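(* Let $N$ be a contact manifold with contact form $\alpha$, with $\dim N\ge 3$, which admits a closed characteristic, and let $M=\mathcal{S}N$ be its symplectization. Then there is no $C^{-1}$ bi-invariant metric on the group $\mathcal{H}(M)$ of Hamiltonian diffeomorphisms of $M$.
   Context: Contact geometry: a contact manifold $(N,\xi)$ with contact form $\alpha$ is a smooth manifold $N$ with a smooth hyperplane field $\xi=\ker\alpha$ such that $d\alpha$ is non-degenerate on $\xi$. Its symplectization is $\mathcal{S}N=\mathbb{R}\times N$ with the symplectic form $\omega=d(e^s\alpha)$, $s$ being the $\mathbb{R}$-coordinate. The Reeb vector field $X_R$ is defined by $\iota_{X_R}d\alpha=0$ and $\alpha(X_R)=1$. Its trajectories are called characteristics; a closed characteristic is a periodic trajectory of $X_R$. Hamiltonian diffeomorphisms: for a smooth function $H$ on a symplectic manifold $(M,\omega)$, $X_H$ is defined by $dH=\iota_{X_H}\omega$. For a smooth path of functions $H=(H_t)_{t\in[0,1]}$, $H_t\in C^\infty(M)$ (no assumption on supports), $\phi_H^t$ denotes the flow generated by $X_{H_t}$, when it exists, and $\phi_H=\phi_H^1$. $\mathit{Ham}$ is the set of such $H$ whose flow exists (as diffeomorphisms of $M$ for all $t\in[0,1]$), $\Phi:\mathit{Ham}\to\mathrm{Diff}(M)$ is $\Phi(H)=\phi_H^1$, and $\mathcal{H}(M)=\Phi(\mathit{Ham})$ is the group of Hamiltonian diffeomorphisms. A bi-invariant metric on a subgroup $\mathcal{G}\subset\mathcal{H}(M)$ is a distance $d$ on $\mathcal{G}$ with $d(\phi,\psi)=d(\phi\chi,\psi\chi)=d(\chi\phi,\chi\psi)$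 for all $\phi,\psi,\chi\in\mathcal{G}$. It is $C^{-1}$ if $(H,K)\mapsto d(\Phi(H),\Phi(K))$ is continuous on $\Phi^{-1}(\mathcal{G})\times\Phi^{-1}(\mathcal{G})$, where $\Phi^{-1}(\mathcal{G})\subset\mathit{Ham}$ carries the compact-open topology (uniform convergence on compact sets). *)

theory Defs
  imports "HOL-Analysis.Analysis"
begin

section \<open>Smooth functions between Euclidean spaces\<close>

primrec Ck_on :: "nat \<Rightarrow> 'a::euclidean_space set \<Rightarrow> ('a \<Rightarrow> 'b::real_normed_vector) \<Rightarrow> bool" where
  "Ck_on 0 S f \<longleftrightarrow> continuous_on S f"
| "Ck_on (Suc k) S f \<longleftrightarrow> (\<forall>x\<in>S. f differentiable (at x)) \<and>
     (\<forall>v. Ck_on k S (\<lambda>x. frechet_derivative f (at x) v))"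

text \<open>On a set that need not be open (below: \<open>{0..1} \<times> V\<close> with \<open>V\<close> open), smoothness
  means that there are local smooth extensions; \<open>Ck_on\<close> itself is only used on open sets.\<close>

definition smooth_on :: "'a::euclidean_space set \<Rightarrow> ('a \<Rightarrow> 'b::real_normed_vector) \<Rightarrow> bool" where
  "smooth_on S f \<longleftrightarrow> (\<forall>x\<in>S. \<exists>V g. open V \<and> x \<in> V \<and> (\<forall>k. Ck_on k V g) \<and> (\<forall>y\<in>V \<inter> S. g y = f y))"

section \<open>Smooth manifolds\<close>

text \<open>A chart is a pair of its domain and its coordinate map; the values of the coordinate map
  outside the domain are irrelevant. The dimension of a manifold is the dimension of the model
  space \<open>'e\<close>.\<close>

type_synonym ('p, 'e) chart = "'p set \<times> ('p \<Rightarrow> 'e)"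

record ('p, 'e) manifold =
  man_top :: "'p topology"
  atlas :: "('p, 'e) chart set"

abbreviation points :: "('p, 'e) manifold \<Rightarrow> 'p set" where
  "points M \<equiv> topspace (man_top M)"

abbreviation chart_inv :: "('p, 'e) chart \<Rightarrow> 'e \<Rightarrow> 'p" where
  "chart_inv c \<equiv> inv_into (fst c) (snd c)"

definition smooth_manifold :: "('p, 'e::euclidean_space) manifold \<Rightarrow> bool" where
  "smooth_manifold M \<longleftrightarrow>
     Hausdorff_space (man_top M) \<and> second_countable (man_top M) \<and>
     (\<forall>c\<in>atlas M. openin (man_top M) (fst c) \<and> open (snd c ` fst c) \<and>
        homeomorphic_map (subtopology (man_top M) (fst c)) (top_of_set (snd c ` fst c)) (snd c)) \<and>
     (\<Union>c\<in>atlas M. fst c) = points M \<and>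
     (\<forall>c\<in>atlas M. \<forall>c'\<in>atlas M. smooth_on (snd c ` (fst c \<inter> fst c')) (snd c' \<circ> chart_inv c))"

definition charts_at :: "('p, 'e) manifold \<Rightarrow> 'p \<Rightarrow> ('p, 'e) chart set" where
  "charts_at M p = {c \<in> atlas M. p \<in> fst c}"

definition chart_at :: "('p, 'e) manifold \<Rightarrow> 'p \<Rightarrow> ('p, 'e) chart" where
  "chart_at M p = (SOME c. c \<in> charts_at M p)"

definition smooth_map ::
    "('p, 'e::euclidean_space) manifold \<Rightarrow> ('q, 'f::euclidean_space) manifold \<Rightarrow> ('p \<Rightarrow> 'q) \<Rightarrow> bool" where
  "smooth_map M N f \<longleftrightarrow> continuous_map (man_top M) (man_top N) f \<and>
     (\<forall>c\<in>atlas M. \<forall>c'\<in>atlas N.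
        smooth_on (snd c ` {p \<in> fst c. f p \<in> fst c'}) (snd c' \<circ> f \<circ> chart_inv c))"

text \<open>Diffeomorphisms of \<open>M\<close>, as functions on the carrier: they take the value
  \<open>undefined\<close> elsewhere, so that equality is equality on \<open>M\<close>.\<close>

definition Diff :: "('p, 'e::euclidean_space) manifold \<Rightarrow> ('p \<Rightarrow> 'p) set" where
  "Diff M = {f \<in> extensional (points M). bij_betw f (points M) (points M) \<and>
     smooth_map M M f \<and> smooth_map M M (inv_into (points M) f)}"

section \<open>Tangent vectors\<close>

text \<open>A tangent vector at \<open>p\<close> is the family of its coordinate vectors in all charts around \<open>p\<close>,
  related by the derivatives of the transition maps.\<close>

type_synonym ('p, 'e) tangent = "('p, 'e) chart \<Rightarrow> 'e"

definition tangent_space :: "('p, 'e::euclidean_space) manifold \<Rightarrow> 'p \<Rightarrow> ('p, 'e) tangent set" where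
  "tangent_space M p = {v \<in> extensional (charts_at M p).
     \<forall>c\<in>charts_at M p. \<forall>c'\<in>charts_at M p.
       v c' = frechet_derivative (snd c' \<circ> chart_inv c) (at (snd c p)) (v c)}"

definition zero_tangent :: "('p, 'e::euclidean_space) manifold \<Rightarrow> 'p \<Rightarrow> ('p, 'e) tangent" where
  "zero_tangent M p = (\<lambda>c\<in>charts_at M p. 0)"

text \<open>The tangent vector at \<open>p\<close> whose coordinate vector in the chart \<open>c\<close> is \<open>u\<close>.\<close>

definition tangent_of ::
    "('p, 'e::euclidean_space) manifold \<Rightarrow> 'p \<Rightarrow> ('p, 'e) chart \<Rightarrow> 'e \<Rightarrow> ('p, 'e) tangent" where
  "tangent_of M p c u =
     (\<lambda>c'\<in>charts_at M p. frechet_derivative (snd c' \<circ> chart_inv c) (at (snd c p)) u)"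

text \<open>The differential of a map at \<open>p\<close>; for smooth maps the choice of the chart at \<open>p\<close>
  does not matter.\<close>

definition pushforward ::
    "('p, 'e::euclidean_space) manifold \<Rightarrow> ('q, 'f::euclidean_space) manifold \<Rightarrow> ('p \<Rightarrow> 'q) \<Rightarrow>
     'p \<Rightarrow> ('p, 'e) tangent \<Rightarrow> ('q, 'f) tangent" where
  "pushforward M N f p v = (let c = chart_at M p in
     (\<lambda>c'\<in>charts_at N (f p).
        frechet_derivative (snd c' \<circ> f \<circ> chart_inv c) (at (snd c p)) (v c)))"

definition integral_curve ::
    "('p, 'e::euclidean_space) manifold \<Rightarrow> (real \<Rightarrow> 'p \<Rightarrow> ('p, 'e) tangent) \<Rightarrow> real set \<Rightarrow>
     (real \<Rightarrow> 'p) \<Rightarrow> bool" where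
  "integral_curve M X I \<gamma> \<longleftrightarrow> continuous_map (top_of_set I) (man_top M) \<gamma> \<and>
     (\<forall>t\<in>I. \<forall>c\<in>charts_at M (\<gamma> t).
        ((\<lambda>s. snd c (\<gamma> s)) has_vector_derivative X t (\<gamma> t) c) (at t within I))"

section \<open>Differential forms\<close>

type_synonym ('p, 'e) one_form = "'p \<Rightarrow> ('p, 'e) tangent \<Rightarrow> real"
type_synonym ('p, 'e) two_form = "'p \<Rightarrow> ('p, 'e) tangent \<Rightarrow> ('p, 'e) tangent \<Rightarrow> real"

text \<open>The expression of a one-form in the coordinates of the chart \<open>c\<close>.\<close>

definition local_form ::
    "('p, 'e::euclidean_space) manifold \<Rightarrow> ('p, 'e) one_form \<Rightarrow> ('p, 'e) chart \<Rightarrow> 'e \<Rightarrow> 'e \<Rightarrow> real" where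
  "local_form M \<beta> c x u = \<beta> (chart_inv c x) (tangent_of M (chart_inv c x) c u)"

definition smooth_one_form :: "('p, 'e::euclidean_space) manifold \<Rightarrow> ('p, 'e) one_form \<Rightarrow> bool" where
  "smooth_one_form M \<beta> \<longleftrightarrow> (\<forall>c\<in>atlas M.
     (\<forall>x\<in>snd c ` fst c. linear (local_form M \<beta> c x)) \<and>
     (\<forall>u. smooth_on (snd c ` fst c) (\<lambda>x. local_form M \<beta> c x u)))"

definition differential :: "('p, 'e::euclidean_space) manifold \<Rightarrow> ('p \<Rightarrow> real) \<Rightarrow> ('p, 'e) one_form" where
  "differential M h p v = (let c = chart_at M p in
     frechet_derivative (h \<circ> chart_inv c) (at (snd c p)) (v c))"

text \<open>In coordinates, \<open>d\<beta>(v, w) = D\<^sub>v(\<beta>(w)) - D\<^sub>w(\<beta>(v))\<close> with \<open>v\<close> and \<open>w\<close> extended as constant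
  vector fields; for smooth \<open>\<beta>\<close> this does not depend on the chart.\<close>

definition ext_deriv :: "('p, 'e::euclidean_space) manifold \<Rightarrow> ('p, 'e) one_form \<Rightarrow> ('p, 'e) two_form" where
  "ext_deriv M \<beta> p v w = (let c = chart_at M p in
     frechet_derivative (\<lambda>x. local_form M \<beta> c x (w c)) (at (snd c p)) (v c) -
     frechet_derivative (\<lambda>x. local_form M \<beta> c x (v c)) (at (snd c p)) (w c))"

section \<open>Contact manifolds and symplectizations\<close>

definition contact_manifold :: "('p, 'e::euclidean_space) manifold \<Rightarrow> ('p, 'e) one_form \<Rightarrow> bool" where
  "contact_manifold N \<alpha> \<longleftrightarrow> smooth_manifold N \<and> smooth_one_form N \<alpha> \<and>
     (\<forall>p\<in>points N.
        (\<exists>v\<in>tangent_space N p. \<alpha> p v \<noteq> 0) \<and>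
        (\<forall>v\<in>tangent_space N p. \<alpha> p v = 0 \<longrightarrow>
           (\<forall>w\<in>tangent_space N p. \<alpha> p w = 0 \<longrightarrow> ext_deriv N \<alpha> p v w = 0) \<longrightarrow>
           v = zero_tangent N p))"

definition reeb_field :: "('p, 'e::euclidean_space) manifold \<Rightarrow> ('p, 'e) one_form \<Rightarrow> 'p \<Rightarrow> ('p, 'e) tangent" where
  "reeb_field N \<alpha> p = (THE v. v \<in> tangent_space N p \<and>
     (\<forall>w\<in>tangent_space N p. ext_deriv N \<alpha> p v w = 0) \<and> \<alpha> p v = 1)"

definition closed_characteristic ::
    "('p, 'e::euclidean_space) manifold \<Rightarrow> ('p, 'e) one_form \<Rightarrow> (real \<Rightarrow> 'p) \<Rightarrow> bool" where
  "closed_characteristic N \<alpha> \<gamma> \<longleftrightarrow>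
     integral_curve N (\<lambda>_. reeb_field N \<alpha>) UNIV \<gamma> \<and> (\<exists>T>0. \<forall>t. \<gamma> (t + T) = \<gamma> t)"

definition symplectization :: "('p, 'e) manifold \<Rightarrow> (real \<times> 'p, real \<times> 'e) manifold" where
  "symplectization N = \<lparr>man_top = prod_topology euclideanreal (man_top N),
     atlas = (\<lambda>c. (UNIV \<times> fst c, map_prod id (snd c))) ` atlas N\<rparr>"

definition symplectization_form ::
    "('p, 'e::euclidean_space) manifold \<Rightarrow> ('p, 'e) one_form \<Rightarrow> (real \<times> 'p, real \<times> 'e) two_form" where
  "symplectization_form N \<alpha> = ext_deriv (symplectization N)
     (\<lambda>z v. exp (fst z) * \<alpha> (snd z) (pushforward (symplectization N) N snd z v))"

section \<open>Hamiltonian diffeomorphisms\<close>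

definition ham_field ::
    "('p, 'e::euclidean_space) manifold \<Rightarrow> ('p, 'e) two_form \<Rightarrow> ('p \<Rightarrow> real) \<Rightarrow> 'p \<Rightarrow> ('p, 'e) tangent" where
  "ham_field M \<omega> h p = (THE v. v \<in> tangent_space M p \<and>
     (\<forall>w\<in>tangent_space M p. differential M h p w = \<omega> p v w))"

text \<open>A path \<open>(H\<^sub>t)\<close> of functions on \<open>M\<close> is a single function on \<open>{0..1} \<times> M\<close>.\<close>

definition ham_flow ::
    "('p, 'e::euclidean_space) manifold \<Rightarrow> ('p, 'e) two_form \<Rightarrow> (real \<times> 'p \<Rightarrow> real) \<Rightarrow>
     (real \<Rightarrow> 'p \<Rightarrow> 'p) \<Rightarrow> bool" where
  "ham_flow M \<omega> H \<phi> \<longleftrightarrow>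
     (\<forall>t\<in>{0..1}. \<phi> t \<in> Diff M) \<and>
     (\<forall>p\<in>points M. \<phi> 0 p = p \<and>
        integral_curve M (\<lambda>t. ham_field M \<omega> (\<lambda>q. H (t, q))) {0..1} (\<lambda>t. \<phi> t p))"

definition Ham :: "('p, 'e::euclidean_space) manifold \<Rightarrow> ('p, 'e) two_form \<Rightarrow> (real \<times> 'p \<Rightarrow> real) set" where
  "Ham M \<omega> = {H \<in> extensional ({0..1} \<times> points M).
     (\<forall>c\<in>atlas M. smooth_on ({0..1} \<times> snd c ` fst c) (\<lambda>(t, x). H (t, chart_inv c x))) \<and>
     (\<exists>\<phi>. ham_flow M \<omega> H \<phi>)}"

definition time_one_map ::
    "('p, 'e::euclidean_space) manifold \<Rightarrow> ('p, 'e) two_form \<Rightarrow> (real \<times> 'p \<Rightarrow> real) \<Rightarrow> 'p \<Rightarrow> 'p" where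
  "time_one_map M \<omega> H = (THE \<psi>. \<exists>\<phi>. ham_flow M \<omega> H \<phi> \<and> \<psi> = \<phi> 1)"

definition ham_group :: "('p, 'e::euclidean_space) manifold \<Rightarrow> ('p, 'e) two_form \<Rightarrow> ('p \<Rightarrow> 'p) set" where
  "ham_group M \<omega> = time_one_map M \<omega> ` Ham M \<omega>"

section \<open>Bi-invariant metrics\<close>

definition bi_invariant_metric ::
    "('p, 'e) manifold \<Rightarrow> ('p \<Rightarrow> 'p) set \<Rightarrow> (('p \<Rightarrow> 'p) \<Rightarrow> ('p \<Rightarrow> 'p) \<Rightarrow> real) \<Rightarrow> bool" where
  "bi_invariant_metric M G d \<longleftrightarrow> Metric_space G d \<and>
     (\<forall>\<phi>\<in>G. \<forall>\<psi>\<in>G. \<forall>\<eta>\<in>G.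
        d (compose (points M) \<phi> \<eta>) (compose (points M) \<psi> \<eta>) = d \<phi> \<psi> \<and>
        d (compose (points M) \<eta> \<phi>) (compose (points M) \<eta> \<psi>) = d \<phi> \<psi>)"

definition compact_open_topology :: "'a topology \<Rightarrow> 'b topology \<Rightarrow> ('a \<Rightarrow> 'b) topology" where
  "compact_open_topology X Y = topology_generated_by
     {{f \<in> extensional (topspace X). continuous_map X Y f \<and> f ` K \<subseteq> U} | K U.
        compactin X K \<and> openin Y U}"

definition C_minus_one ::
    "('p, 'e::euclidean_space) manifold \<Rightarrow> ('p, 'e) two_form \<Rightarrow> ('p \<Rightarrow> 'p) set \<Rightarrow>
     (('p \<Rightarrow> 'p) \<Rightarrow> ('p \<Rightarrow> 'p) \<Rightarrow> real) \<Rightarrow> bool" where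
  "C_minus_one M \<omega> G d \<longleftrightarrow>
     (let T = subtopology
                (compact_open_topology (prod_topology (top_of_set {0..1}) (man_top M)) euclideanreal)
                {H \<in> Ham M \<omega>. time_one_map M \<omega> H \<in> G}
      in continuous_map (prod_topology T T) euclideanreal
           (\<lambda>(H, K). d (time_one_map M \<omega> H) (time_one_map M \<omega> K)))"

end

theory Submission
  imports Defs
begin

text \<open>Let \<open>\<phi>\<close> be a nontrivial Hamiltonian diffeomorphism supported in a small ball \<open>B\<close> around a point
  \<open>z\<close> of \<open>\<real> \<times> N\<close> (the closed characteristic only provides a point). If \<open>B\<close> can be moved by Hamiltonian
  diffeomorphisms into \<open>{s \<ge> n}\<close> for every \<open>n\<close>, then \<open>\<phi>\<close> is conjugate to time-one maps of Hamiltonians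
  supported in \<open>{s \<ge> n}\<close>. These tend to \<open>0\<close> in the compact-open topology, so by bi-invariance and
  continuity the distance of \<open>\<phi>\<close> to the identity is \<open>0\<close>.

  To move \<open>B\<close>, choose \<open>H\<close> whose field \<open>X\<close> satisfies \<open>X(z) = \<partial>\<^sub>s\<close> and, in coordinates, \<open>DX(z) = -1/2\<close>.
  This 2-jet is possible because \<open>X - \<partial>\<^sub>s\<close> is conformally symplectic with factor \<open>-1\<close>. For small \<open>c\<close>,
  the time-one map \<open>\<eta>\<close> of \<open>c H\<close> then maps \<open>B\<close> into its translate by \<open>c\<close> in the \<open>s\<close>-direction.
  Translations rescale the symplectic form, so they conjugate \<open>\<eta>\<close> to Hamiltonian diffeomorphisms that
  push the successive translates of \<open>B\<close> further up.\<close>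

section \<open>Calculus of \<open>C\<^sup>k\<close> functions\<close>

text \<open>The flow of \<open>\<partial>_s\<close> itself moves the ball upwards, but it rescales
  the symplectic form, so it is not Hamiltonian. The rescaling is also what makes the replacement
  possible: a ball of the same coordinate radius higher up has larger symplectic volume, hence room
  for a contracted image of the lower one. The value -1/2 is the multiple of the identity that fits
  the factor -1: \<open>W(Au, w) + W(u, Aw) = - W(u, w)\<close> holds for \<open>A = -1/2\<close>.
  This strict contraction pays for the nonlinear part of the field and for replacing the time-one
  map by one Euler step. Everything happens in one chart, a product of the real line with a chart
  image, which is invariant under translations in the s-direction; maps are extended by the
  identity. Flows come from Picard iteration for fields with Lipschitz constant at most 1/2, where
  one iteration covers the whole interval [0, 1]; a small factor brings every compactly supported
  field into this range. Conjugated flows are not iterated anew but carried along as explicit data,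
  so flow, inverse and support are bundled in one locale.\<close>

lemma frechet_derivative_eqI:
  "(f has_derivative f') (at x) \<Longrightarrow> frechet_derivative f (at x) = f'"
  using frechet_derivative_at by metis

lemma Ck_on_cong:
  assumes "open S" "\<And>x. x \<in> S \<Longrightarrow> f x = g x"
  shows "Ck_on k S f \<longleftrightarrow> Ck_on k S g"
  using assms(2)
proof (induction k arbitrary: f g)
  case 0
  then show ?case by (simp cong: continuous_on_cong)
next
  case (Suc k)
  have d: "(f has_derivative D) (at x) \<longleftrightarrow> (g has_derivative D) (at x)" if "x \<in> S" for x D
    using has_derivative_transform_within_open[of f D x UNIV S g]
      has_derivative_transform_within_open[of g D x UNIV S f] assms(1) that Suc.prems by auto
  have fd: "frechet_derivative f (at x) = frechet_derivative g (at x)" if "x \<in> S" for x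
    unfolding frechet_derivative_def using d[OF that] by simp
  have "Ck_on k S (\<lambda>x. frechet_derivative f (at x) v) =
        Ck_on k S (\<lambda>x. frechet_derivative g (at x) v)" for v
    by (rule Suc.IH) (simp add: fd)
  moreover have "(\<forall>x\<in>S. f differentiable at x) \<longleftrightarrow> (\<forall>x\<in>S. g differentiable at x)"
    unfolding differentiable_def using d by blast
  ultimately show ?case by simp
qed

lemma Ck_on_subset: "Ck_on k S f \<Longrightarrow> T \<subseteq> S \<Longrightarrow> Ck_on k T f"
  by (induction k arbitrary: f) (auto intro: continuous_on_subset)

text \<open>Derivatives are taken at points of the whole space, so neighbourhoods of the single
  points carry all the information, whatever the shape of \<open>S\<close>.\<close>

lemma Ck_on_local:
  assumes "\<And>x. x \<in> S \<Longrightarrow> \<exists>V. open V \<and> x \<in> V \<and> Ck_on k V f"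
  shows "Ck_on k S f"
  using assms
proof (induction k arbitrary: f)
  case 0
  then have "\<forall>x\<in>S. isCont f x"
    by (metis Ck_on.simps(1) continuous_on_eq_continuous_at)
  then show ?case by (simp add: continuous_at_imp_continuous_on)
next
  case (Suc k)
  then show ?case by fastforce
qed

lemma Ck_on_imp_continuous_on: "Ck_on k S f \<Longrightarrow> continuous_on S f"
  by (cases k) (auto intro!: continuous_at_imp_continuous_on differentiable_imp_continuous_within)

lemma Ck_on_SucD: "Ck_on (Suc k) S f \<Longrightarrow> Ck_on k S f"
proof (induction k arbitrary: f)
  case 0
  then show ?case using Ck_on_imp_continuous_on[OF 0] by simp
next
  case (Suc k)
  then show ?case
    by (metis Ck_on.simps(2))
qed

lemma Ck_on_has_derivative:
  "Ck_on (Suc k) S f \<Longrightarrow> x \<in> S \<Longrightarrow> (f has_derivative frechet_derivative f (at x)) (at x)"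
  by (simp add: frechet_derivative_works)

lemma Ck_on_const [simp]: "Ck_on k S (\<lambda>x. c)"
  by (induction k arbitrary: c) auto

lemma Ck_on_bounded_linear:
  assumes "bounded_linear f"
  shows "Ck_on k S f"
proof (cases k)
  case 0
  then show ?thesis using assms by (simp add: linear_continuous_on)
next
  case (Suc n)
  have d: "(f has_derivative f) (at x)" for x
    using assms by (rule bounded_linear_imp_has_derivative)
  then have "f differentiable at x" for x unfolding differentiable_def by blast
  then show ?thesis unfolding Suc by (simp add: frechet_derivative_eqI[OF d])
qed

lemma frechet_derivative_add:
  assumes "f differentiable at x" "g differentiable at x"
  shows "frechet_derivative (\<lambda>x. f x + g x) (at x) v =
    frechet_derivative f (at x) v + frechet_derivative g (at x) v"
  using frechet_derivative_eqI[OF has_derivative_add[OF assms[unfolded frechet_derivative_works]]]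
  by simp

lemma (in bounded_bilinear) frechet_derivative:
  assumes "f differentiable at x" "g differentiable at x"
  shows "frechet_derivative (\<lambda>x. prod (f x) (g x)) (at x) v =
    prod (f x) (frechet_derivative g (at x) v) + prod (frechet_derivative f (at x) v) (g x)"
  using frechet_derivative_eqI[OF FDERIV[OF assms[unfolded frechet_derivative_works]]]
  by simp

lemma Ck_on_add:
  assumes "open S" "Ck_on k S f" "Ck_on k S g"
  shows "Ck_on k S (\<lambda>x. f x + g x)"
  using assms(2-)
proof (induction k arbitrary: f g)
  case 0
  then show ?case by (simp add: continuous_on_add)
next
  case (Suc k)
  have "Ck_on k S (\<lambda>x. frechet_derivative (\<lambda>x. f x + g x) (at x) v)" for v
    using Suc
    by (subst Ck_on_cong[where g = "\<lambda>x. frechet_derivative f (at x) v + frechet_derivative g (at x) v"])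
      (auto simp: assms frechet_derivative_add)
  with Suc.prems show ?case by simp
qed

lemma Ck_on_sum:
  assumes "open S" "\<And>i. i \<in> I \<Longrightarrow> Ck_on k S (f i)"
  shows "Ck_on k S (\<lambda>x. \<Sum>i\<in>I. f i x)"
  using assms(2)
  by (induction I rule: infinite_finite_induct) (auto intro: Ck_on_add assms(1))

lemma (in bounded_bilinear) Ck_on:
  fixes f :: "'z::euclidean_space \<Rightarrow> 'a"
  assumes "open S" "Ck_on k S f" "Ck_on k S g"
  shows "Ck_on k S (\<lambda>x. prod (f x) (g x))"
  using assms(2-)
proof (induction k arbitrary: f g)
  case 0
  then show ?case by (simp add: continuous_on)
next
  case (Suc k)
  have "Ck_on k S (\<lambda>x. frechet_derivative (\<lambda>x. prod (f x) (g x)) (at x) v)" for v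
  proof (subst Ck_on_cong[where g = "\<lambda>x. prod (f x) (frechet_derivative g (at x) v) +
         prod (frechet_derivative f (at x) v) (g x)"])
    show "Ck_on k S (\<lambda>x. prod (f x) (frechet_derivative g (at x) v) +
         prod (frechet_derivative f (at x) v) (g x))"
      using Suc.prems Ck_on_SucD[OF Suc.prems(1)] Ck_on_SucD[OF Suc.prems(2)]
      by (intro Ck_on_add assms(1) Suc.IH) auto
  qed (use Suc.prems in \<open>auto simp: frechet_derivative assms(1)\<close>)
  moreover have "(\<lambda>x. prod (f x) (g x)) differentiable at x" if "x \<in> S" for x
    using FDERIV[OF Ck_on_has_derivative[OF Suc.prems(1) that] Ck_on_has_derivative[OF Suc.prems(2) that]]
    by (rule differentiableI)
  ultimately show ?case by simp
qed

lemmas Ck_on_scaleR = bounded_bilinear.Ck_on[OF bounded_bilinear_scaleR]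
lemmas Ck_on_mult = bounded_bilinear.Ck_on[OF bounded_bilinear_mult]
lemmas Ck_on_inner = bounded_bilinear.Ck_on[OF bounded_bilinear_inner]

lemma frechet_derivative_bounded_linear:
  assumes "bounded_linear L" "f differentiable at x"
  shows "frechet_derivative (\<lambda>x. L (f x)) (at x) v = L (frechet_derivative f (at x) v)"
  using frechet_derivative_eqI[OF bounded_linear.has_derivative[OF assms(1)
      assms(2)[unfolded frechet_derivative_works]]] by simp

lemma Ck_on_bounded_linear_compose:
  assumes "open S" "bounded_linear L" "Ck_on k S f"
  shows "Ck_on k S (\<lambda>x. L (f x))"
  using assms(3)
proof (induction k arbitrary: f)
  case 0
  then show ?case
    using assms(2) by (simp add: bounded_linear.continuous_on)
next
  case (Suc k)
  have "Ck_on k S (\<lambda>x. frechet_derivative (\<lambda>x. L (f x)) (at x) v)" for v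
    using Suc by (subst Ck_on_cong[where g = "\<lambda>x. L (frechet_derivative f (at x) v)"])
      (auto simp: assms frechet_derivative_bounded_linear)
  moreover have "(\<lambda>x. L (f x)) differentiable at x" if "x \<in> S" for x
    using bounded_linear.has_derivative[OF assms(2) Ck_on_has_derivative[OF Suc.prems that]]
    by (rule differentiableI)
  ultimately show ?case by simp
qed

lemma Ck_on_uminus: "open S \<Longrightarrow> Ck_on k S f \<Longrightarrow> Ck_on k S (\<lambda>x. - f x)"
  using Ck_on_bounded_linear_compose[OF _ bounded_linear_minus[OF bounded_linear_ident]] by blast

lemma Ck_on_diff: "open S \<Longrightarrow> Ck_on k S f \<Longrightarrow> Ck_on k S g \<Longrightarrow> Ck_on k S (\<lambda>x. f x - g x)"
  using Ck_on_add[of S k f "\<lambda>x. - g x"] Ck_on_uminus[of S k g] by simp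

lemma linear_sum_Basis:
  fixes f :: "'a::euclidean_space \<Rightarrow> 'b::real_vector"
  assumes "linear f"
  shows "f v = (\<Sum>i\<in>Basis. (v \<bullet> i) *\<^sub>R f i)"
proof -
  have "f v = f (\<Sum>i\<in>Basis. (v \<bullet> i) *\<^sub>R i)" by (simp add: euclidean_representation)
  also have "\<dots> = (\<Sum>i\<in>Basis. (v \<bullet> i) *\<^sub>R f i)"
    using assms by (simp add: linear_sum linear_scale)
  finally show ?thesis .
qed

lemma linear_frechet_derivative':
  "f differentiable at x \<Longrightarrow> linear (frechet_derivative f (at x))"
  using linear_frechet_derivative by blast

text \<open>\<open>Ck_on\<close> asks for every direction \<open>v\<close>; linearity of the
  derivative leaves finitely many to check.\<close>

lemma Ck_on_Suc_BasisI:
  assumes "open S" "\<And>x. x \<in> S \<Longrightarrow> f differentiable at x"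
    "\<And>i. i \<in> Basis \<Longrightarrow> Ck_on k S (\<lambda>x. frechet_derivative f (at x) i)"
  shows "Ck_on (Suc k) S f"
proof -
  have "Ck_on k S (\<lambda>x. frechet_derivative f (at x) v)" for v
    by (subst Ck_on_cong[where g = "\<lambda>x. \<Sum>i\<in>Basis. (v \<bullet> i) *\<^sub>R frechet_derivative f (at x) i"])
      (auto intro!: Ck_on_sum Ck_on_scaleR linear_sum_Basis linear_frechet_derivative' assms)
  with assms(2) show ?thesis by simp
qed

lemma frechet_derivative_comp:
  assumes "g differentiable at x" "f differentiable at (g x)"
  shows "frechet_derivative (\<lambda>x. f (g x)) (at x) v =
    frechet_derivative f (at (g x)) (frechet_derivative g (at x) v)"
  using frechet_derivative_compose[OF assms] by (simp add: o_def fun_eq_iff)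

text \<open>By the chain rule the derivative of \<open>f\<close> is evaluated in a direction that
  varies with \<open>x\<close>, whereas \<open>Ck_on\<close> controls fixed directions. Expanding
  that direction in the basis leaves sums of products whose factors the induction hypothesis
  covers.\<close>

lemma Ck_on_compose:
  assumes "open S" "open T" "Ck_on k S g" "Ck_on k T f" "g ` S \<subseteq> T"
  shows "Ck_on k S (\<lambda>x. f (g x))"
  using assms(3,4)
proof (induction k arbitrary: f)
  case 0
  then show ?case using assms(5) by (auto intro: continuous_on_compose2)
next
  case (Suc k)
  have gT: "g x \<in> T" if "x \<in> S" for x using that assms(5) by auto
  have dg: "g differentiable at x" and df: "f differentiable at (g x)" if "x \<in> S" for x
    using Suc.prems that gT by auto
  have "Ck_on k S (\<lambda>x. frechet_derivative (\<lambda>x. f (g x)) (at x) v)" for v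
  proof (subst Ck_on_cong[where g = "\<lambda>x. \<Sum>i\<in>Basis. (frechet_derivative g (at x) v \<bullet> i) *\<^sub>R
           frechet_derivative f (at (g x)) i"])
    show "frechet_derivative (\<lambda>x. f (g x)) (at x) v =
       (\<Sum>i\<in>Basis. (frechet_derivative g (at x) v \<bullet> i) *\<^sub>R frechet_derivative f (at (g x)) i)"
      if "x \<in> S" for x
      by (rule trans[OF frechet_derivative_comp[OF dg[OF that] df[OF that]]
            linear_sum_Basis[OF linear_frechet_derivative'[OF df[OF that]]]])
    show "Ck_on k S (\<lambda>x. \<Sum>i\<in>Basis. (frechet_derivative g (at x) v \<bullet> i) *\<^sub>R
           frechet_derivative f (at (g x)) i)"
      using Suc.prems Ck_on_SucD[OF Suc.prems(1)]
      by (intro Ck_on_sum Ck_on_scaleR Ck_on_inner assms(1) Suc.IH Ck_on_const) simp_all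
  qed (use assms in auto)
  moreover have "(\<lambda>x. f (g x)) differentiable at x" if "x \<in> S" for x
    using differentiable_chain_at[OF dg[OF that] df[OF that]] by (simp add: o_def)
  ultimately show ?case by simp
qed

lemma smooth_on_open:
  assumes "open S"
  shows "smooth_on S f \<longleftrightarrow> (\<forall>k. Ck_on k S f)"
proof
  assume sm: "smooth_on S f"
  show "\<forall>k. Ck_on k S f"
  proof (intro allI Ck_on_local)
    fix k x assume "x \<in> S"
    then obtain V g where V: "open V" "x \<in> V" "\<And>k. Ck_on k V g" "\<And>y. y\<in>V \<inter> S \<Longrightarrow> g y = f y"
      using sm unfolding smooth_on_def by metis
    have "Ck_on k (V \<inter> S) f"
      using V(1,3,4) assms Ck_on_cong[of "V \<inter> S" g f k] Ck_on_subset[of k V g "V \<inter> S"] by auto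
    then show "\<exists>V. open V \<and> x \<in> V \<and> Ck_on k V f"
      using V assms \<open>x \<in> S\<close> by blast
  qed
next
  assume "\<forall>k. Ck_on k S f"
  then show "smooth_on S f"
    unfolding smooth_on_def using assms by blast
qed

text \<open>Two applications of the mean value theorem, in either order of the directions, write the
  second difference of \<open>f\<close> over a small parallelogram as \<open>h * h\<close> times
  either mixed derivative at some point of it; continuity at \<open>x\<close> then forces
  equality.\<close>

lemma symmetric_second_derivative:
  fixes f :: "'a::euclidean_space \<Rightarrow> real"
  assumes "open S" "Ck_on 2 S f" "x \<in> S"
  shows "frechet_derivative (\<lambda>y. frechet_derivative f (at y) u) (at x) v =
         frechet_derivative (\<lambda>y. frechet_derivative f (at y) v) (at x) u"
proof (rule ccontr)
  define d where "d v g y = frechet_derivative g (at y) v" for v :: 'a and g :: "'a \<Rightarrow> real" and y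
  have C: "Ck_on (Suc (Suc 0)) S f" using assms(2) by (simp add: numeral_2_eq_2)
  have df: "f differentiable at y" and ddf: "d w f differentiable at y"
    and cont: "continuous_on S (d w' (d w f))" if "y \<in> S" for y w w'
    using C that unfolding d_def by auto
  have mv: "\<exists>\<xi>>0. \<xi> < h \<and> g (y + h *\<^sub>R w) - g y = h * d w g (y + \<xi> *\<^sub>R w)"
    if h: "0 < h" and g: "\<And>\<xi>. 0 \<le> \<xi> \<Longrightarrow> \<xi> \<le> h \<Longrightarrow> g differentiable at (y + \<xi> *\<^sub>R w)"
    for g y w and h :: real
  proof -
    have "((\<lambda>s. g (y + s *\<^sub>R w)) has_real_derivative d w g (y + \<xi> *\<^sub>R w)) (at \<xi>)"
      if "0 \<le> \<xi>" "\<xi> \<le> h" for \<xi>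
    proof -
      have D: "(g has_derivative frechet_derivative g (at (y + \<xi> *\<^sub>R w))) (at (y + \<xi> *\<^sub>R w))"
        using g[OF that] by (simp add: frechet_derivative_works)
      have "((\<lambda>s. g (y + s *\<^sub>R w)) has_derivative
          (\<lambda>s. frechet_derivative g (at (y + \<xi> *\<^sub>R w)) (s *\<^sub>R w))) (at \<xi>)"
        by (rule has_derivative_compose[of "\<lambda>s. y + s *\<^sub>R w" _ _ _ g, OF _ D])
          (auto intro!: derivative_eq_intros)
      moreover have "(\<lambda>s. frechet_derivative g (at (y + \<xi> *\<^sub>R w)) (s *\<^sub>R w)) =
          (*) (d w g (y + \<xi> *\<^sub>R w))"
        using linear_scale[OF linear_frechet_derivative'[OF g[OF that]]]
        by (simp add: d_def fun_eq_iff)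
      ultimately show ?thesis by (simp add: has_field_derivative_def)
    qed
    from MVT2[OF h this] show ?thesis by auto
  qed
  assume "\<not> ?thesis"
  then have ne: "d v (d u f) x \<noteq> d u (d v f) x" by (simp add: d_def[abs_def])
  \<comment> \<open>Half the gap: a number within \<open>e\<close> of one mixed derivative at
    \<open>x\<close> cannot be within \<open>e\<close> of the other.\<close>
  define e where "e = dist (d v (d u f) x) (d u (d v f) x) / 2"
  have e: "e > 0" using ne by (simp add: e_def)
  have "isCont (d v (d u f)) x" "isCont (d u (d v f)) x"
    using cont[OF assms(3)] assms(1,3) continuous_on_eq_continuous_at by blast+
  then obtain \<delta>1 \<delta>2 where \<delta>: "\<delta>1 > 0" "\<And>y. dist y x < \<delta>1 \<Longrightarrow> dist (d v (d u f) y) (d v (d u f) x) < e"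
     "\<delta>2 > 0" "\<And>y. dist y x < \<delta>2 \<Longrightarrow> dist (d u (d v f) y) (d u (d v f) x) < e"
    using e unfolding continuous_at_eps_delta by metis
  obtain \<delta>3 where \<delta>3: "\<delta>3 > 0" "ball x \<delta>3 \<subseteq> S"
    using assms(1,3) openE by blast
  define \<delta> where "\<delta> = min \<delta>1 (min \<delta>2 \<delta>3)"
  \<comment> \<open>With this \<open>h\<close> the parallelogram stays within
    \<open>\<delta> / 2\<close> of \<open>x\<close>; the summand 1 covers
    \<open>u = v = 0\<close>.\<close>
  define h where "h = \<delta> / (norm u + norm v + 1) / 2"
  have n0: "norm u + norm v + 1 > 0" by (smt (verit) norm_ge_zero)
  have h: "h > 0" using \<delta> \<delta>3 n0 by (simp add: h_def \<delta>_def)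
  have near: "dist (x + s *\<^sub>R u + t *\<^sub>R v) x < \<delta>" if "0 \<le> s" "s \<le> h" "0 \<le> t" "t \<le> h" for s t
  proof -
    have "dist (x + s *\<^sub>R u + t *\<^sub>R v) x \<le> s * norm u + t * norm v"
      using norm_triangle_ineq[of "s *\<^sub>R u" "t *\<^sub>R v"] that by (simp add: dist_norm add.assoc)
    also have "\<dots> \<le> h * norm u + h * norm v"
      using that by (intro add_mono mult_right_mono) auto
    also have "\<dots> \<le> h * (norm u + norm v + 1)" using h by (simp add: algebra_simps)
    also have "\<dots> = \<delta> / 2" using n0 by (simp add: h_def field_simps)
    also have "\<dots> < \<delta>" using \<delta>(1,3) \<delta>3(1) by (auto simp: \<delta>_def)
    finally show ?thesis .
  qed
  have inS: "x + s *\<^sub>R u + t *\<^sub>R v \<in> S" if "0 \<le> s" "s \<le> h" "0 \<le> t" "t \<le> h" for s t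
    using near[OF that] \<delta>3(2) by (auto simp: \<delta>_def dist_commute subset_iff)
  have key: "\<exists>s t. 0 \<le> s \<and> s \<le> h \<and> 0 \<le> t \<and> t \<le> h \<and>
      f (x + h *\<^sub>R a + h *\<^sub>R b) - f (x + h *\<^sub>R a) - f (x + h *\<^sub>R b) + f x =
        h * h * d b (d a f) (x + s *\<^sub>R a + t *\<^sub>R b)"
    if inS: "\<And>s t. 0 \<le> s \<Longrightarrow> s \<le> h \<Longrightarrow> 0 \<le> t \<Longrightarrow> t \<le> h \<Longrightarrow> x + s *\<^sub>R a + t *\<^sub>R b \<in> S" for a b
  proof -
    \<comment> \<open>The first difference in direction \<open>b\<close>. Its mean value along
      \<open>a\<close>, followed by one along \<open>b\<close>, produces the mixed
      derivative.\<close>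
    let ?g = "\<lambda>y. f (y + h *\<^sub>R b) - f y"
    have dg: "?g differentiable at (x + s *\<^sub>R a)"
      and dgv: "d a ?g (x + s *\<^sub>R a) = d a f (x + s *\<^sub>R a + h *\<^sub>R b) - d a f (x + s *\<^sub>R a)"
      if "0 \<le> s" "s \<le> h" for s
    proof -
      have 1: "f differentiable at (x + s *\<^sub>R a + h *\<^sub>R b)" "f differentiable at (x + s *\<^sub>R a)"
        using df inS[of s h] inS[of s 0] that h by auto
      have "((\<lambda>y. f (y + h *\<^sub>R b)) has_derivative
          frechet_derivative f (at (x + s *\<^sub>R a + h *\<^sub>R b))) (at (x + s *\<^sub>R a))"
        by (rule has_derivative_eq_rhs[OF has_derivative_compose[of "\<lambda>y. y + h *\<^sub>R b" _ _ _ f,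
                OF _ 1(1)[unfolded frechet_derivative_works]]])
          (auto intro!: derivative_eq_intros)
      from has_derivative_diff[OF this 1(2)[unfolded frechet_derivative_works]]
      have D: "(?g has_derivative (\<lambda>w. frechet_derivative f (at (x + s *\<^sub>R a + h *\<^sub>R b)) w
          - frechet_derivative f (at (x + s *\<^sub>R a)) w)) (at (x + s *\<^sub>R a))" .
      then show "?g differentiable at (x + s *\<^sub>R a)" by (rule differentiableI)
      show "d a ?g (x + s *\<^sub>R a) = d a f (x + s *\<^sub>R a + h *\<^sub>R b) - d a f (x + s *\<^sub>R a)"
        unfolding d_def frechet_derivative_eqI[OF D] ..
    qed
    obtain s where s: "s > 0" "s < h" "?g (x + h *\<^sub>R a) - ?g x = h * d a ?g (x + s *\<^sub>R a)"
      using mv[OF h dg] by blast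
    have "d a f differentiable at (x + s *\<^sub>R a + t *\<^sub>R b)" if "0 \<le> t" "t \<le> h" for t
      using ddf inS[of s t] s that by auto
    from mv[OF h this] obtain t where t: "t > 0" "t < h"
      "d a f (x + s *\<^sub>R a + h *\<^sub>R b) - d a f (x + s *\<^sub>R a) = h * d b (d a f) (x + s *\<^sub>R a + t *\<^sub>R b)"
      by blast
    show ?thesis
      using s t dgv[of s] by (intro exI[of _ s] exI[of _ t]) auto
  qed
  obtain s t where st: "0 \<le> s" "s \<le> h" "0 \<le> t" "t \<le> h"
    "f (x + h *\<^sub>R u + h *\<^sub>R v) - f (x + h *\<^sub>R u) - f (x + h *\<^sub>R v) + f x =
        h * h * d v (d u f) (x + s *\<^sub>R u + t *\<^sub>R v)"
    using key[of u v] inS by blast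
  have "x + s *\<^sub>R v + t *\<^sub>R u \<in> S" if "0 \<le> s" "s \<le> h" "0 \<le> t" "t \<le> h" for s t
    using inS[of t s] that by (simp add: algebra_simps)
  from key[OF this] obtain s' t' where st': "0 \<le> s'" "s' \<le> h" "0 \<le> t'" "t' \<le> h"
    "f (x + h *\<^sub>R v + h *\<^sub>R u) - f (x + h *\<^sub>R v) - f (x + h *\<^sub>R u) + f x =
        h * h * d u (d v f) (x + s' *\<^sub>R v + t' *\<^sub>R u)"
    by blast
  have "h * h * d v (d u f) (x + s *\<^sub>R u + t *\<^sub>R v) = h * h * d u (d v f) (x + s' *\<^sub>R v + t' *\<^sub>R u)"
    using st(5) st'(5) by (simp add: algebra_simps)
  then have eq: "d v (d u f) (x + s *\<^sub>R u + t *\<^sub>R v) = d u (d v f) (x + t' *\<^sub>R u + s' *\<^sub>R v)"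
    using h by (simp add: algebra_simps)
  have "dist (d v (d u f) (x + s *\<^sub>R u + t *\<^sub>R v)) (d v (d u f) x) < e"
    using near[OF st(1-4)] by (intro \<delta>(2)) (simp add: \<delta>_def)
  moreover have "dist (d u (d v f) (x + t' *\<^sub>R u + s' *\<^sub>R v)) (d u (d v f) x) < e"
    using near[OF st'(3,4,1,2)] by (intro \<delta>(4)) (simp add: \<delta>_def)
  ultimately show False
    using e unfolding eq e_def dist_real_def by argo
qed

text \<open>Solutions of a linear system with smoothly varying invertible matrix, treated without
  determinants. With \<open>L\<close> inverse to \<open>A x\<close>, the increment of
  \<open>X\<close> is \<open>L (b y - A y (X x))\<close> up to a smaller error, so \<open>X\<close>
  inherits differentiability. The derivative in direction \<open>v\<close> solves a system with the
  same matrices, whose right side is \<open>Db v - (DA v) (X x)\<close>; hence the induction on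
  \<open>k\<close> over all \<open>b\<close> and \<open>X\<close>.\<close>

lemma Ck_on_linear_solve:
  fixes A :: "'a::euclidean_space \<Rightarrow> 'a \<Rightarrow> 'a"
  assumes S: "open S"
    and lin: "\<And>x. x \<in> S \<Longrightarrow> linear (A x)" and inj: "\<And>x. x \<in> S \<Longrightarrow> inj (A x)"
    and CA: "\<And>k i. Ck_on k S (\<lambda>x. A x i)"
    and "Ck_on k S b" "\<And>x. x \<in> S \<Longrightarrow> A x (X x) = b x"
  shows "Ck_on k S X"
proof -
  have est: "\<exists>L \<delta>. bounded_linear L \<and> (\<delta> \<longlongrightarrow> 0) (at x) \<and>
      (\<forall>y\<in>S. norm (X y - X x - L (b y - A y (X x))) \<le> \<delta> y * norm (X y - X x))"
    if x: "x \<in> S" and ab: "\<forall>x\<in>S. A x (X x) = b x" for x b X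
  proof -
    obtain L where L: "linear L" "L \<circ> A x = id"
      using linear_injective_left_inverse[OF lin inj] x by blast
    \<comment> \<open>For the increment \<open>u = X y - X x\<close> one has
      \<open>L (A x u) = u\<close>, so the error is \<open>L\<close> applied to
      \<open>(A y - A x) u\<close>. \<open>\<delta>\<close> bounds it relative to
      \<open>norm u\<close> and vanishes at \<open>x\<close>.\<close>
    define \<delta> where "\<delta> y = (\<Sum>i\<in>Basis. norm (L (A y i - A x i)))" for y
    have bl: "bounded_linear L" using L(1) by (simp add: linear_conv_bounded_linear)
    have "continuous_on S \<delta>"
      unfolding \<delta>_def
      by (intro continuous_intros bounded_linear.continuous_on[OF bl] Ck_on_imp_continuous_on[OF CA[of 0]])
    then have "isCont \<delta> x" using S x continuous_on_eq_continuous_at by blast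
    then have "(\<delta> \<longlongrightarrow> 0) (at x)"
      unfolding isCont_def by (simp add: \<delta>_def linear_0[OF L(1)])
    moreover have "norm (X y - X x - L (b y - A y (X x))) \<le> \<delta> y * norm (X y - X x)" if y: "y \<in> S" for y
    proof -
      define u where "u = X y - X x"
      have lA: "linear (\<lambda>u. L (A y u - A x u))"
        using linear_compose[OF linear_compose_sub[OF lin[OF y] lin[OF x]] L(1)] by (simp add: o_def)
      have "b y - A y (X x) = A y u"
        using bspec[OF ab y] linear_diff[OF lin[OF y]] by (simp add: u_def)
      moreover have "u = L (A x u)" using L(2) by (simp add: fun_eq_iff)
      ultimately have "norm (X y - X x - L (b y - A y (X x))) = norm (L (A y u - A x u))"
        using linear_diff[OF L(1)] by (metis norm_minus_commute u_def)
      also have "\<dots> = norm (\<Sum>i\<in>Basis. (u \<bullet> i) *\<^sub>R L (A y i - A x i))"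
        by (subst linear_sum_Basis[OF lA]) simp
      also have "\<dots> \<le> (\<Sum>i\<in>Basis. norm u * norm (L (A y i - A x i)))"
        by (rule sum_norm_le) (auto intro: mult_right_mono Basis_le_norm)
      also have "\<dots> = \<delta> y * norm u" by (simp add: \<delta>_def sum_distrib_left mult.commute)
      finally show ?thesis by (simp add: u_def)
    qed
    ultimately show ?thesis using bl by blast
  qed
  \<comment> \<open>Once \<open>\<delta> y\<close> is at most 1/2, the unknown increment on the
    right is absorbed, and the error is measured by the known quantity
    \<open>L (b y - A y (X x))\<close>.\<close>
  have bound: "\<exists>L \<delta>. bounded_linear L \<and> (\<delta> \<longlongrightarrow> 0) (at x) \<and>
      (\<forall>\<^sub>F y in at x. norm (X y - X x) \<le> 2 * norm (L (b y - A y (X x)))) \<and>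
      (\<forall>\<^sub>F y in at x. norm (X y - X x - L (b y - A y (X x))) \<le> \<delta> y * norm (L (b y - A y (X x))))"
    if x: "x \<in> S" and ab: "\<forall>x\<in>S. A x (X x) = b x" for x b X
  proof -
    obtain L \<delta> where L: "bounded_linear L" and \<delta>: "(\<delta> \<longlongrightarrow> 0) (at x)"
      and e: "\<And>y. y \<in> S \<Longrightarrow> norm (X y - X x - L (b y - A y (X x))) \<le> \<delta> y * norm (X y - X x)"
      using est[OF x ab] by metis
    have "\<forall>\<^sub>F y in at x. dist (\<delta> y) 0 < 1/2" using tendstoD[OF \<delta>, of "1/2"] by simp
    moreover have "\<forall>\<^sub>F y in at x. y \<in> S" using S x by (simp add: eventually_at_topological) blast
    ultimately have 1: "\<forall>\<^sub>F y in at x. \<bar>\<delta> y\<bar> \<le> 1/2 \<and> y \<in> S"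
      by eventually_elim (simp add: dist_real_def)
    have 2: "norm (X y - X x) \<le> 2 * norm (L (b y - A y (X x)))" if "\<bar>\<delta> y\<bar> \<le> 1/2 \<and> y \<in> S" for y
    proof -
      have "norm (X y - X x) \<le> norm (L (b y - A y (X x))) + norm (X y - X x - L (b y - A y (X x)))"
        by (metis add.commute diff_add_cancel norm_triangle_ineq)
      also have "norm (X y - X x - L (b y - A y (X x))) \<le> 1/2 * norm (X y - X x)"
      proof -
        have "\<delta> y * norm (X y - X x) \<le> 1/2 * norm (X y - X x)"
          using that by (intro mult_right_mono) auto
        then show ?thesis using e[of y] that by linarith
      qed
      finally show ?thesis by simp
    qed
    have 3: "norm (X y - X x - L (b y - A y (X x))) \<le> 2 * \<bar>\<delta> y\<bar> * norm (L (b y - A y (X x)))"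
      if "\<bar>\<delta> y\<bar> \<le> 1/2 \<and> y \<in> S" for y
    proof -
      have "norm (X y - X x - L (b y - A y (X x))) \<le> \<bar>\<delta> y\<bar> * norm (X y - X x)"
      proof -
        have "\<delta> y * norm (X y - X x) \<le> \<bar>\<delta> y\<bar> * norm (X y - X x)"
          by (intro mult_right_mono) auto
        then show ?thesis using e[of y] that by linarith
      qed
      also have "\<dots> \<le> \<bar>\<delta> y\<bar> * (2 * norm (L (b y - A y (X x))))"
        using 2[OF that] by (intro mult_left_mono) auto
      finally show ?thesis by (simp add: mult_ac)
    qed
    have "((\<lambda>y. 2 * \<bar>\<delta> y\<bar>) \<longlongrightarrow> 0) (at x)" using tendsto_mult_right_zero[OF tendsto_rabs_zero[OF \<delta>]] by simp
    moreover from 1 have "\<forall>\<^sub>F y in at x. norm (X y - X x) \<le> 2 * norm (L (b y - A y (X x)))"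
      by (rule eventually_mono) (rule 2)
    moreover from 1 have "\<forall>\<^sub>F y in at x. norm (X y - X x - L (b y - A y (X x))) \<le> 2 * \<bar>\<delta> y\<bar> * norm (L (b y - A y (X x)))"
      by (rule eventually_mono) (rule 3)
    ultimately show ?thesis using L by blast
  qed
  show ?thesis
    using assms(5,6)
  proof (induction k arbitrary: b X)
    case 0
    have "isCont X x" if x: "x \<in> S" for x
    proof -
      obtain L :: "'a \<Rightarrow> 'a" where L: "bounded_linear L" and
        e: "\<forall>\<^sub>F y in at x. norm (X y - X x) \<le> 2 * norm (L (b y - A y (X x)))"
        using bound[OF x, of X b] 0(2) by auto
      have "continuous_on S (\<lambda>y. 2 * norm (L (b y - A y (X x))))"
        using 0 by (intro continuous_intros bounded_linear.continuous_on[OF L] Ck_on_imp_continuous_on[OF CA[of 0]]) auto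
      then have "((\<lambda>y. 2 * norm (L (b y - A y (X x)))) \<longlongrightarrow> 2 * norm (L (b x - A x (X x)))) (at x)"
        using S x continuous_on_eq_continuous_at isCont_def by blast
      then have "((\<lambda>y. 2 * norm (L (b y - A y (X x)))) \<longlongrightarrow> 0) (at x)"
        using 0(2)[OF x] linear_0[OF bounded_linear.linear[OF L]] by simp
      from Lim_null_comparison[OF e this] show ?thesis
        by (simp add: isCont_def LIM_zero_iff)
    qed
    then show ?case by (simp add: continuous_at_imp_continuous_on)
  next
    case (Suc k)
    have der: "X differentiable at x" if x: "x \<in> S" for x
    proof -
      obtain L :: "'a \<Rightarrow> 'a" and \<delta> where L: "bounded_linear L" and \<delta>: "(\<delta> \<longlongrightarrow> 0) (at x)" and
        e: "\<forall>\<^sub>F y in at x. norm (X y - X x - L (b y - A y (X x))) \<le> \<delta> y * norm (L (b y - A y (X x)))"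
        using bound[OF x, of X b] Suc.prems(2) by auto
      \<comment> \<open>\<open>?q\<close> contains \<open>X\<close> only through the constant
        \<open>X x\<close>, so its smoothness is known. It agrees with \<open>X y - X x\<close> to
        first order and therefore supplies the derivative of \<open>X\<close> at
        \<open>x\<close>.\<close>
      let ?q = "\<lambda>y. L (b y - A y (X x))"
      have "Ck_on (Suc k) S ?q"
        using Suc.prems CA by (intro Ck_on_bounded_linear_compose[OF S L] Ck_on_diff S)
      then have q: "(?q has_derivative frechet_derivative ?q (at x)) (at x)"
        using x by (rule Ck_on_has_derivative)
      have q0: "?q x = 0" using Suc.prems(2)[OF x] linear_0[OF bounded_linear.linear[OF L]] by simp
      have "((\<lambda>y. X y - X x - ?q y) has_derivative (\<lambda>h. 0)) (at x)"
        unfolding has_derivative_at_alt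
      proof (intro conjI allI impI)
        fix e' :: real assume e': "e' > 0"
        obtain B where B: "B > 0" "\<And>v. norm (frechet_derivative ?q (at x) v) \<le> norm v * B"
          using bounded_linear.pos_bounded[OF has_derivative_bounded_linear[OF q]] by blast
        obtain d1 where d1: "d1 > 0" "\<And>y. norm (y - x) < d1 \<Longrightarrow>
            norm (?q y - ?q x - frechet_derivative ?q (at x) (y - x)) \<le> 1 * norm (y - x)"
          using conjunct2[OF q[unfolded has_derivative_at_alt], rule_format, of 1] by auto
        have qb: "norm (?q y) \<le> (B + 1) * norm (y - x)" if "norm (y - x) < d1" for y
          using B(2)[of "y - x"] norm_triangle_sub[of "?q y" "frechet_derivative ?q (at x) (y - x)"]
            d1(2)[OF that] q0 by (simp add: algebra_simps)
        have "\<forall>\<^sub>F y in at x. dist (\<delta> y) 0 < e' / (B + 1)"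
          using tendstoD[OF \<delta>, of "e' / (B + 1)"] e' B(1) by simp
        with e have "\<forall>\<^sub>F y in at x. norm (X y - X x - ?q y) \<le> e' / (B + 1) * norm (?q y)"
        proof eventually_elim
          case (elim y)
          have "\<delta> y * norm (?q y) \<le> e' / (B + 1) * norm (?q y)"
            using elim by (intro mult_right_mono) auto
          with elim show ?case by linarith
        qed
        then obtain d2 where d2: "d2 > 0" "\<And>y. y \<noteq> x \<Longrightarrow> norm (y - x) < d2 \<Longrightarrow>
            norm (X y - X x - ?q y) \<le> e' / (B + 1) * norm (?q y)"
          unfolding eventually_at dist_norm by blast
        show "\<exists>d>0. \<forall>y. norm (y - x) < d \<longrightarrow>
           norm (X y - X x - ?q y - (X x - X x - ?q x) - 0) \<le> e' * norm (y - x)"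
        proof (intro exI[of _ "min d1 d2"] conjI allI impI)
          fix y assume y: "norm (y - x) < min d1 d2"
          show "norm (X y - X x - ?q y - (X x - X x - ?q x) - 0) \<le> e' * norm (y - x)"
          proof (cases "y = x")
            case False
            then have "norm (X y - X x - ?q y) \<le> e' / (B + 1) * norm (?q y)" using d2(2) y by simp
            also have "\<dots> \<le> e' / (B + 1) * ((B + 1) * norm (y - x))"
              using qb y e' B(1) by (intro mult_left_mono) auto
            finally show ?thesis using q0 B(1) by simp
          qed simp
        qed (use d1 d2 in auto)
      qed (rule bounded_linear_zero)
      from has_derivative_add[OF this q] have "((\<lambda>y. X y - X x) has_derivative frechet_derivative ?q (at x)) (at x)"
        by simp
      from has_derivative_add[OF this has_derivative_const[of "X x"]]
      show ?thesis by (auto intro: differentiableI)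
    qed
    show ?case
    proof (rule Ck_on_Suc_BasisI[OF S der])
      fix v :: 'a
      let ?D = "\<lambda>x. frechet_derivative X (at x) v"
      show "Ck_on k S ?D"
      proof (rule Suc.IH)
        have CX: "Ck_on k S X" by (rule Suc.IH[OF Ck_on_SucD]) (use Suc.prems in auto)
        show "Ck_on k S (\<lambda>x. frechet_derivative b (at x) v -
           (\<Sum>i\<in>Basis. (X x \<bullet> i) *\<^sub>R frechet_derivative (\<lambda>x. A x i) (at x) v))"
          using Suc.prems(1) CA[of "Suc k"]
          by (intro Ck_on_diff Ck_on_sum Ck_on_scaleR Ck_on_inner S CX) auto
        fix x assume x: "x \<in> S"
        have dA: "((\<lambda>x. A x i) has_derivative frechet_derivative (\<lambda>x. A x i) (at x)) (at x)" for i
          using CA[of "Suc 0"] x by (intro Ck_on_has_derivative)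
        have dX: "(X has_derivative frechet_derivative X (at x)) (at x)"
          using der[OF x] by (simp add: frechet_derivative_works)
        \<comment> \<open>The product rule for \<open>A y (X y) = b y\<close>, with
          \<open>X y\<close> expanded in the basis.\<close>
        have 1: "(b has_derivative (\<lambda>h. \<Sum>i\<in>Basis. (X x \<bullet> i) *\<^sub>R frechet_derivative (\<lambda>x. A x i) (at x) h +
            (frechet_derivative X (at x) h \<bullet> i) *\<^sub>R A x i)) (at x)"
        proof (rule has_derivative_transform_within_open[OF _ S x])
          show "((\<lambda>x. \<Sum>i\<in>Basis. (X x \<bullet> i) *\<^sub>R A x i) has_derivative (\<lambda>h. \<Sum>i\<in>Basis. (X x \<bullet> i) *\<^sub>R frechet_derivative (\<lambda>x. A x i) (at x) h +
            (frechet_derivative X (at x) h \<bullet> i) *\<^sub>R A x i)) (at x)"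
            by (intro has_derivative_sum has_derivative_scaleR has_derivative_inner_left dA dX)
          show "(\<Sum>i\<in>Basis. (X y \<bullet> i) *\<^sub>R A y i) = b y" if "y \<in> S" for y
            using linear_sum_Basis[OF lin[OF that], of "X y"] Suc.prems(2)[OF that] by simp
        qed
        show "A x (?D x) = frechet_derivative b (at x) v -
           (\<Sum>i\<in>Basis. (X x \<bullet> i) *\<^sub>R frechet_derivative (\<lambda>x. A x i) (at x) v)"
          unfolding frechet_derivative_eqI[OF 1] linear_sum_Basis[OF lin[OF x], of "?D x"]
          by (simp add: sum.distrib)
      qed
    qed
  qed
qed


section \<open>Flat functions from which bump functions are built\<close>

definition exp_bump :: "nat \<Rightarrow> real \<Rightarrow> real" where
  "exp_bump n x = (if x > 0 then exp (- inverse x) * inverse x ^ n else 0)"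

lemma exp_bump_tendsto: "(exp_bump n \<longlongrightarrow> 0) (at 0)"
proof -
  have "((\<lambda>x::real. inverse x ^ n / exp (inverse x)) \<longlongrightarrow> 0) (at_right 0)"
    using filterlim_compose[OF tendsto_power_div_exp_0[of n] filterlim_inverse_at_top_right] by (simp add: o_def)
  moreover have "\<forall>\<^sub>F x in at_right 0. inverse x ^ n / exp (inverse x) = exp_bump n x"
    by (auto simp: eventually_at_filter exp_bump_def exp_minus divide_inverse mult.commute)
  ultimately have 1: "(exp_bump n \<longlongrightarrow> 0) (at_right 0)"
    by (rule Lim_transform_eventually)
  have 2: "(exp_bump n \<longlongrightarrow> 0) (at_left 0)"
    by (rule Lim_transform_eventually[of "\<lambda>_. 0"])
      (auto simp: eventually_at_filter exp_bump_def)
  from 1 2 show ?thesis by (rule filterlim_split_at[rotated])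
qed

text \<open>The powers of \<open>inverse x\<close> make the family closed under differentiation,
  which gives smoothness of all members by induction. At 0 the difference quotient is the member
  with index \<open>n + 1\<close>, and this tends to 0.\<close>

lemma exp_bump_derivative:
  "(exp_bump n has_real_derivative exp_bump (n + 2) x - real n * exp_bump (n + 1) x) (at x)"
proof (cases "x = 0")
  case True
  have "((\<lambda>h. (exp_bump n h - exp_bump n 0) / (h - 0)) \<longlongrightarrow> 0) (at 0)"
    by (rule Lim_transform_eventually[OF exp_bump_tendsto[of "Suc n"]])
      (auto simp: eventually_at_filter exp_bump_def divide_inverse)
  then show ?thesis using True
    by (simp add: has_field_derivative_iff exp_bump_def[of _ 0])
next
  case False
  then consider "x > 0" | "x < 0" by linarith
  then show ?thesis
  proof cases
    case 1
    have "((\<lambda>x. exp (- inverse x) * inverse x ^ n) has_real_derivative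
        exp (- inverse x) * (inverse x * inverse x) * inverse x ^ n +
        (real n * inverse x ^ (n - 1)) * - (inverse x * inverse x) * exp (- inverse x)) (at x)"
      using 1 by (auto intro!: derivative_eq_intros)
    moreover have "exp (- inverse x) * (inverse x * inverse x) * inverse x ^ n +
        (real n * inverse x ^ (n - 1)) * - (inverse x * inverse x) * exp (- inverse x) =
        exp_bump (n + 2) x - real n * exp_bump (n + 1) x"
      using 1 by (cases n) (simp_all add: exp_bump_def algebra_simps)
    ultimately have "((\<lambda>x. exp (- inverse x) * inverse x ^ n) has_real_derivative
        exp_bump (n + 2) x - real n * exp_bump (n + 1) x) (at x)"
      by simp
    then show ?thesis
      by (rule has_field_derivative_transform_within_open[where S = "{0<..}"])
        (use 1 in \<open>auto simp: exp_bump_def\<close>)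
  next
    case 2
    then have "((\<lambda>x. 0) has_real_derivative exp_bump (n + 2) x - real n * exp_bump (n + 1) x) (at x)"
      by (simp add: exp_bump_def)
    then show ?thesis
      by (rule has_field_derivative_transform_within_open[where S = "{..<0}"])
        (use 2 in \<open>auto simp: exp_bump_def\<close>)
  qed
qed

lemma Ck_on_exp_bump: "Ck_on k UNIV (exp_bump n)"
proof (induction k arbitrary: n)
  case 0
  then show ?case
    using DERIV_isCont[OF exp_bump_derivative] by (simp add: continuous_at_imp_continuous_on)
next
  case (Suc k)
  have d: "(exp_bump n has_derivative (*) (exp_bump (n + 2) x - real n * exp_bump (n + 1) x)) (at x)" for x
    using exp_bump_derivative by (simp add: has_field_derivative_def)
  then have "exp_bump n differentiable at x" for x by (rule differentiableI)
  moreover have "Ck_on k UNIV (\<lambda>x. (exp_bump (n + 2) x - real n * exp_bump (n + 1) x) * v)" for v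
    by (intro Ck_on_mult Ck_on_diff Ck_on_const Suc.IH open_UNIV)
  ultimately show ?case by (simp only: Ck_on.simps frechet_derivative_eqI[OF d] ball_simps) blast
qed

section \<open>Sequences converging with all space derivatives\<close>

text \<open>This is \<open>\<integral>\<^sub>0\<^sup>t f(s, x) ds\<close> for \<open>z = (t, x)\<close>, rescaled to a fixed interval so that the
  theorems on parametric integrals apply.\<close>

definition time_int :: "(real \<times> 'a \<Rightarrow> 'b::euclidean_space) \<Rightarrow> real \<times> 'a \<Rightarrow> 'b" where
  "time_int f z = fst z *\<^sub>R integral {0..1} (\<lambda>s. f (s * fst z, snd z))"

definition xderiv :: "'a::euclidean_space \<Rightarrow> (real \<times> 'a \<Rightarrow> 'b::real_normed_vector) \<Rightarrow> real \<times> 'a \<Rightarrow> 'b" where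
  "xderiv v f z = frechet_derivative (\<lambda>y. f (fst z, y)) (at (snd z)) v"

definition C0_conv :: "(nat \<Rightarrow> real \<times> 'a::euclidean_space \<Rightarrow> 'b::euclidean_space) \<Rightarrow> bool" where
  "C0_conv f \<longleftrightarrow> (\<forall>n. continuous_on ({0..1} \<times> UNIV) (f n)) \<and>
     (\<forall>S. compact S \<longrightarrow> uniformly_convergent_on ({0..1} \<times> S) f)"

text \<open>Only space derivatives are controlled. Time regularity of a limit is read off from an
  integral equation instead.\<close>

primrec Ck_conv :: "nat \<Rightarrow> (nat \<Rightarrow> real \<times> 'a::euclidean_space \<Rightarrow> 'b::euclidean_space) \<Rightarrow> bool" where
  "Ck_conv 0 f \<longleftrightarrow> C0_conv f"
| "Ck_conv (Suc k) f \<longleftrightarrow> C0_conv f \<and>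
     (\<forall>n. \<forall>t\<in>{0..1}. \<forall>x. (\<lambda>y. f n (t, y)) differentiable (at x)) \<and>
     (\<forall>v. Ck_conv k (\<lambda>n. xderiv v (f n)))"

section \<open>Time integrals: estimates, continuity and derivatives in the space variable\<close>

lemma mult_unit_interval: "s \<in> {0..1} \<Longrightarrow> t \<in> {0..1} \<Longrightarrow> s * t \<in> {0..1::real}"
  by (auto intro: mult_le_one)

lemma time_int_cong:
  assumes "fst z \<in> {0..1}" "\<And>s. s \<in> {0..1} \<Longrightarrow> f (s, snd z) = g (s, snd z)"
  shows "time_int f z = time_int g z"
  unfolding time_int_def using assms mult_unit_interval
  by (intro arg_cong2[where f = scaleR] refl integral_cong) blast

lemma time_int_continuous_aux:
  fixes f :: "real \<times> 'a::topological_space \<Rightarrow> 'b::euclidean_space"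
  assumes "continuous_on ({0..1} \<times> S) f" "z \<in> {0..1} \<times> S"
  shows "continuous_on {0..1} (\<lambda>s. f (s * fst z, snd z))"
proof (rule continuous_on_compose2[OF assms(1)])
  show "continuous_on {0..1} (\<lambda>s. (s * fst z, snd z))" by (intro continuous_intros)
  show "(\<lambda>s. (s * fst z, snd z)) ` {0..1} \<subseteq> {0..1} \<times> S"
    using assms(2) mult_unit_interval by (auto simp: mem_Times_iff)
qed

lemma norm_time_int_le:
  assumes "continuous_on ({0..1} \<times> S) f" "z \<in> {0..1} \<times> S"
    "\<And>s. s \<in> {0..1} \<Longrightarrow> norm (f (s, snd z)) \<le> B"
  shows "norm (time_int f z) \<le> B"
proof -
  have "norm (integral {0..1} (\<lambda>s. f (s * fst z, snd z))) \<le> B * (1 - 0)"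
    using assms(2,3) mult_unit_interval
    by (intro integral_bound time_int_continuous_aux[OF assms(1,2)]) (auto simp: mem_Times_iff)
  moreover have "norm (time_int f z) \<le> 1 * norm (integral {0..1} (\<lambda>s. f (s * fst z, snd z)))"
    unfolding time_int_def norm_scaleR using assms(2) by (intro mult_right_mono) auto
  ultimately show ?thesis by simp
qed

lemma time_int_add:
  assumes "continuous_on ({0..1} \<times> S) f" "continuous_on ({0..1} \<times> S) g" "z \<in> {0..1} \<times> S"
  shows "time_int (\<lambda>z. f z + g z) z = time_int f z + time_int g z"
  unfolding time_int_def using assms
  by (simp add: integral_add integrable_continuous_real time_int_continuous_aux scaleR_add_right)

lemma time_int_diff:
  assumes "continuous_on ({0..1} \<times> S) f" "continuous_on ({0..1} \<times> S) g" "z \<in> {0..1} \<times> S"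
  shows "time_int (\<lambda>z. f z - g z) z = time_int f z - time_int g z"
  unfolding time_int_def using assms
  by (simp add: integral_diff integrable_continuous_real time_int_continuous_aux scaleR_diff_right)

lemma continuous_on_time_int:
  fixes f :: "real \<times> 'a::topological_space \<Rightarrow> 'b::euclidean_space"
  assumes "continuous_on ({0..1} \<times> S) f"
  shows "continuous_on ({0..1} \<times> S) (time_int f)"
proof -
  have "continuous_on ({0..1} \<times> S) (\<lambda>z. integral (cbox 0 1) (\<lambda>s. f (s * fst z, snd z)))"
  proof (rule integral_continuous_on_param)
    show "continuous_on (({0..1} \<times> S) \<times> cbox 0 1) (\<lambda>(z, s). f (s * fst z, snd z))"
      unfolding split_beta
    proof (rule continuous_on_compose2[OF assms])
      show "continuous_on (({0..1} \<times> S) \<times> cbox 0 (1::real))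
          (\<lambda>p. (snd p * fst (fst p), snd (fst p)))" by (intro continuous_intros)
      show "(\<lambda>p. (snd p * fst (fst p), snd (fst p))) ` (({0..1} \<times> S) \<times> cbox 0 (1::real)) \<subseteq> {0..1} \<times> S"
        using mult_unit_interval by fastforce
    qed
  qed
  then show ?thesis unfolding time_int_def[abs_def] by (intro continuous_intros) auto
qed

lemma uniform_limit_time_int:
  assumes "\<And>n. continuous_on ({0..1} \<times> S) (f n)" "uniform_limit ({0..1} \<times> S) f l sequentially"
  shows "uniform_limit ({0..1} \<times> S) (\<lambda>n. time_int (f n)) (time_int l) sequentially"
proof (rule uniform_limitI)
  fix e :: real assume e: "e > 0"
  have l: "continuous_on ({0..1} \<times> S) l"
    using uniform_limit_theorem[OF _ assms(2)] assms(1) by simp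
  have "\<forall>\<^sub>F n in sequentially. \<forall>z\<in>{0..1} \<times> S. dist (f n z) (l z) < e / 2"
    using uniform_limitD[OF assms(2), of "e / 2"] e by simp
  then show "\<forall>\<^sub>F n in sequentially. \<forall>z\<in>{0..1} \<times> S. dist (time_int (f n) z) (time_int l z) < e"
  proof eventually_elim
    case (elim n)
    show ?case
    proof
      fix z assume z: "z \<in> {0..1::real} \<times> S"
      have "norm (time_int (\<lambda>z. f n z - l z) z) \<le> e / 2"
        using elim z by (intro norm_time_int_le[OF continuous_on_diff[OF assms(1) l] z])
          (force simp: dist_norm mem_Times_iff)
      then show "dist (time_int (f n) z) (time_int l z) < e"
        using e by (simp add: time_int_diff[OF assms(1) l z] dist_norm)
    qed
  qed
qed

lemma time_int_eq_integral:
  assumes "t \<in> {0..1}"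
  shows "time_int f (t, x) = integral {0..t} (\<lambda>s. f (s, x))"
proof (cases "t = 0")
  case False
  have "(\<lambda>x. x / t) ` {0..t} = {0..1}"
  proof
    show "{0..1} \<subseteq> (\<lambda>x. x / t) ` {0..t}"
    proof
      fix s :: real assume "s \<in> {0..1}"
      then show "s \<in> (\<lambda>x. x / t) ` {0..t}"
        using False assms by (intro image_eqI[of _ _ "s * t"]) (auto simp: mult_left_le_one_le)
    qed
  qed (use False assms in auto)
  then show ?thesis
    using integral_stretch_real[OF False, of 0 t "\<lambda>s. f (s, x)"] False assms
    by (simp add: time_int_def mult.commute)
qed (simp add: time_int_def)

text \<open>Differentiation under the integral sign. The parametric theorem wants the derivative as
  a bounded linear map depending continuously on the parameters, which is checked on basis
  vectors.\<close>

lemma xderiv_time_int: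
  assumes f: "continuous_on ({0..1} \<times> UNIV) f"
    and df: "\<And>t x. t \<in> {0..1} \<Longrightarrow> (\<lambda>y. f (t, y)) differentiable (at x)"
    and cd: "\<And>v. continuous_on ({0..1} \<times> UNIV) (xderiv v f)"
    and t: "t \<in> {0..1}"
  shows "((\<lambda>y. time_int f (t, y)) has_derivative (\<lambda>v. time_int (xderiv v f) (t, x))) (at x)"
proof -
  define F where "F y s = Blinfun (frechet_derivative (\<lambda>y. f (s * t, y)) (at y))" for y s
  have bl: "bounded_linear (frechet_derivative (\<lambda>y. f (s * t, y)) (at y))" if "s \<in> {0..1}" for s y
    using df[OF mult_unit_interval[OF that t]] frechet_derivative_works has_derivative_bounded_linear by blast
  have F: "blinfun_apply (F y s) = frechet_derivative (\<lambda>y. f (s * t, y)) (at y)" if "s \<in> {0..1}" for s y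
    unfolding F_def using bl[OF that] by (simp add: bounded_linear_Blinfun_apply)
  have cF: "continuous_on (UNIV \<times> cbox 0 1) (\<lambda>(y, s). F y s)"
  proof (rule continuous_on_blinfun_componentwise)
    fix i :: 'a assume "i \<in> Basis"
    have "continuous_on (UNIV \<times> cbox 0 1) (\<lambda>p::'a\<times>real. xderiv i f (snd p * t, fst p))"
      using t mult_unit_interval
      by (intro continuous_on_compose2[OF cd] continuous_intros) auto
    then show "continuous_on (UNIV \<times> cbox 0 1) (\<lambda>p. blinfun_apply (case p of (y, s) \<Rightarrow> F y s) i)"
      by (rule continuous_on_eq) (auto simp: F xderiv_def)
  qed
  have I: "(\<lambda>s. F x s) integrable_on {0..1}"
  proof -
    have "continuous_on {0..1} (\<lambda>s. case (x, s) of (y, s) \<Rightarrow> F y s)"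
      by (rule continuous_on_compose2[OF cF, of _ "Pair x"]) (auto intro!: continuous_intros)
    then show ?thesis by (simp add: integrable_continuous_real)
  qed
  have "((\<lambda>y. integral (cbox 0 1) (\<lambda>s. f (s * t, y))) has_derivative integral (cbox 0 1) (F x)) (at x within UNIV)"
  proof (rule leibniz_rule[OF _ _ cF])
    show "((\<lambda>y. f (s * t, y)) has_derivative blinfun_apply (F y s)) (at y within UNIV)"
      if "s \<in> cbox 0 1" for y s
      using that df[OF mult_unit_interval[OF _ t]] by (simp add: F frechet_derivative_works)
    show "(\<lambda>s. f (s * t, y)) integrable_on cbox 0 1" for y
      using time_int_continuous_aux[OF f, of "(t, y)"] t by (simp add: integrable_continuous_real)
  qed auto
  from has_derivative_scaleR_right[OF this, of t]
  have "((\<lambda>y. time_int f (t, y)) has_derivative (\<lambda>v. t *\<^sub>R blinfun_apply (integral {0..1} (F x)) v)) (at x)"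
    by (simp add: time_int_def)
  moreover have "t *\<^sub>R blinfun_apply (integral {0..1} (F x)) v = time_int (xderiv v f) (t, x)" for v
    unfolding blinfun_apply_integral[OF I] time_int_def
    using F by (intro arg_cong2[where f = scaleR] refl integral_cong) (auto simp: xderiv_def)
  ultimately show ?thesis by simp
qed

lemma C0_convD:
  assumes "C0_conv f" "compact S"
  shows "\<exists>l. uniform_limit ({0..1} \<times> S) f l sequentially \<and> continuous_on ({0..1} \<times> S) l \<and>
           bounded (l ` ({0..1} \<times> S))"
proof -
  obtain l where l: "uniform_limit ({0..1} \<times> S) f l sequentially"
    using assms unfolding C0_conv_def uniformly_convergent_on_def by blast
  have "continuous_on ({0..1} \<times> S) (f n)" for n
    using assms(1) unfolding C0_conv_def by (meson Sigma_mono continuous_on_subset subset_UNIV subset_refl)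
  then have c: "continuous_on ({0..1} \<times> S) l"
    using uniform_limit_theorem[OF _ l] by simp
  moreover have "compact ({0..1::real} \<times> S)" using assms(2) by (simp add: compact_Times)
  ultimately show ?thesis using l by (blast intro: compact_imp_bounded compact_continuous_image)
qed

lemma C0_conv_continuous: "C0_conv f \<Longrightarrow> continuous_on ({0..1} \<times> S) (f n)"
  unfolding C0_conv_def by (meson Sigma_mono continuous_on_subset subset_UNIV subset_refl)

lemma C0_convI:
  assumes "\<And>n. continuous_on ({0..1} \<times> UNIV) (f n)"
    "\<And>S. compact S \<Longrightarrow> \<exists>l. uniform_limit ({0..1} \<times> S) f l sequentially"
  shows "C0_conv f"
  using assms unfolding C0_conv_def uniformly_convergent_on_def by blast

text \<open>The bound is uniform in \<open>n\<close>: late members are close to the bounded limit,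
  and each of the finitely many early ones is bounded by compactness.\<close>

lemma C0_conv_bounded:
  assumes f: "C0_conv f" and S: "compact S"
  shows "\<exists>C. \<forall>n. \<forall>z\<in>{0..1} \<times> S. norm (f n z) \<le> C"
proof -
  obtain l B where l: "uniform_limit ({0..1} \<times> S) f l sequentially"
    and B: "\<And>z. z \<in> {0..1} \<times> S \<Longrightarrow> norm (l z) \<le> B"
    using C0_convD[OF assms] unfolding bounded_iff by auto
  obtain M where M: "\<And>n z. n \<ge> M \<Longrightarrow> z \<in> {0..1} \<times> S \<Longrightarrow> dist (f n z) (l z) < 1"
    using uniform_limitD[OF l, of 1] unfolding eventually_sequentially by auto
  have "\<exists>C. \<forall>z\<in>{0..1} \<times> S. norm (f n z) \<le> C" for n
    using compact_imp_bounded[OF compact_continuous_image[OF C0_conv_continuous[OF f]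
      compact_Times[OF compact_Icc S]]] unfolding bounded_iff by blast
  then obtain C where C: "\<And>n z. z \<in> {0..1} \<times> S \<Longrightarrow> norm (f n z) \<le> C n" by metis
  have "norm (f n z) \<le> \<bar>B\<bar> + 1 + (\<Sum>n<M. \<bar>C n\<bar>)" if z: "z \<in> {0..1} \<times> S" for n z
  proof (cases "n < M")
    case True
    then have "\<bar>C n\<bar> \<le> (\<Sum>n<M. \<bar>C n\<bar>)" by (intro member_le_sum) auto
    then show ?thesis using C[OF z, of n] by linarith
  next
    case False
    then have "norm (f n z) \<le> norm (l z) + 1"
      using M[of n z] z norm_triangle_sub[of "f n z" "l z"] by (simp add: dist_norm)
    moreover have "0 \<le> (\<Sum>n<M. \<bar>C n\<bar>)" by (simp add: sum_nonneg)
    ultimately show ?thesis using B[OF z] by linarith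
  qed
  then show ?thesis by blast
qed

lemma C0_conv_cong:
  assumes "\<And>n z. fst z \<in> {0..1} \<Longrightarrow> f n z = g n z"
  shows "C0_conv f \<longleftrightarrow> C0_conv g"
proof -
  have "continuous_on ({0..1} \<times> UNIV) (f n) \<longleftrightarrow> continuous_on ({0..1} \<times> UNIV) (g n)" for n
    using assms by (intro continuous_on_cong) auto
  moreover have "uniform_limit ({0..1} \<times> S) f l sequentially \<longleftrightarrow> uniform_limit ({0..1} \<times> S) g l sequentially"
    for S l by (rule uniform_limit_cong') (use assms in auto)
  ultimately show ?thesis unfolding C0_conv_def uniformly_convergent_on_def by simp
qed

lemma Ck_conv_cong:
  assumes "\<And>n z. fst z \<in> {0..1} \<Longrightarrow> f n z = g n z"
  shows "Ck_conv k f \<longleftrightarrow> Ck_conv k g"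
  using assms
proof (induction k arbitrary: f g)
  case 0
  then show ?case using C0_conv_cong[of f g] by simp
next
  case (Suc k)
  have e: "(\<lambda>y. f n (t, y)) = (\<lambda>y. g n (t, y))" if "t \<in> {0..1}" for n t
    using Suc.prems[of "(t, _)"] that by auto
  have "Ck_conv k (\<lambda>n. xderiv v (f n)) = Ck_conv k (\<lambda>n. xderiv v (g n))" for v
    by (rule Suc.IH) (simp add: xderiv_def e)
  moreover have "C0_conv f = C0_conv g" by (rule C0_conv_cong) (rule Suc.prems)
  ultimately show ?case by (simp add: e)
qed

lemma Ck_conv_C0: "Ck_conv k f \<Longrightarrow> C0_conv f"
  by (cases k) auto

lemma Ck_conv_SucD: "Ck_conv (Suc k) f \<Longrightarrow> Ck_conv k f"
proof (induction k arbitrary: f)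
  case 0
  then show ?case by simp
next
  case (Suc k)
  then have "Ck_conv (Suc k) (\<lambda>n. xderiv v (f n))" for v by simp
  then have "Ck_conv k (\<lambda>n. xderiv v (f n))" for v by (rule Suc.IH)
  with Suc.prems show ?case by simp
qed

text \<open>Constant sequences serve as the regularity predicate for a single function of time and
  space.\<close>

lemma Ck_conv_constant_sequence: "Ck_conv k f \<Longrightarrow> Ck_conv k (\<lambda>_. f n)"
proof (induction k arbitrary: f)
  case 0
  then show ?case by (auto simp: C0_conv_def intro: uniformly_convergent_on_const)
next
  case (Suc k)
  have "C0_conv (\<lambda>_. f n)" using Suc.prems by (auto simp: C0_conv_def intro: uniformly_convergent_on_const)
  moreover have "Ck_conv k (\<lambda>_. xderiv v (f n))" for v
    by (rule Suc.IH[of "\<lambda>n. xderiv v (f n)"]) (use Suc.prems in auto)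
  ultimately show ?case using Suc.prems by auto
qed

lemma Ck_conv_const [simp]: "Ck_conv k (\<lambda>n z. c)"
proof (induction k arbitrary: c)
  case 0
  then show ?case by (auto simp: C0_conv_def intro: uniformly_convergent_on_const)
next
  case (Suc k)
  have "C0_conv (\<lambda>n z. c)" by (auto simp: C0_conv_def intro: uniformly_convergent_on_const)
  then show ?case using Suc by (auto simp: xderiv_def[abs_def])
qed

section \<open>Stability of convergence under algebraic operations, composition and
  integration\<close>

lemma C0_conv_add:
  assumes "C0_conv f" "C0_conv g"
  shows "C0_conv (\<lambda>n z. f n z + g n z)"
proof (rule C0_convI)
  fix S :: "'a set" assume S: "compact S"
  obtain l m where "uniform_limit ({0..1} \<times> S) f l sequentially" "uniform_limit ({0..1} \<times> S) g m sequentially"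
    using C0_convD[OF assms(1) S] C0_convD[OF assms(2) S] by blast
  from uniform_limit_add[OF this]
  show "\<exists>l. uniform_limit ({0..1} \<times> S) (\<lambda>n z. f n z + g n z) l sequentially"
    by blast
qed (intro continuous_on_add C0_conv_continuous assms)

lemma C0_conv_scaleR:
  assumes "C0_conv f" "C0_conv g"
  shows "C0_conv (\<lambda>n z. f n z *\<^sub>R g n z)"
proof (rule C0_convI)
  fix S :: "'a set" assume S: "compact S"
  show "\<exists>l. uniform_limit ({0..1} \<times> S) (\<lambda>n z. f n z *\<^sub>R g n z) l sequentially"
    using C0_convD[OF assms(1) S] C0_convD[OF assms(2) S]
      bounded_bilinear.bounded_uniform_limit[OF bounded_bilinear_scaleR] by blast
qed (intro continuous_on_scaleR C0_conv_continuous assms)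

lemma C0_conv_inner:
  assumes "C0_conv f"
  shows "C0_conv (\<lambda>n z. f n z \<bullet> c)"
proof (rule C0_convI)
  fix S :: "'a set" assume S: "compact S"
  show "\<exists>l. uniform_limit ({0..1} \<times> S) (\<lambda>n z. f n z \<bullet> c) l sequentially"
    using C0_convD[OF assms S] bounded_linear.uniform_limit[OF bounded_linear_inner_left] by blast
qed (intro continuous_on_inner C0_conv_continuous continuous_on_const assms)

text \<open>Over a compact set all values of all members lie in one ball, where \<open>X\<close> is
  uniformly continuous.\<close>

lemma C0_conv_compose:
  assumes f: "C0_conv f" and X: "continuous_on UNIV X"
  shows "C0_conv (\<lambda>n z. X (f n z))"
proof (rule C0_convI)
  show "continuous_on ({0..1} \<times> UNIV) (\<lambda>z. X (f n z))" for n
    by (rule continuous_on_compose2[OF X C0_conv_continuous[OF f]]) auto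
  fix S :: "'a set" assume S: "compact S"
  obtain l where l: "uniform_limit ({0..1} \<times> S) f l sequentially"
    using C0_convD[OF f S] by blast
  obtain C where C: "\<And>n z. z \<in> {0..1} \<times> S \<Longrightarrow> norm (f n z) \<le> C"
    using C0_conv_bounded[OF f S] by blast
  have "uniformly_continuous_on (cball 0 C) X"
    by (rule compact_uniformly_continuous) (auto intro: continuous_on_subset[OF X])
  from uniform_limit_compose_uniformly_continuous_on[OF l this]
  show "\<exists>l. uniform_limit ({0..1} \<times> S) (\<lambda>n z. X (f n z)) l sequentially"
    using C by (auto simp: dist_norm)
qed

lemma C0_conv_time_int:
  assumes "C0_conv f"
  shows "C0_conv (\<lambda>n. time_int (f n))"
proof (rule C0_convI)
  fix S :: "'a set" assume S: "compact S"
  show "\<exists>l. uniform_limit ({0..1} \<times> S) (\<lambda>n. time_int (f n)) l sequentially"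
    using C0_convD[OF assms S] uniform_limit_time_int[of S f, OF C0_conv_continuous[OF assms]] by blast
qed (intro continuous_on_time_int C0_conv_continuous assms)

lemma xderiv_has_derivative:
  "(\<lambda>y. f (t, y)) differentiable (at x) \<Longrightarrow>
    ((\<lambda>y. f (t, y)) has_derivative (\<lambda>v. xderiv v f (t, x))) (at x)"
  by (simp add: xderiv_def frechet_derivative_works)

lemma xderiv_eqI:
  "((\<lambda>y. f (t, y)) has_derivative D) (at x) \<Longrightarrow> xderiv v f (t, x) = D v"
  by (simp add: xderiv_def frechet_derivative_eqI)

lemma Ck_conv_SucI:
  assumes "C0_conv f"
    "\<And>n t x. t \<in> {0..1} \<Longrightarrow> ((\<lambda>y. f n (t, y)) has_derivative (\<lambda>v. f' v n (t, x))) (at x)"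
    "\<And>v. Ck_conv k (f' v)"
  shows "Ck_conv (Suc k) f"
proof -
  have "Ck_conv k (\<lambda>n. xderiv v (f n)) = Ck_conv k (f' v)" for v
    by (rule Ck_conv_cong) (auto simp: xderiv_eqI[OF assms(2)])
  moreover have "(\<lambda>y. f n (t, y)) differentiable (at x)" if "t \<in> {0..1}" for n t x
    using assms(2)[OF that] by (rule differentiableI)
  ultimately show ?thesis using assms(1,3) by simp
qed

lemma Ck_conv_has_derivative:
  "Ck_conv (Suc k) f \<Longrightarrow> t \<in> {0..1} \<Longrightarrow>
    ((\<lambda>y. f n (t, y)) has_derivative (\<lambda>v. xderiv v (f n) (t, x))) (at x)"
  by (rule xderiv_has_derivative) simp

lemma Ck_conv_add:
  assumes "Ck_conv k f" "Ck_conv k g"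
  shows "Ck_conv k (\<lambda>n z. f n z + g n z)"
  using assms
proof (induction k arbitrary: f g)
  case (Suc k)
  show ?case
  proof (rule Ck_conv_SucI[where f' = "\<lambda>v n z. xderiv v (f n) z + xderiv v (g n) z"])
    show "((\<lambda>y. f n (t, y) + g n (t, y)) has_derivative
        (\<lambda>v. xderiv v (f n) (t, x) + xderiv v (g n) (t, x))) (at x)" if "t \<in> {0..1}" for n t x
      by (rule has_derivative_add[OF Ck_conv_has_derivative[OF Suc.prems(1) that]
            Ck_conv_has_derivative[OF Suc.prems(2) that]])
    show "Ck_conv k (\<lambda>n z. xderiv v (f n) z + xderiv v (g n) z)" for v
      using Suc.prems by (intro Suc.IH) simp_all
  qed (use Suc.prems in \<open>simp add: C0_conv_add\<close>)
qed (simp add: C0_conv_add)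

lemma Ck_conv_sum:
  assumes "\<And>i. i \<in> I \<Longrightarrow> Ck_conv k (f i)"
  shows "Ck_conv k (\<lambda>n z. \<Sum>i\<in>I. f i n z)"
  using assms
proof (induction I rule: infinite_finite_induct)
  case (insert x F)
  then show ?case using Ck_conv_add[of k "f x" "\<lambda>n z. \<Sum>i\<in>F. f i n z"] by simp
qed simp_all

lemma Ck_conv_scaleR:
  assumes "Ck_conv k f" "Ck_conv k g"
  shows "Ck_conv k (\<lambda>n z. f n z *\<^sub>R g n z)"
  using assms
proof (induction k arbitrary: f g)
  case (Suc k)
  show ?case
  proof (rule Ck_conv_SucI[where f' = "\<lambda>v n z. f n z *\<^sub>R xderiv v (g n) z + xderiv v (f n) z *\<^sub>R g n z"])
    show "((\<lambda>y. f n (t, y) *\<^sub>R g n (t, y)) has_derivative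
        (\<lambda>v. f n (t, x) *\<^sub>R xderiv v (g n) (t, x) + xderiv v (f n) (t, x) *\<^sub>R g n (t, x))) (at x)"
      if "t \<in> {0..1}" for n t x
      by (rule has_derivative_scaleR[OF Ck_conv_has_derivative[OF Suc.prems(1) that]
            Ck_conv_has_derivative[OF Suc.prems(2) that]])
    show "Ck_conv k (\<lambda>n z. f n z *\<^sub>R xderiv v (g n) z + xderiv v (f n) z *\<^sub>R g n z)" for v
      using Suc.prems Ck_conv_SucD[OF Suc.prems(1)] Ck_conv_SucD[OF Suc.prems(2)]
      by (intro Ck_conv_add Suc.IH) simp_all
  qed (use Suc.prems in \<open>simp add: C0_conv_scaleR\<close>)
qed (simp add: C0_conv_scaleR)

lemma Ck_conv_inner:
  assumes "Ck_conv k f"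
  shows "Ck_conv k (\<lambda>n z. f n z \<bullet> c)"
  using assms
proof (induction k arbitrary: f)
  case (Suc k)
  show ?case
  proof (rule Ck_conv_SucI[where f' = "\<lambda>v n z. xderiv v (f n) z \<bullet> c"])
    show "((\<lambda>y. f n (t, y) \<bullet> c) has_derivative (\<lambda>v. xderiv v (f n) (t, x) \<bullet> c)) (at x)"
      if "t \<in> {0..1}" for n t x
      by (rule has_derivative_inner_left[OF Ck_conv_has_derivative[OF Suc.prems that]])
    show "Ck_conv k (\<lambda>n z. xderiv v (f n) z \<bullet> c)" for v
      using Suc.prems by (intro Suc.IH) simp_all
  qed (use Suc.prems in \<open>simp add: C0_conv_inner\<close>)
qed (simp add: C0_conv_inner)

lemma Ck_conv_compose:
  fixes X :: "'b::euclidean_space \<Rightarrow> 'c::euclidean_space"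
  assumes "Ck_conv k f" "Ck_on k UNIV X"
  shows "Ck_conv k (\<lambda>n z. X (f n z))"
  using assms
proof (induction k arbitrary: X)
  case (Suc k)
  show ?case
  proof (rule Ck_conv_SucI[where f' = "\<lambda>v n z. \<Sum>i\<in>Basis. (xderiv v (f n) z \<bullet> i) *\<^sub>R
      frechet_derivative X (at (f n z)) i"])
    show "((\<lambda>y. X (f n (t, y))) has_derivative (\<lambda>v. \<Sum>i\<in>Basis. (xderiv v (f n) (t, x) \<bullet> i) *\<^sub>R
      frechet_derivative X (at (f n (t, x))) i)) (at x)" if t: "t \<in> {0..1}" for n t x
    proof -
      have dX: "(X has_derivative frechet_derivative X (at (f n (t, x)))) (at (f n (t, x)))"
        by (rule Ck_on_has_derivative[OF Suc.prems(2)]) simp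
      show ?thesis
        by (rule has_derivative_eq_rhs[OF has_derivative_compose[OF Ck_conv_has_derivative[OF Suc.prems(1) t] dX]])
          (rule ext, rule linear_sum_Basis[OF has_derivative_linear[OF dX]])
    qed
    show "Ck_conv k (\<lambda>n z. \<Sum>i\<in>Basis. (xderiv v (f n) z \<bullet> i) *\<^sub>R
      frechet_derivative X (at (f n z)) i)" for v
      using Suc.prems Ck_conv_SucD[OF Suc.prems(1)]
      by (intro Ck_conv_sum Ck_conv_scaleR Ck_conv_inner Suc.IH) simp_all
    show "C0_conv (\<lambda>n z. X (f n z))"
      by (rule C0_conv_compose[OF Ck_conv_C0[OF Suc.prems(1)] Ck_on_imp_continuous_on[OF Suc.prems(2)]])
  qed
qed (simp add: C0_conv_compose)

lemma Ck_conv_time_int: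
  assumes "Ck_conv k f"
  shows "Ck_conv k (\<lambda>n. time_int (f n))"
  using assms
proof (induction k arbitrary: f)
  case (Suc k)
  show ?case
  proof (rule Ck_conv_SucI[where f' = "\<lambda>v n. time_int (xderiv v (f n))"])
    show "((\<lambda>y. time_int (f n) (t, y)) has_derivative (\<lambda>v. time_int (xderiv v (f n)) (t, x))) (at x)"
      if t: "t \<in> {0..1}" for n t x
    proof (rule xderiv_time_int[OF _ _ _ t])
      show "continuous_on ({0..1} \<times> UNIV) (xderiv v (f n))" for v
        by (rule C0_conv_continuous[OF Ck_conv_C0[of k], where f = "\<lambda>n. xderiv v (f n)"]) (use Suc.prems in simp)
    qed (use Suc.prems C0_conv_continuous in auto)
    show "Ck_conv k (\<lambda>n. time_int (xderiv v (f n)))" for v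
      using Suc.prems by (intro Suc.IH) simp_all
  qed (use Suc.prems in \<open>simp add: C0_conv_time_int\<close>)
qed (simp add: C0_conv_time_int)

text \<open>On a time interval of length 1, a Lipschitz constant 1/2 makes the integral operator a
  contraction in the sup norm. \<open>w\<close> and \<open>T\<close> may vary with \<open>n\<close>,
  because the derivatives of Picard iterates obey a recursion whose coefficients depend on the
  iterates.\<close>

lemma picard_uniformly_convergent:
  fixes u :: "nat \<Rightarrow> real \<times> 'a::euclidean_space \<Rightarrow> 'b::euclidean_space"
  assumes rec: "\<And>n z. z \<in> {0..1} \<times> S \<Longrightarrow> u (Suc n) z = w n z + time_int (\<lambda>z. T n z (u n z)) z"
    and cont: "\<And>n. continuous_on ({0..1} \<times> S) (\<lambda>z. T n z (u n z))"
    and lip: "\<And>n z y y'. z \<in> {0..1} \<times> S \<Longrightarrow> norm (T n z y - T n z y') \<le> norm (y - y') / 2"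
    and u0: "\<And>z. z \<in> {0..1} \<times> S \<Longrightarrow> norm (u 0 z) \<le> 4 * C"
    and w: "\<And>n z. z \<in> {0..1} \<times> S \<Longrightarrow> norm (w n z) \<le> C"
    and T0: "\<And>n z. z \<in> {0..1} \<times> S \<Longrightarrow> norm (T n z 0) \<le> C"
    and wconv: "uniformly_convergent_on ({0..1} \<times> S) w"
    and Tconv: "\<And>e. e > 0 \<Longrightarrow> \<exists>N. \<forall>n\<ge>N. \<forall>m\<ge>N. \<forall>z\<in>{0..1} \<times> S. \<forall>y. norm y \<le> 4 * C \<longrightarrow>
        norm (T n z y - T m z y) \<le> e"
  shows "uniformly_convergent_on ({0..1} \<times> S) u"
proof (rule Cauchy_uniformly_convergent, rule uniformly_Cauchy_onI)
  let ?K = "{0..1::real} \<times> S"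
  \<comment> \<open>The bound \<open>4 * C\<close> reproduces itself: \<open>T\<close> contributes
    at most \<open>C + 4 * C / 2 = 3 * C\<close>, and \<open>w\<close> at most
    \<open>C\<close>.\<close>
  have bound: "norm (u n z) \<le> 4 * C" if "z \<in> ?K" for n z
    using that
  proof (induction n arbitrary: z)
    case (Suc n)
    have "norm (T n z' (u n z')) \<le> 3 * C" if z': "z' \<in> ?K" for z'
    proof -
      have "norm (T n z' (u n z')) \<le> norm (T n z' 0) + norm (T n z' (u n z') - T n z' 0)"
        by (metis add.commute norm_triangle_sub)
      then show ?thesis using lip[OF z', of n "u n z'" 0] T0[OF z', of n] Suc.IH[OF z'] by simp
    qed
    then have "norm (time_int (\<lambda>z. T n z (u n z)) z) \<le> 3 * C"
      using Suc.prems by (intro norm_time_int_le[OF cont Suc.prems]) auto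
    then show ?case
      using rec[OF Suc.prems, of n] w[OF Suc.prems, of n]
        norm_triangle_ineq[of "w n z" "time_int (\<lambda>z. T n z (u n z)) z"] by simp
  qed (rule u0)
  fix e :: real assume e: "e > 0"
  have "uniformly_Cauchy_on ?K w" using wconv by (rule uniformly_convergent_Cauchy)
  then obtain N1 where N1: "\<And>n m z. n \<ge> N1 \<Longrightarrow> m \<ge> N1 \<Longrightarrow> z \<in> ?K \<Longrightarrow> dist (w n z) (w m z) < e / 8"
    using e unfolding uniformly_Cauchy_on_def by (metis divide_pos_pos zero_less_numeral)
  obtain N2 where N2: "\<And>n m z y. n \<ge> N2 \<Longrightarrow> m \<ge> N2 \<Longrightarrow> z \<in> ?K \<Longrightarrow> norm y \<le> 4 * C \<Longrightarrow>
      norm (T n z y - T m z y) \<le> e / 8"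
    using Tconv[of "e / 8"] e by (metis divide_pos_pos zero_less_numeral)
  define N where "N = max N1 N2"
  \<comment> \<open>One step turns a bound \<open>D\<close> into \<open>D / 2 + e / 4\<close>, with
    \<open>e / 8\<close> for the drift of \<open>w\<close> and as much for that of \<open>T\<close>;
    \<open>e / 2\<close> is the fixed point. The start \<open>8 * C\<close> is twice the uniform
    bound.\<close>
  have contract: "norm (u n z - u m z) \<le> 8 * C / 2 ^ j + e / 2"
    if "n \<ge> N + j" "m \<ge> N + j" "z \<in> ?K" for j n m z
    using that
  proof (induction j arbitrary: n m z)
    case 0
    then show ?case
      using bound[of z n] bound[of z m] norm_triangle_ineq4[of "u n z" "u m z"] e by simp
  next
    case (Suc j)
    obtain n' m' where nm: "n = Suc n'" "m = Suc m'" "n' \<ge> N + j" "m' \<ge> N + j"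
      using Suc.prems by (cases n; cases m) auto
    define D where "D = 8 * C / 2 ^ j + e / 2"
    have *: "norm (T n' z' (u n' z') - T m' z' (u m' z')) \<le> D / 2 + e / 8"
      if z': "z' \<in> ?K" for z'
    proof -
      have "norm (T n' z' (u n' z') - T m' z' (u m' z')) \<le>
          norm (T n' z' (u n' z') - T n' z' (u m' z')) + norm (T n' z' (u m' z') - T m' z' (u m' z'))"
        by (metis diff_add_cancel add_diff_eq norm_triangle_ineq)
      moreover have "norm (T n' z' (u m' z') - T m' z' (u m' z')) \<le> e / 8"
        using nm by (intro N2 z' bound) (auto simp: N_def)
      ultimately show ?thesis
        using lip[OF z', of n' "u n' z'" "u m' z'"] Suc.IH[OF nm(3,4) z'] unfolding D_def[symmetric] by linarith
    qed
    have "norm (time_int (\<lambda>z. T n' z (u n' z) - T m' z (u m' z)) z) \<le> D / 2 + e / 8"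
      using Suc.prems(3) by (intro norm_time_int_le[OF continuous_on_diff[OF cont cont] Suc.prems(3)] *) auto
    moreover have "u n z - u m z = (w n' z - w m' z) + time_int (\<lambda>z. T n' z (u n' z) - T m' z (u m' z)) z"
      unfolding nm using Suc.prems(3) by (simp add: rec time_int_diff[OF cont cont])
    moreover have "norm (w n' z - w m' z) < e / 8"
      using N1[of n' m' z] nm Suc.prems(3) by (simp add: N_def dist_norm)
    ultimately have "norm (u n z - u m z) \<le> e / 8 + (D / 2 + e / 8)"
      by (smt (verit) norm_triangle_ineq)
    then show ?case by (simp add: D_def field_simps)
  qed
  have "(\<lambda>j. 8 * C / 2 ^ j) \<longlonglongrightarrow> 0"
    using tendsto_mult_right_zero[OF LIMSEQ_inverse_realpow_zero[of 2]] by (simp add: divide_inverse)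
  then obtain j where j: "8 * C / 2 ^ j < e / 2"
    using order_tendstoD(2)[of _ 0 sequentially "e / 2"] e by (metis eventually_happens half_gt_zero sequentially_bot)
  show "\<exists>M. \<forall>x\<in>?K. \<forall>m\<ge>M. \<forall>n\<ge>M. dist (u m x) (u n x) < e"
  proof (intro exI[of _ "N + j"] ballI allI impI)
    fix z m n assume "z \<in> ?K" "m \<ge> N + j" "n \<ge> N + j"
    from contract[OF this(2,3,1)] j show "dist (u m z) (u n z) < e" by (simp add: dist_norm)
  qed
qed

lemma C0_conv_linear_recursion:
  fixes u :: "nat \<Rightarrow> real \<times> 'a::euclidean_space \<Rightarrow> 'b::euclidean_space"
  assumes u0: "continuous_on ({0..1} \<times> UNIV) (u 0)"
    and rec: "\<And>n z. fst z \<in> {0..1} \<Longrightarrow> u (Suc n) z = w n z + time_int (\<lambda>z. \<Sum>i\<in>Basis. (u n z \<bullet> i) *\<^sub>R a i n z) z"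
    and small: "\<And>n z y. fst z \<in> {0..1} \<Longrightarrow> norm (\<Sum>i\<in>Basis. (y \<bullet> i) *\<^sub>R a i n z) \<le> norm y / 2"
    and w: "C0_conv w" and a: "\<And>i. i \<in> Basis \<Longrightarrow> C0_conv (a i)"
  shows "C0_conv u"
proof -
  have Tc: "continuous_on ({0..1} \<times> S) (\<lambda>z. \<Sum>i\<in>Basis. (u n z \<bullet> i) *\<^sub>R a i n z)"
    if "continuous_on ({0..1} \<times> S) (u n)" for S n
    by (intro continuous_on_sum continuous_on_scaleR continuous_on_inner that continuous_on_const
        C0_conv_continuous a)
  have cu: "continuous_on ({0..1} \<times> UNIV) (u n)" for n
  proof (induction n)
    case (Suc n)
    have "continuous_on ({0..1} \<times> UNIV) (\<lambda>z. w n z + time_int (\<lambda>z. \<Sum>i\<in>Basis. (u n z \<bullet> i) *\<^sub>R a i n z) z)"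
      by (intro continuous_on_add C0_conv_continuous w continuous_on_time_int Tc Suc)
    then show ?case by (rule continuous_on_eq) (auto simp: rec)
  qed (rule u0)
  then have cuS: "continuous_on ({0..1} \<times> S) (u n)" for n S
    by (meson Sigma_mono continuous_on_subset subset_UNIV subset_refl)
  have "uniformly_convergent_on ({0..1} \<times> S) u" if S: "compact S" for S
  proof -
    obtain C1 where C1: "\<And>n z. z \<in> {0..1} \<times> S \<Longrightarrow> norm (w n z) \<le> C1"
      using C0_conv_bounded[OF w S] by blast
    obtain C2 where C2: "\<And>z. z \<in> {0..1} \<times> S \<Longrightarrow> norm (u 0 z) \<le> C2"
      using compact_imp_bounded[OF compact_continuous_image[OF cuS compact_Times[OF compact_Icc S]]]
      unfolding bounded_iff by blast
    define C where "C = \<bar>C1\<bar> + \<bar>C2\<bar>"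
    show ?thesis
    proof (rule picard_uniformly_convergent[where T = "\<lambda>n z y. \<Sum>i\<in>Basis. (y \<bullet> i) *\<^sub>R a i n z" and C = C and w = w])
      show "norm ((\<Sum>i\<in>Basis. (y \<bullet> i) *\<^sub>R a i n z) - (\<Sum>i\<in>Basis. (y' \<bullet> i) *\<^sub>R a i n z)) \<le> norm (y - y') / 2"
        if "z \<in> {0..1::real} \<times> S" for n z and y y' :: 'b
        using small[of z "y - y'" n] that
        by (auto simp: inner_diff_left scaleR_diff_left sum_subtractf)
      show "norm (u 0 z) \<le> 4 * C" if "z \<in> {0..1} \<times> S" for z
        using C2[OF that] by (simp add: C_def)
      show "norm (w n z) \<le> C" if "z \<in> {0..1} \<times> S" for n z
        using C1[OF that, of n] by (simp add: C_def)
      show "uniformly_convergent_on ({0..1} \<times> S) w"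
        using w S unfolding C0_conv_def by blast
      fix e :: real assume e: "e > 0"
      \<comment> \<open>Distributes \<open>e\<close> over \<open>DIM('b)\<close> summands, each with
        a coordinate of size at most \<open>4 * C\<close>; the 1 avoids division by 0.\<close>
      define e' where "e' = e / (4 * C + 1) / real DIM('b)"
      have C0: "C \<ge> 0" by (simp add: C_def)
      have e': "e' > 0" using e C0 by (simp add: e'_def)
      have "\<exists>N. \<forall>n\<ge>N. \<forall>m\<ge>N. \<forall>z\<in>{0..1} \<times> S. dist (a i n z) (a i m z) < e'" if i: "i \<in> Basis" for i
      proof -
        have "uniformly_Cauchy_on ({0..1} \<times> S) (a i)"
          using a[OF i] S uniformly_convergent_Cauchy unfolding C0_conv_def by blast
        then show ?thesis using e' unfolding uniformly_Cauchy_on_def by blast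
      qed
      then obtain N where N: "\<And>i n m z. i \<in> Basis \<Longrightarrow> n \<ge> N i \<Longrightarrow> m \<ge> N i \<Longrightarrow> z \<in> {0..1} \<times> S \<Longrightarrow>
          dist (a i n z) (a i m z) < e'" by metis
      show "\<exists>N. \<forall>n\<ge>N. \<forall>m\<ge>N. \<forall>z\<in>{0..1} \<times> S. \<forall>y. norm y \<le> 4 * C \<longrightarrow>
        norm ((\<Sum>i\<in>Basis. (y \<bullet> i) *\<^sub>R a i n z) - (\<Sum>i\<in>Basis. (y \<bullet> i) *\<^sub>R a i m z)) \<le> e"
      proof (intro exI[of _ "Max (N ` Basis)"] allI impI ballI)
        fix n m and z :: "real \<times> 'a" and y :: 'b
        assume nm: "Max (N ` Basis) \<le> n" "Max (N ` Basis) \<le> m" and z: "z \<in> {0..1} \<times> S" and y: "norm y \<le> 4 * C"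
        have "norm ((\<Sum>i\<in>Basis. (y \<bullet> i) *\<^sub>R a i n z) - (\<Sum>i\<in>Basis. (y \<bullet> i) *\<^sub>R a i m z)) =
            norm (\<Sum>i\<in>Basis. (y \<bullet> i) *\<^sub>R (a i n z - a i m z))"
          by (simp add: scaleR_diff_right sum_subtractf)
        also have "\<dots> \<le> (\<Sum>i\<in>(Basis :: 'b set). (4 * C) * e')"
        proof (rule sum_norm_le)
          fix i :: 'b assume i: "i \<in> Basis"
          have "N i \<le> n" "N i \<le> m" using nm i by (auto simp: Max_le_iff)
          then have "norm (a i n z - a i m z) \<le> e'" using N[OF i _ _ z] by (force simp: dist_norm)
          moreover have "\<bar>y \<bullet> i\<bar> \<le> 4 * C" using Basis_le_norm[OF i, of y] y by linarith
          ultimately show "norm ((y \<bullet> i) *\<^sub>R (a i n z - a i m z)) \<le> (4 * C) * e'"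
            unfolding norm_scaleR using C0 by (intro mult_mono) auto
        qed
        also have "\<dots> = 4 * C * (e / (4 * C + 1))" by (simp add: e'_def)
        also have "\<dots> \<le> e" using C0 e by (simp add: field_simps)
        finally show "norm ((\<Sum>i\<in>Basis. (y \<bullet> i) *\<^sub>R a i n z) - (\<Sum>i\<in>Basis. (y \<bullet> i) *\<^sub>R a i m z)) \<le> e" .
      qed
    qed (use rec Tc[OF cuS] C_def in \<open>auto simp: mem_Times_iff\<close>)
  qed
  with cu show ?thesis unfolding C0_conv_def by blast
qed

text \<open>Differentiating the recursion in direction \<open>v\<close> keeps the coefficients
  \<open>a\<close>, hence their smallness, and only changes the inhomogeneity: it becomes
  \<open>xderiv v (w n)\<close> plus the integral of \<open>u n\<close> against
  \<open>xderiv v (a i n)\<close>. So the induction runs over all \<open>u\<close> and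
  \<open>w\<close>.\<close>

lemma Ck_conv_linear_recursion:
  fixes u :: "nat \<Rightarrow> real \<times> 'a::euclidean_space \<Rightarrow> 'b::euclidean_space"
  assumes small: "\<And>n z y. fst z \<in> {0..1} \<Longrightarrow> norm (\<Sum>i\<in>Basis. (y \<bullet> i) *\<^sub>R a i n z) \<le> norm y / 2"
    and "Ck_conv k (\<lambda>_. u 0)"
    and "\<And>n z. fst z \<in> {0..1} \<Longrightarrow> u (Suc n) z = w n z + time_int (\<lambda>z. \<Sum>i\<in>Basis. (u n z \<bullet> i) *\<^sub>R a i n z) z"
    and "Ck_conv k w" and "\<And>i. i \<in> Basis \<Longrightarrow> Ck_conv k (a i)"
  shows "Ck_conv k u"
  using assms(2-)
proof (induction k arbitrary: u w)
  case 0
  show ?case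
    unfolding Ck_conv.simps
  proof (rule C0_conv_linear_recursion[where w = w and a = a])
    show "continuous_on ({0..1} \<times> UNIV) (u 0)"
      using 0(1) C0_conv_continuous[of "\<lambda>_. u 0"] by simp
  qed (use 0 small in simp_all)
next
  case (Suc k)
  note prems = Suc.prems
  \<comment> \<open>Convergence to one order less, which the new inhomogeneity needs.\<close>
  have u: "Ck_conv k u"
    by (rule Suc.IH[OF Ck_conv_SucD[OF Suc.prems(1)] Suc.prems(2) Ck_conv_SucD[OF Suc.prems(3)]
          Ck_conv_SucD[OF Suc.prems(4)]])
  \<comment> \<open>Without uniformity in \<open>n\<close>: each single iterate has the full
    regularity needed to differentiate under the integral.\<close>
  have 1: "Ck_conv (Suc k) (\<lambda>_. u n)" for n
  proof (induction n)
    case (Suc n)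
    have "Ck_conv (Suc k) (\<lambda>_. a i n)" if "i \<in> Basis" for i
      by (rule Ck_conv_constant_sequence[OF prems(4)[OF that]])
    then have "Ck_conv (Suc k) (\<lambda>_ z. w n z + time_int (\<lambda>z. \<Sum>i\<in>Basis. (u n z \<bullet> i) *\<^sub>R a i n z) z)"
      using Ck_conv_constant_sequence[OF prems(3)] Suc.IH
      by (intro Ck_conv_add Ck_conv_time_int Ck_conv_sum Ck_conv_scaleR Ck_conv_inner)
    then show ?case
      by (rule iffD1[OF Ck_conv_cong, rotated]) (simp add: prems(2))
  qed (rule prems(1))
  have "Ck_conv k (\<lambda>n. xderiv v (u n))" for v
  proof (rule Suc.IH)
    show "Ck_conv k (\<lambda>_. xderiv v (u 0))" using Suc.prems(1) by simp
    show "Ck_conv k (a i)" if "i \<in> Basis" for i using Suc.prems(4)[OF that] by (rule Ck_conv_SucD)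
    show "Ck_conv k (\<lambda>n z. xderiv v (w n) z + time_int (\<lambda>z. \<Sum>i\<in>Basis. (u n z \<bullet> i) *\<^sub>R xderiv v (a i n) z) z)"
      using Suc.prems(3,4) by (intro Ck_conv_add Ck_conv_time_int Ck_conv_sum Ck_conv_scaleR Ck_conv_inner u) simp_all
    fix n and z :: "real \<times> 'a" assume z: "fst z \<in> {0..1}"
    obtain t x where tx: "z = (t, x)" "t \<in> {0..1}" using z by (cases z) auto
    let ?f = "\<lambda>z. \<Sum>i\<in>Basis. (u n z \<bullet> i) *\<^sub>R a i n z"
    have df: "((\<lambda>y. ?f (s, y)) has_derivative (\<lambda>v. \<Sum>i\<in>Basis. (u n (s, x) \<bullet> i) *\<^sub>R xderiv v (a i n) (s, x) +
        (xderiv v (u n) (s, x) \<bullet> i) *\<^sub>R a i n (s, x))) (at x)" if "s \<in> {0..1}" for s x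
      by (intro has_derivative_sum has_derivative_scaleR has_derivative_inner_left
          Ck_conv_has_derivative[OF 1 that] Ck_conv_has_derivative[OF Suc.prems(4) that])
    have C: "Ck_conv (Suc k) (\<lambda>_. ?f)"
      using 1[of n] Ck_conv_constant_sequence[OF Suc.prems(4)]
      by (intro Ck_conv_sum Ck_conv_scaleR Ck_conv_inner)
    have "(\<lambda>y. u (Suc n) (t, y)) = (\<lambda>y. w n (t, y) + time_int ?f (t, y))"
      by (rule ext, rule Suc.prems(2)) (use tx(2) in simp)
    then have "((\<lambda>y. u (Suc n) (t, y)) has_derivative (\<lambda>v. xderiv v (w n) (t, x) + xderiv v (time_int ?f) (t, x))) (at x)"
      using has_derivative_add[OF Ck_conv_has_derivative[OF Suc.prems(3) tx(2), of n x]
        Ck_conv_has_derivative[OF Ck_conv_time_int[OF C] tx(2), of x]]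
      by simp
    then have "xderiv v (u (Suc n)) z = xderiv v (w n) z + xderiv v (time_int ?f) z"
      unfolding tx(1) by (rule xderiv_eqI)
    also have "xderiv v (time_int ?f) z = time_int (xderiv v ?f) z"
      unfolding tx(1)
    proof (rule xderiv_eqI[OF xderiv_time_int[OF _ _ _ tx(2)]])
      show "continuous_on ({0..1} \<times> UNIV) ?f" by (rule C0_conv_continuous[OF Ck_conv_C0[OF C]])
      show "continuous_on ({0..1} \<times> UNIV) (xderiv v ?f)" for v
        by (rule C0_conv_continuous[OF Ck_conv_C0[of k], of "\<lambda>_. xderiv v ?f"]) (use C in simp)
    qed (use df in \<open>auto intro: differentiableI\<close>)
    also have "\<dots> = time_int (\<lambda>z. (\<Sum>i\<in>Basis. (u n z \<bullet> i) *\<^sub>R xderiv v (a i n) z) +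
         (\<Sum>i\<in>Basis. (xderiv v (u n) z \<bullet> i) *\<^sub>R a i n z)) z"
      unfolding tx(1) by (rule time_int_cong) (use tx(2) in \<open>simp_all add: xderiv_eqI[OF df] sum.distrib\<close>)
    also have "\<dots> = time_int (\<lambda>z. \<Sum>i\<in>Basis. (u n z \<bullet> i) *\<^sub>R xderiv v (a i n) z) z +
         time_int (\<lambda>z. \<Sum>i\<in>Basis. (xderiv v (u n) z \<bullet> i) *\<^sub>R a i n z) z"
    proof (rule time_int_add)
      show "z \<in> {0..1} \<times> UNIV" using tx by simp
      have "Ck_conv k (\<lambda>_ z. \<Sum>i\<in>Basis. (u n z \<bullet> i) *\<^sub>R xderiv v (a i n) z)"
        using Ck_conv_SucD[OF 1, of n] Ck_conv_constant_sequence[OF Suc.prems(4)]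
        by (intro Ck_conv_sum Ck_conv_scaleR Ck_conv_inner) simp_all
      then show "continuous_on ({0..1} \<times> UNIV) (\<lambda>z. \<Sum>i\<in>Basis. (u n z \<bullet> i) *\<^sub>R xderiv v (a i n) z)"
        using C0_conv_continuous[OF Ck_conv_C0] by blast
      have "Ck_conv k (\<lambda>_ z. \<Sum>i\<in>Basis. (xderiv v (u n) z \<bullet> i) *\<^sub>R a i n z)"
        using 1[of n] Ck_conv_SucD[OF Ck_conv_constant_sequence[OF Suc.prems(4)]]
        by (intro Ck_conv_sum Ck_conv_scaleR Ck_conv_inner) simp_all
      then show "continuous_on ({0..1} \<times> UNIV) (\<lambda>z. \<Sum>i\<in>Basis. (xderiv v (u n) z \<bullet> i) *\<^sub>R a i n z)"
        using C0_conv_continuous[OF Ck_conv_C0] by blast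
    qed
    finally show "xderiv v (u (Suc n)) z =
       xderiv v (w n) z + time_int (\<lambda>z. \<Sum>i\<in>Basis. (u n z \<bullet> i) *\<^sub>R xderiv v (a i n) z) z +
       time_int (\<lambda>z. \<Sum>i\<in>Basis. (xderiv v (u n) z \<bullet> i) *\<^sub>R a i n z) z"
      by simp
  qed
  then show ?case using Ck_conv_C0[OF u] 1 by auto
qed

text \<open>The derivatives converge uniformly on a unit ball around \<open>x\<close>, which permits
  exchanging limit and derivative. Uniformity in the direction \<open>v\<close> follows from the
  basis directions by linearity.\<close>

lemma Ck_conv_limit:
  fixes f :: "nat \<Rightarrow> real \<times> 'a::euclidean_space \<Rightarrow> 'b::euclidean_space"
  assumes "Ck_conv (Suc k) f" "t \<in> {0..1}"
  shows "((\<lambda>y. lim (\<lambda>n. f n (t, y))) has_derivative (\<lambda>v. lim (\<lambda>n. xderiv v (f n) (t, x)))) (at x)"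
proof -
  define g where "g v x = lim (\<lambda>n. xderiv v (f n) (t, x))" for v x
  have lin: "linear (\<lambda>v. xderiv v (f n) (t, x))" for n x
    using has_derivative_linear[OF Ck_conv_has_derivative[OF assms]] .
  have ul: "uniform_limit ({0..1} \<times> S) (\<lambda>n. xderiv v (f n)) (\<lambda>z. lim (\<lambda>n. xderiv v (f n) z)) sequentially"
    if "compact S" for S v
  proof -
    have "C0_conv (\<lambda>n. xderiv v (f n))" by (rule Ck_conv_C0[of k]) (use assms(1) in simp)
    then show ?thesis
      using that unfolding C0_conv_def uniformly_convergent_uniform_limit_iff by blast
  qed
  have tl: "(\<lambda>n. xderiv v (f n) (t, x)) \<longlonglongrightarrow> g v x" for v x
    using tendsto_uniform_limitI[OF ul[of "{x}" v], of "(t, x)"] assms(2) by (simp add: g_def)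
  have ling: "g v x = (\<Sum>i\<in>Basis. (v \<bullet> i) *\<^sub>R g i x)" for v x
  proof (rule LIMSEQ_unique[OF tl])
    have "(\<lambda>n. \<Sum>i\<in>Basis. (v \<bullet> i) *\<^sub>R xderiv i (f n) (t, x)) \<longlonglongrightarrow> (\<Sum>i\<in>Basis. (v \<bullet> i) *\<^sub>R g i x)"
      by (intro tendsto_sum tendsto_scaleR tendsto_const tl)
    then show "(\<lambda>n. xderiv v (f n) (t, x)) \<longlonglongrightarrow> (\<Sum>i\<in>Basis. (v \<bullet> i) *\<^sub>R g i x)"
      using linear_sum_Basis[OF lin, of v] by simp
  qed
  have "C0_conv f" using Ck_conv_C0[OF assms(1)] .
  then have ulf: "uniform_limit ({0..1} \<times> {x}) f (\<lambda>z. lim (\<lambda>n. f n z)) sequentially" for x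
    by (simp add: C0_conv_def uniformly_convergent_uniform_limit_iff)
  have tf: "(\<lambda>n. f n (t, x)) \<longlonglongrightarrow> lim (\<lambda>n. f n (t, x))" for x
    using tendsto_uniform_limitI[OF ulf[of x], of "(t, x)"] assms(2) by simp
  have "\<exists>h. \<forall>y\<in>ball x 1. (\<lambda>n. f n (t, y)) \<longlonglongrightarrow> h y \<and> (h has_derivative (\<lambda>v. g v y)) (at y within ball x 1)"
  proof (rule has_derivative_sequence[where f' = "\<lambda>n y v. xderiv v (f n) (t, y)"])
    show "((\<lambda>y. f n (t, y)) has_derivative (\<lambda>v. xderiv v (f n) (t, y))) (at y within ball x 1)" for n y
      using Ck_conv_has_derivative[OF assms] by (rule has_derivative_at_withinI)
    show "(\<lambda>n. f n (t, x)) \<longlonglongrightarrow> lim (\<lambda>n. f n (t, x))" by (rule tf)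
    fix e :: real assume e: "e > 0"
    define e' where "e' = e / real DIM('a)"
    have e': "e' > 0" using e by (simp add: e'_def)
    have "\<forall>\<^sub>F n in sequentially. \<forall>i\<in>Basis. \<forall>z\<in>{0..1} \<times> cball x 1. dist (xderiv i (f n) z) (lim (\<lambda>n. xderiv i (f n) z)) < e'"
      by (intro eventually_ball_finite ballI uniform_limitD[OF ul] e') auto
    then show "\<forall>\<^sub>F n in sequentially. \<forall>y\<in>ball x 1. \<forall>v. norm (xderiv v (f n) (t, y) - g v y) \<le> e * norm v"
    proof eventually_elim
      case (elim n)
      show ?case
      proof (intro ballI allI)
        fix y v assume y: "y \<in> ball x 1"
        have "norm (xderiv v (f n) (t, y) - g v y) =
           norm (\<Sum>i\<in>Basis. (v \<bullet> i) *\<^sub>R (xderiv i (f n) (t, y) - g i y))"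
          using linear_sum_Basis[OF lin, of v n y] ling[of v y] by (simp add: scaleR_diff_right sum_subtractf)
        also have "\<dots> \<le> (\<Sum>i\<in>(Basis :: 'a set). norm v * e')"
        proof (rule sum_norm_le)
          fix i :: 'a assume i: "i \<in> Basis"
          have "norm (xderiv i (f n) (t, y) - g i y) \<le> e'"
            using bspec[OF bspec[OF elim i], of "(t, y)"] y assms(2) by (simp add: g_def dist_norm)
          then show "norm ((v \<bullet> i) *\<^sub>R (xderiv i (f n) (t, y) - g i y)) \<le> norm v * e'"
            unfolding norm_scaleR using Basis_le_norm[OF i, of v] by (intro mult_mono) auto
        qed
        also have "\<dots> = e * norm v" by (simp add: e'_def)
        finally show "norm (xderiv v (f n) (t, y) - g v y) \<le> e * norm v" .
      qed
    qed
  qed auto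
  then obtain h where h: "\<forall>y\<in>ball x 1. (\<lambda>n. f n (t, y)) \<longlonglongrightarrow> h y \<and>
      (h has_derivative (\<lambda>v. g v y)) (at y within ball x 1)" ..
  have hx: "(h has_derivative (\<lambda>v. g v x)) (at x)"
    using bspec[OF h, of x] at_within_open[of x "ball x 1"] by simp
  show ?thesis
    unfolding g_def[symmetric]
  proof (rule has_derivative_transform_within_open[OF hx open_ball])
    show "h y = lim (\<lambda>n. f n (t, y))" if "y \<in> ball x 1" for y
      using limI[OF conjunct1[OF bspec[OF h that]]] by simp
  qed simp
qed

lemma Ck_on_limit:
  assumes "Ck_conv k f" "t \<in> {0..1}"
  shows "Ck_on k UNIV (\<lambda>x. lim (\<lambda>n. f n (t, x)))"
  using assms(1)
proof (induction k arbitrary: f)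
  case 0
  have "\<exists>l. uniform_limit ({0..1} \<times> cball 0 r) f l sequentially" for r
    using C0_convD[of f "cball 0 r"] 0 by auto
  have "isCont (\<lambda>x. lim (\<lambda>n. f n (t, x))) x" for x
  proof -
    obtain l where l: "uniform_limit ({0..1} \<times> cball x 1) f l sequentially" "continuous_on ({0..1} \<times> cball x 1) l"
      using C0_convD[of f "cball x 1"] 0 by auto
    have "l (t, y) = lim (\<lambda>n. f n (t, y))" if "y \<in> ball x 1" for y
      using limI[OF tendsto_uniform_limitI[OF l(1), of "(t, y)"]] that assms(2) by auto
    moreover have "continuous_on (ball x 1) (\<lambda>y. l (t, y))"
      using assms(2) by (intro continuous_on_compose2[OF l(2)] continuous_intros) auto
    ultimately have "continuous_on (ball x 1) (\<lambda>y. lim (\<lambda>n. f n (t, y)))"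
      using continuous_on_cong by (metis (no_types, lifting))
    then show ?thesis
      using continuous_on_eq_continuous_at[OF open_ball, of x 1 "\<lambda>y. lim (\<lambda>n. f n (t, y))"] by simp
  qed
  then show ?case by (simp add: continuous_at_imp_continuous_on)
next
  case (Suc k)
  have d: "((\<lambda>y. lim (\<lambda>n. f n (t, y))) has_derivative (\<lambda>v. lim (\<lambda>n. xderiv v (f n) (t, x)))) (at x)" for x
    by (rule Ck_conv_limit[OF Suc.prems assms(2)])
  then have "(\<lambda>y. lim (\<lambda>n. f n (t, y))) differentiable (at x)" for x by (rule differentiableI)
  moreover have "Ck_on k UNIV (\<lambda>x. lim (\<lambda>n. xderiv v (f n) (t, x)))" for v
    using Suc.prems by (intro Suc.IH) simp
  ultimately show ?case by (simp add: frechet_derivative_eqI[OF d])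
qed

section \<open>Flows of vector fields\<close>

lemma has_vector_derivative_norm_bound:
  fixes f :: "real \<Rightarrow> 'a::real_normed_vector"
  assumes "\<And>t. t \<in> {a..b} \<Longrightarrow> (f has_vector_derivative f' t) (at t within {a..b})"
    and "\<And>t. t \<in> {a..b} \<Longrightarrow> norm (f' t) \<le> B" and "s \<in> {a..b}" "t \<in> {a..b}"
  shows "norm (f t - f s) \<le> B * \<bar>t - s\<bar>"
proof -
  have "norm (f t - f s) \<le> B * norm (t - s)"
  proof (rule differentiable_bound[of "{a..b}" f "\<lambda>t h. h *\<^sub>R f' t" B t s])
    show "onorm (\<lambda>h. h *\<^sub>R f' t) \<le> B" if "t \<in> {a..b}" for t
      using mult_right_mono[OF assms(2)[OF that], of "\<bar>h\<bar>" for h]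
      by (intro onorm_le) (simp add: mult.commute)
  qed (use assms in \<open>auto simp: has_vector_derivative_def\<close>)
  then show ?thesis by simp
qed

lemma norm_attains_sup:
  fixes f :: "real \<Rightarrow> 'a::real_normed_vector"
  assumes "continuous_on {a..b} f" "t \<in> {a..b}"
  obtains s where "s \<in> {a..b}" "\<And>r. r \<in> {a..b} \<Longrightarrow> norm (f r) \<le> norm (f s)"
  using continuous_attains_sup[OF compact_Icc _ continuous_on_norm[OF assms(1)]] assms(2) by auto

text \<open>At a time of maximal distance \<open>D\<close> the mean value bound gives
  \<open>D \<le> K * (b - a) * D \<le> D / 2\<close>. The common point \<open>t0\<close> may lie
  anywhere in the interval, as the open-closed argument on manifolds requires.\<close>

lemma ode_unique:
  fixes y z :: "real \<Rightarrow> 'a::real_normed_vector"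
  assumes y: "\<And>t. t \<in> {a..b} \<Longrightarrow> (y has_vector_derivative X (y t)) (at t within {a..b})"
    and z: "\<And>t. t \<in> {a..b} \<Longrightarrow> (z has_vector_derivative X (z t)) (at t within {a..b})"
    and lip: "\<And>x x'. norm (X x - X x') \<le> K * norm (x - x')" and K: "0 \<le> K" "K * (b - a) \<le> 1/2"
    and t0: "t0 \<in> {a..b}" "y t0 = z t0" and t: "t \<in> {a..b}"
  shows "y t = z t"
proof -
  have d: "((\<lambda>t. y t - z t) has_vector_derivative X (y t) - X (z t)) (at t within {a..b})" if "t \<in> {a..b}" for t
    by (rule has_vector_derivative_diff[OF y[OF that] z[OF that]])
  have "continuous_on {a..b} (\<lambda>t. y t - z t)" by (rule continuous_on_vector_derivative[OF d])
  then obtain s where s: "s \<in> {a..b}" "\<And>r. r \<in> {a..b} \<Longrightarrow> norm (y r - z r) \<le> norm (y s - z s)"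
    by (rule norm_attains_sup[OF _ t]) blast
  let ?D = "norm (y s - z s)"
  have "norm ((y s - z s) - (y t0 - z t0)) \<le> (K * ?D) * \<bar>s - t0\<bar>"
  proof (rule has_vector_derivative_norm_bound[OF d _ t0(1) s(1)])
    show "norm (X (y r) - X (z r)) \<le> K * ?D" if "r \<in> {a..b}" for r
      using order_trans[OF lip mult_left_mono[OF s(2)[OF that] K(1)]] .
  qed
  also have "\<dots> \<le> (K * ?D) * (b - a)"
    using s(1) t0(1) K(1) by (intro mult_left_mono) auto
  also have "\<dots> = (K * (b - a)) * ?D" by simp
  also have "\<dots> \<le> 1/2 * ?D" using K(2) by (rule mult_right_mono) simp
  finally have "?D \<le> 0" using t0(2) by simp
  then show ?thesis using s(2)[OF t] by simp
qed

primrec picard :: "('a::euclidean_space \<Rightarrow> 'a) \<Rightarrow> nat \<Rightarrow> real \<times> 'a \<Rightarrow> 'a" where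
  "picard X 0 = snd"
| "picard X (Suc n) = (\<lambda>z. snd z + time_int (\<lambda>z. X (picard X n z)) z)"

text \<open>Used for \<open>t\<close> in \<open>{0..1}\<close> and fields satisfying
  \<open>small_field\<close>, where the iterates converge.\<close>

definition flow :: "('a::euclidean_space \<Rightarrow> 'a) \<Rightarrow> real \<Rightarrow> 'a \<Rightarrow> 'a" where
  "flow X t x = lim (\<lambda>n. picard X n (t, x))"

text \<open>The recursion passes to an integral equation for the limit, which the fundamental
  theorem of calculus turns into a differential equation. It serves twice: for the flow and for its
  space derivative.\<close>

lemma C0_conv_recursion_limit:
  fixes u :: "nat \<Rightarrow> real \<times> 'a::euclidean_space \<Rightarrow> 'b::euclidean_space"
  assumes u: "C0_conv u" and T: "C0_conv T"
    and rec: "\<And>n t x. t \<in> {0..1} \<Longrightarrow> u (Suc n) (t, x) = w x + time_int (T n) (t, x)"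
    and t: "t \<in> {0..1}"
  shows "((\<lambda>s. lim (\<lambda>n. u n (s, x))) has_vector_derivative lim (\<lambda>n. T n (t, x))) (at t within {0..1})"
    and "lim (\<lambda>n. u n (0, x)) = w x" and "(\<lambda>n. u n (t, x)) \<longlonglongrightarrow> lim (\<lambda>n. u n (t, x))"
proof -
  let ?T = "\<lambda>z. lim (\<lambda>n. T n z)"
  have lT: "uniform_limit ({0..1} \<times> {x}) T ?T sequentially"
    and lu: "uniform_limit ({0..1} \<times> {x}) u (\<lambda>z. lim (\<lambda>n. u n z)) sequentially"
    using u T by (simp_all add: C0_conv_def uniformly_convergent_uniform_limit_iff)
  have tu: "(\<lambda>n. u n (t, x)) \<longlonglongrightarrow> lim (\<lambda>n. u n (t, x))" if "t \<in> {0..1}" for t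
    using tendsto_uniform_limitI[OF lu, of "(t, x)"] that by simp
  then show "(\<lambda>n. u n (t, x)) \<longlonglongrightarrow> lim (\<lambda>n. u n (t, x))" using t .
  have lI: "(\<lambda>n. time_int (T n) (t, x)) \<longlonglongrightarrow> integral {0..t} (\<lambda>s. ?T (s, x))" if "t \<in> {0..1}" for t
    using tendsto_uniform_limitI[OF uniform_limit_time_int[OF C0_conv_continuous[OF T] lT], of "(t, x)"] that
    by (simp add: time_int_eq_integral[OF that, of ?T])
  have eq: "lim (\<lambda>n. u n (t, x)) = w x + integral {0..t} (\<lambda>s. ?T (s, x))" if "t \<in> {0..1}" for t
  proof (rule LIMSEQ_unique)
    show "(\<lambda>n. u (Suc n) (t, x)) \<longlonglongrightarrow> lim (\<lambda>n. u n (t, x))"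
      using tu[OF that] by (rule LIMSEQ_Suc)
    show "(\<lambda>n. u (Suc n) (t, x)) \<longlonglongrightarrow> w x + integral {0..t} (\<lambda>s. ?T (s, x))"
      unfolding rec[OF that]
      by (intro tendsto_add tendsto_const lI that)
  qed
  show "lim (\<lambda>n. u n (0, x)) = w x" by (simp add: eq)
  have "continuous_on ({0..1} \<times> {x}) ?T"
    using uniform_limit_theorem[OF _ lT] C0_conv_continuous[OF T] by simp
  then have "continuous_on {0..1} (\<lambda>s. ?T (s, x))"
    by (rule continuous_on_compose2) (auto intro!: continuous_intros)
  from has_vector_derivative_add[OF has_vector_derivative_const[of "w x"]
      integral_has_vector_derivative[OF this t]]
  have H: "((\<lambda>s. w x + integral {0..s} (\<lambda>s. ?T (s, x))) has_vector_derivative ?T (t, x)) (at t within {0..1})"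
    by simp
  show "((\<lambda>s. lim (\<lambda>n. u n (s, x))) has_vector_derivative ?T (t, x)) (at t within {0..1})"
    by (rule has_vector_derivative_transform[OF t _ H]) (rule eq)
qed

lemma Ck_conv_snd: "Ck_conv k (\<lambda>n. snd :: real \<times> 'a::euclidean_space \<Rightarrow> 'a)"
proof -
  have 0: "C0_conv (\<lambda>n. snd :: real \<times> 'a \<Rightarrow> 'a)"
    by (auto simp: C0_conv_def intro!: continuous_intros uniformly_convergent_on_const)
  show ?thesis
  proof (cases k)
    case (Suc n)
    show ?thesis unfolding Suc
      by (rule Ck_conv_SucI[OF 0, where f' = "\<lambda>v n z. v"]) simp_all
  qed (simp add: 0)
qed

text \<open>The bound 1/2 lets a single Picard iteration cover all of \<open>{0..1}\<close>, so no
  short-time flows have to be glued. A compactly supported field satisfies it after multiplication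
  by a small constant.\<close>

locale small_field =
  fixes X :: "'a::euclidean_space \<Rightarrow> 'a" and K :: real
  assumes smooth: "\<And>k. Ck_on k UNIV X"
    and deriv_le: "\<And>x v. norm (frechet_derivative X (at x) v) \<le> K * norm v"
    and K: "0 \<le> K" "K \<le> 1/2"
begin

lemma X_has_derivative: "(X has_derivative frechet_derivative X (at x)) (at x)"
  using Ck_on_has_derivative[OF smooth[of "Suc 0"]] by simp

lemma lipschitz: "norm (X x - X y) \<le> K * norm (x - y)"
  by (rule differentiable_bound[of UNIV X "\<lambda>x. frechet_derivative X (at x)"])
    (auto intro: onorm_le deriv_le X_has_derivative)

lemma half: "K * norm v \<le> norm v / 2" for v :: 'a
  using mult_right_mono[OF K(2), of "norm v"] by simp

lemma picard_smooth: "Ck_conv k (\<lambda>_. picard X n)"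
proof (induction n)
  case (Suc n)
  have "Ck_conv k (\<lambda>_ z. snd z + time_int (\<lambda>z. X (picard X n z)) z)"
    by (intro Ck_conv_add Ck_conv_time_int Ck_conv_snd Ck_conv_compose[OF Suc smooth])
  then show ?case by simp
qed (simp add: Ck_conv_snd)

lemma picard_C0_conv: "C0_conv (picard X)"
proof -
  have "uniformly_convergent_on ({0..1} \<times> S) (picard X)" if S: "compact S" for S
  proof -
    obtain B where B: "\<And>x. x \<in> S \<Longrightarrow> norm x \<le> B"
      using compact_imp_bounded[OF S] unfolding bounded_iff by blast
    define C where "C = \<bar>B\<bar> + norm (X 0)"
    have C: "norm x \<le> C" if "x \<in> S" for x
      using B[OF that] norm_ge_zero[of "X 0"] unfolding C_def by linarith
    show ?thesis
    proof (rule picard_uniformly_convergent[where T = "\<lambda>n z y. X y" and w = "\<lambda>n. snd" and C = C])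
      show "continuous_on ({0..1} \<times> S) (\<lambda>z. X (picard X n z))" for n
        by (rule C0_conv_continuous[OF C0_conv_compose[OF Ck_conv_C0[OF picard_smooth]
                Ck_on_imp_continuous_on[OF smooth]]])
      show "norm (X y - X y') \<le> norm (y - y') / 2" for y y'
        using order_trans[OF lipschitz half] .
      show "norm (picard X 0 z) \<le> 4 * C" if "z \<in> {0..1} \<times> S" for z
        using C[of "snd z"] that norm_ge_zero[of "snd z"] by (auto simp del: norm_ge_zero)
    qed (use C in \<open>auto simp: C_def intro: uniformly_convergent_on_const\<close>)
  qed
  then show ?thesis
    using C0_conv_continuous[OF Ck_conv_C0[OF picard_smooth]] by (simp add: C0_conv_def)
qed

lemma xderiv_picard:
  assumes "t \<in> {0..1}"
  shows "xderiv v (picard X (Suc n)) (t, x) = v +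
    time_int (\<lambda>z. \<Sum>i\<in>Basis. (xderiv v (picard X n) z \<bullet> i) *\<^sub>R frechet_derivative X (at (picard X n z)) i) (t, x)"
proof -
  let ?f = "\<lambda>z. X (picard X n z)"
  have C: "Ck_conv (Suc 0) (\<lambda>_. ?f)" by (rule Ck_conv_compose[OF picard_smooth smooth])
  have df: "((\<lambda>y. ?f (s, y)) has_derivative (\<lambda>v. \<Sum>i\<in>Basis. (xderiv v (picard X n) (s, y) \<bullet> i) *\<^sub>R
      frechet_derivative X (at (picard X n (s, y))) i)) (at y)" if "s \<in> {0..1}" for s y
    by (rule has_derivative_eq_rhs[OF has_derivative_compose[OF
            Ck_conv_has_derivative[OF picard_smooth that] X_has_derivative]])
      (rule ext, rule linear_sum_Basis[OF has_derivative_linear[OF X_has_derivative]])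
  have "((\<lambda>y. time_int ?f (t, y)) has_derivative (\<lambda>v. time_int (xderiv v ?f) (t, x))) (at x)"
  proof (rule xderiv_time_int[OF _ _ _ assms])
    show "continuous_on ({0..1} \<times> UNIV) ?f" by (rule C0_conv_continuous[OF Ck_conv_C0[OF C]])
    show "continuous_on ({0..1} \<times> UNIV) (xderiv v ?f)" for v
      by (rule C0_conv_continuous[OF Ck_conv_C0[of 0], of "\<lambda>_. xderiv v ?f"]) (use C in simp)
    show "(\<lambda>y. ?f (t, y)) differentiable at x" if "t \<in> {0..1}" for t x
      using df[OF that] by (rule differentiableI)
  qed
  from has_derivative_add[OF has_derivative_ident this]
  have "xderiv v (picard X (Suc n)) (t, x) = v + time_int (xderiv v ?f) (t, x)"
    by (intro xderiv_eqI) simp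
  also have "time_int (xderiv v ?f) (t, x) = time_int (\<lambda>z. \<Sum>i\<in>Basis. (xderiv v (picard X n) z \<bullet> i) *\<^sub>R
      frechet_derivative X (at (picard X n z)) i) (t, x)"
    using assms by (intro time_int_cong) (auto simp: xderiv_eqI[OF df])
  finally show ?thesis .
qed

text \<open>The derivatives of the iterates obey a linear recursion with the derivative of
  \<open>X\<close> along the iterates as coefficients. These converge to order \<open>k\<close> if
  the iterates do, and the recursion lifts this to order \<open>Suc k\<close>.\<close>

lemma picard_Ck_conv: "Ck_conv k (picard X)"
proof (induction k)
  case (Suc k)
  have "Ck_conv k (\<lambda>n. xderiv v (picard X n))" for v
  proof (rule Ck_conv_linear_recursion[where a = "\<lambda>i n z. frechet_derivative X (at (picard X n z)) i"
        and w = "\<lambda>n z. v"])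
    show "norm (\<Sum>i\<in>Basis. (y \<bullet> i) *\<^sub>R frechet_derivative X (at (picard X n z)) i) \<le> norm y / 2" for n z y
      using order_trans[OF deriv_le half, of "picard X n z" y]
        linear_sum_Basis[OF has_derivative_linear[OF X_has_derivative], of "picard X n z" y] by simp
    show "Ck_conv k (\<lambda>_. xderiv v (picard X 0))"
      using picard_smooth[of "Suc k" 0] by simp
    show "Ck_conv k (\<lambda>n z. frechet_derivative X (at (picard X n z)) i)" for i
      by (rule Ck_conv_compose[OF Suc]) (use smooth[of "Suc k"] in simp)
    fix n and z :: "real \<times> 'a" assume "fst z \<in> {0..1}"
    then show "xderiv v (picard X (Suc n)) z = v + time_int (\<lambda>z. \<Sum>i\<in>Basis. (xderiv v (picard X n) z \<bullet> i) *\<^sub>R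
        frechet_derivative X (at (picard X n z)) i) z"
      using xderiv_picard[of "fst z" v n "snd z"] by simp
  qed simp
  moreover have "(\<lambda>y. picard X n (t, y)) differentiable (at x)" if "t \<in> {0..1}" for n t x
    using picard_smooth[of "Suc 0" n] that by simp
  ultimately show ?case using picard_C0_conv by simp
qed (simp add: picard_C0_conv)

lemma Ck_on_flow: "t \<in> {0..1} \<Longrightarrow> Ck_on k UNIV (flow X t)"
  using Ck_on_limit[OF picard_Ck_conv] by (simp add: flow_def[abs_def])

lemma C0_conv_X_picard: "C0_conv (\<lambda>n z. X (picard X n z))"
  by (rule C0_conv_compose[OF picard_C0_conv Ck_on_imp_continuous_on[OF smooth]])

lemma picard_tendsto: "t \<in> {0..1} \<Longrightarrow> (\<lambda>n. picard X n (t, x)) \<longlonglongrightarrow> flow X t x"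
  unfolding flow_def
  by (rule C0_conv_recursion_limit(3)[OF picard_C0_conv C0_conv_X_picard, where w = "\<lambda>x. x"]) auto

lemma flow_0: "flow X 0 x = x"
  unfolding flow_def
  by (rule C0_conv_recursion_limit(2)[OF picard_C0_conv C0_conv_X_picard, where w = "\<lambda>x. x" and t = 0]) auto

lemma flow_has_vector_derivative:
  assumes "t \<in> {0..1}"
  shows "((\<lambda>s. flow X s x) has_vector_derivative X (flow X t x)) (at t within {0..1})"
proof -
  have "isCont X (flow X t x)" using X_has_derivative has_derivative_continuous by blast
  then have "(\<lambda>n. X (picard X n (t, x))) \<longlonglongrightarrow> X (flow X t x)"
    using picard_tendsto[OF assms] by (rule isCont_tendsto_compose)
  then have "lim (\<lambda>n. X (picard X n (t, x))) = X (flow X t x)" by (rule limI)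
  moreover have "((\<lambda>s. lim (\<lambda>n. picard X n (s, x))) has_vector_derivative lim (\<lambda>n. X (picard X n (t, x))))
      (at t within {0..1})"
    by (rule C0_conv_recursion_limit(1)[OF picard_C0_conv C0_conv_X_picard, where w = "\<lambda>x. x"])
      (use assms in auto)
  ultimately show ?thesis by (simp add: flow_def)
qed

text \<open>The recursion for the derivatives of the iterates passes to the limit as the one for the
  iterates did. The result is needed to differentiate the pulled-back symplectic form in
  time.\<close>

lemma variational_equation:
  assumes "t \<in> {0..1}"
  shows "((\<lambda>s. frechet_derivative (flow X s) (at x) v) has_vector_derivative
    frechet_derivative X (at (flow X t x)) (frechet_derivative (flow X t) (at x) v)) (at t within {0..1})"
proof -
  let ?u = "\<lambda>n. xderiv v (picard X n)"
  let ?T = "\<lambda>n z. \<Sum>i\<in>Basis. (?u n z \<bullet> i) *\<^sub>R frechet_derivative X (at (picard X n z)) i"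
  have fd: "frechet_derivative (flow X s) (at x) v = lim (\<lambda>n. ?u n (s, x))" if "s \<in> {0..1}" for s
    using frechet_derivative_eqI[OF Ck_conv_limit[OF picard_Ck_conv that]] by (simp add: flow_def[abs_def])
  have u: "C0_conv ?u" by (rule Ck_conv_C0[of 0]) (use picard_Ck_conv[of "Suc 0"] in simp)
  have cX: "continuous_on UNIV (\<lambda>x. frechet_derivative X (at x) i)" for i
    using Ck_on_imp_continuous_on[of 0] smooth[of "Suc 0"] by simp
  have T: "C0_conv ?T"
    unfolding Ck_conv.simps(1)[symmetric]
    by (intro Ck_conv_sum Ck_conv_scaleR Ck_conv_inner)
      (simp_all add: u C0_conv_compose[OF picard_C0_conv cX])
  have rec: "xderiv v (picard X (Suc n)) (t, x) = v + time_int (?T n) (t, x)" if "t \<in> {0..1}" for n t x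
    by (rule xderiv_picard[OF that])
  have "(\<lambda>n. ?T n (t, x)) \<longlonglongrightarrow> (\<Sum>i\<in>Basis. (frechet_derivative (flow X t) (at x) v \<bullet> i) *\<^sub>R
      frechet_derivative X (at (flow X t x)) i)"
  proof (intro tendsto_sum tendsto_scaleR tendsto_inner tendsto_const)
    show "(\<lambda>n. ?u n (t, x)) \<longlonglongrightarrow> frechet_derivative (flow X t) (at x) v"
      unfolding fd[OF assms] by (rule C0_conv_recursion_limit(3)[OF u T rec assms])
    show "(\<lambda>n. frechet_derivative X (at (picard X n (t, x))) i) \<longlonglongrightarrow> frechet_derivative X (at (flow X t x)) i" for i
      using cX[of i] by (intro continuous_on_tendsto_compose[OF _ picard_tendsto[OF assms]]) auto
  qed
  then have "lim (\<lambda>n. ?T n (t, x)) =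
      frechet_derivative X (at (flow X t x)) (frechet_derivative (flow X t) (at x) v)"
    unfolding linear_sum_Basis[OF has_derivative_linear[OF X_has_derivative],
        of "flow X t x" "frechet_derivative (flow X t) (at x) v"] by (rule limI)
  with C0_conv_recursion_limit(1)[OF u T rec assms, of x]
  have H: "((\<lambda>s. lim (\<lambda>n. ?u n (s, x))) has_vector_derivative
      frechet_derivative X (at (flow X t x)) (frechet_derivative (flow X t) (at x) v)) (at t within {0..1})"
    by simp
  show ?thesis by (rule has_vector_derivative_transform[OF assms _ H]) (rule fd)
qed

text \<open>If \<open>m\<close> is the maximal displacement, the speed never exceeds
  \<open>norm (X x) + m / 2\<close>, so \<open>m \<le> norm (X x) + m / 2\<close>.\<close>

lemma flow_displacement:
  assumes "t \<in> {0..1}"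
  shows "norm (flow X t x - x) \<le> 2 * norm (X x)"
proof -
  have d: "((\<lambda>s. flow X s x) has_vector_derivative X (flow X s x)) (at s within {0..1})"
    if "s \<in> {0..1}" for s by (rule flow_has_vector_derivative[OF that])
  have "continuous_on {0..1} (\<lambda>s. flow X s x)" by (rule continuous_on_vector_derivative[OF d])
  then have "continuous_on {0..1} (\<lambda>s. flow X s x - x)" by (intro continuous_intros)
  then obtain s where s: "s \<in> {0..1}" "\<And>r. r \<in> {0..1} \<Longrightarrow> norm (flow X r x - x) \<le> norm (flow X s x - x)"
    by (rule norm_attains_sup[OF _ assms]) blast
  let ?m = "norm (flow X s x - x)"
  have "norm (flow X s x - flow X 0 x) \<le> (norm (X x) + ?m / 2) * \<bar>s - 0\<bar>"
  proof (rule has_vector_derivative_norm_bound[OF d])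
    fix r :: real assume "r \<in> {0..1}"
    then show "norm (X (flow X r x)) \<le> norm (X x) + ?m / 2"
      using norm_triangle_sub[of "X (flow X r x)" "X x"] lipschitz[of "flow X r x" x] half[of "flow X r x - x"]
        s(2)[of r] by simp
  qed (use s in auto)
  also have "\<dots> \<le> (norm (X x) + ?m / 2) * 1" using s(1) by (intro mult_left_mono) auto
  finally have "?m \<le> 2 * norm (X x)" by (simp add: flow_0)
  then show ?thesis using s(2)[OF assms] by linarith
qed

lemma flow_stationary: "t \<in> {0..1} \<Longrightarrow> X x = 0 \<Longrightarrow> flow X t x = x"
  using flow_displacement[of t x] by simp

text \<open>Comparison of the time-one map with one Euler step. For a field scaled by
  \<open>c\<close>, both \<open>K\<close> and the field are proportional to \<open>c\<close>, so the
  error is quadratic in \<open>c\<close>.\<close>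

lemma flow_1_approx: "norm (flow X 1 x - x - X x) \<le> 2 * K * norm (X x)"
proof -
  have "norm ((flow X 1 x - 1 *\<^sub>R X x) - (flow X 0 x - 0 *\<^sub>R X x)) \<le> (2 * K * norm (X x)) * \<bar>1 - 0\<bar>"
  proof (rule has_vector_derivative_norm_bound[where a = 0 and b = 1 and f' = "\<lambda>s. X (flow X s x) - X x"])
    fix s :: real assume s: "s \<in> {0..1}"
    show "((\<lambda>s. flow X s x - s *\<^sub>R X x) has_vector_derivative X (flow X s x) - X x) (at s within {0..1})"
      using flow_has_vector_derivative[OF s] by (auto intro!: derivative_eq_intros)
    show "norm (X (flow X s x) - X x) \<le> 2 * K * norm (X x)"
      using order_trans[OF lipschitz mult_left_mono[OF flow_displacement[OF s] K(1)]] by (simp add: mult_ac)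
  qed auto
  then show ?thesis by (simp add: flow_0 algebra_simps)
qed

lemma small_field_uminus: "small_field (\<lambda>x. - X x) K"
proof
  have "frechet_derivative (\<lambda>x. - X x) (at x) = (\<lambda>v. - frechet_derivative X (at x) v)" for x
    by (rule frechet_derivative_eqI[OF has_derivative_minus[OF X_has_derivative]])
  then show "norm (frechet_derivative (\<lambda>x. - X x) (at x) v) \<le> K * norm v" for x v
    using deriv_le by simp
qed (use smooth K in \<open>auto intro: Ck_on_uminus\<close>)

text \<open>The reversed trajectory \<open>flow X (t - s) x\<close> solves the equation of
  \<open>- X\<close> and starts at \<open>flow X t x\<close>.\<close>

lemma flow_inverse:
  assumes t: "t \<in> {0..1}"
  shows "flow (\<lambda>x. - X x) t (flow X t x) = x"
proof -
  interpret m: small_field "\<lambda>x. - X x" K by (rule small_field_uminus)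
  have "flow X (t - t) x = flow (\<lambda>x. - X x) t (flow X t x)"
  proof (rule ode_unique[where a = 0 and b = t and X = "\<lambda>x. - X x" and K = K and ?t0.0 = 0
        and y = "\<lambda>s. flow X (t - s) x" and z = "\<lambda>s. flow (\<lambda>x. - X x) s (flow X t x)"])
    fix s assume s: "s \<in> {0..t}"
    have "((\<lambda>s. flow X s x) \<circ> (\<lambda>s. t - s) has_vector_derivative (- 1) *\<^sub>R X (flow X (t - s) x)) (at s within {0..t})"
    proof (rule vector_diff_chain_within)
      show "((\<lambda>s. t - s) has_vector_derivative - 1) (at s within {0..t})"
        by (auto intro!: derivative_eq_intros)
      show "((\<lambda>s. flow X s x) has_vector_derivative X (flow X (t - s) x)) (at (t - s) within (\<lambda>s. t - s) ` {0..t})"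
        by (rule has_vector_derivative_within_subset[OF flow_has_vector_derivative]) (use s t in auto)
    qed
    then show "((\<lambda>s. flow X (t - s) x) has_vector_derivative - X (flow X (t - s) x)) (at s within {0..t})"
      by (simp add: o_def)
    show "((\<lambda>s. flow (\<lambda>x. - X x) s (flow X t x)) has_vector_derivative
        - X (flow (\<lambda>x. - X x) s (flow X t x))) (at s within {0..t})"
      by (rule has_vector_derivative_within_subset[OF m.flow_has_vector_derivative]) (use s t in auto)
  next
    show "K * (t - 0) \<le> 1/2" using mult_mono[OF K(2), of t 1] t K by simp
  qed (use t K m.lipschitz in \<open>auto simp: m.flow_0\<close>)
  then show ?thesis by (simp add: flow_0)
qed

end

section \<open>Exact symplectic forms in coordinates\<close>

definition form_deriv :: "('a::euclidean_space \<Rightarrow> 'a \<Rightarrow> real) \<Rightarrow> 'a \<Rightarrow> 'a \<Rightarrow> 'a \<Rightarrow> real" where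
  "form_deriv \<beta> x u w = frechet_derivative (\<lambda>y. \<beta> y w) (at x) u"

text \<open>The exterior derivative on constant vector fields, for which the bracket term of the
  invariant formula vanishes.\<close>

definition form_ext :: "('a::euclidean_space \<Rightarrow> 'a \<Rightarrow> real) \<Rightarrow> 'a \<Rightarrow> 'a \<Rightarrow> 'a \<Rightarrow> real" where
  "form_ext \<beta> x u w = form_deriv \<beta> x u w - form_deriv \<beta> x w u"

lemma frechet_derivative_zero_outside:
  assumes "closed K" "\<And>x. x \<notin> K \<Longrightarrow> f x = 0" "x \<notin> K"
  shows "frechet_derivative f (at x) = (\<lambda>v. 0)"
proof (rule frechet_derivative_eqI)
  show "(f has_derivative (\<lambda>v. 0)) (at x)"
    by (rule has_derivative_transform_within_open[of "\<lambda>_. 0" _ _ _ "- K"])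
      (use assms in auto)
qed

lemma compact_support_derivative_bounded:
  fixes X :: "'a::euclidean_space \<Rightarrow> 'b::real_normed_vector"
  assumes "\<And>k. Ck_on k UNIV X" "compact K" "\<And>x. x \<notin> K \<Longrightarrow> X x = 0"
  shows "\<exists>L\<ge>0. \<forall>x v. norm (frechet_derivative X (at x) v) \<le> L * norm v"
proof -
  have dX: "(X has_derivative frechet_derivative X (at x)) (at x)" for x
    using Ck_on_has_derivative[OF assms(1)[of "Suc 0"]] by simp
  have "\<exists>B. \<forall>x\<in>K. norm (frechet_derivative X (at x) i) \<le> B" for i
  proof -
    have "continuous_on K (\<lambda>x. frechet_derivative X (at x) i)"
      by (rule continuous_on_subset[of UNIV]) (use assms(1)[of "Suc 0"] in auto)
    from compact_imp_bounded[OF compact_continuous_image[OF this assms(2)]]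
    show ?thesis unfolding bounded_iff by blast
  qed
  then obtain B where B: "\<And>i x. x \<in> K \<Longrightarrow> norm (frechet_derivative X (at x) i) \<le> B i" by metis
  have "norm (frechet_derivative X (at x) v) \<le> (\<Sum>i\<in>Basis. \<bar>B i\<bar>) * norm v" for x v
  proof (cases "x \<in> K")
    case True
    have "norm (frechet_derivative X (at x) v) = norm (\<Sum>i\<in>Basis. (v \<bullet> i) *\<^sub>R frechet_derivative X (at x) i)"
      by (subst linear_sum_Basis[OF has_derivative_linear[OF dX]]) simp
    also have "\<dots> \<le> (\<Sum>i\<in>Basis. \<bar>B i\<bar> * norm v)"
    proof (rule sum_norm_le)
      fix i :: 'a assume i: "i \<in> Basis"
      have "\<bar>v \<bullet> i\<bar> * norm (frechet_derivative X (at x) i) \<le> norm v * \<bar>B i\<bar>"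
        using Basis_le_norm[OF i, of v] B[OF True, of i] by (intro mult_mono) auto
      then show "norm ((v \<bullet> i) *\<^sub>R frechet_derivative X (at x) i) \<le> \<bar>B i\<bar> * norm v"
        by (simp add: mult.commute)
    qed
    finally show ?thesis by (simp add: sum_distrib_right)
  next
    case False
    then show ?thesis
      using frechet_derivative_zero_outside[OF compact_imp_closed[OF assms(2)] assms(3) False]
      by (simp add: sum_nonneg)
  qed
  moreover have "0 \<le> (\<Sum>i\<in>(Basis::'a set). \<bar>B i\<bar>)" by (simp add: sum_nonneg)
  ultimately show ?thesis by blast
qed

lemma compact_support_lipschitz:
  fixes X :: "'a::euclidean_space \<Rightarrow> 'b::real_normed_vector"
  assumes "\<And>k. Ck_on k UNIV X" "compact K" "\<And>x. x \<notin> K \<Longrightarrow> X x = 0"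
  shows "\<exists>L\<ge>0. \<forall>x y. norm (X x - X y) \<le> L * norm (x - y)"
proof -
  obtain L where L: "L \<ge> 0" "\<And>x v. norm (frechet_derivative X (at x) v) \<le> L * norm v"
    using compact_support_derivative_bounded[OF assms] by auto
  have "norm (X x - X y) \<le> L * norm (x - y)" for x y
    by (rule differentiable_bound[of UNIV X "\<lambda>x. frechet_derivative X (at x)"])
      (use Ck_on_has_derivative[OF assms(1)[of "Suc 0"]] L in \<open>auto intro: onorm_le\<close>)
  with L(1) show ?thesis by blast
qed

locale coordinate_form =
  fixes V :: "'a::euclidean_space set" and \<beta> :: "'a \<Rightarrow> 'a \<Rightarrow> real"
  assumes open_V: "open V"
    and linear_form: "x \<in> V \<Longrightarrow> linear (\<beta> x)"
    and smooth_form: "Ck_on k V (\<lambda>x. \<beta> x u)"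
begin

abbreviation W :: "'a \<Rightarrow> 'a \<Rightarrow> 'a \<Rightarrow> real" where "W \<equiv> form_ext \<beta>"

lemma form_has_derivative:
  "x \<in> V \<Longrightarrow> ((\<lambda>y. \<beta> y w) has_derivative (\<lambda>u. form_deriv \<beta> x u w)) (at x)"
  unfolding form_deriv_def using Ck_on_has_derivative[OF smooth_form[of "Suc 0"]] .

lemma form_deriv_eqI:
  "((\<lambda>y. \<beta> y w) has_derivative D) (at x) \<Longrightarrow> form_deriv \<beta> x u w = D u"
  by (simp add: form_deriv_def frechet_derivative_eqI)

lemma linear_form_deriv1: "x \<in> V \<Longrightarrow> linear (\<lambda>u. form_deriv \<beta> x u w)"
  by (rule has_derivative_linear[OF form_has_derivative])

lemma linear_form_deriv2:
  assumes "x \<in> V" shows "linear (\<lambda>w. form_deriv \<beta> x u w)"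
proof
  fix w w' :: 'a and c :: real
  have "((\<lambda>y. \<beta> y (w + w')) has_derivative (\<lambda>u. form_deriv \<beta> x u w + form_deriv \<beta> x u w')) (at x)"
    by (rule has_derivative_transform_within_open[OF
          has_derivative_add[OF form_has_derivative form_has_derivative] open_V])
      (use assms linear_form in \<open>auto simp: linear_add\<close>)
  then show "form_deriv \<beta> x u (w + w') = form_deriv \<beta> x u w + form_deriv \<beta> x u w'"
    by (rule form_deriv_eqI)
  have "((\<lambda>y. \<beta> y (c *\<^sub>R w)) has_derivative (\<lambda>u. c *\<^sub>R form_deriv \<beta> x u w)) (at x)"
    by (rule has_derivative_transform_within_open[OF
          has_derivative_scaleR_right[OF form_has_derivative] open_V])
      (use assms linear_form in \<open>auto simp: linear_scale\<close>)
  then show "form_deriv \<beta> x u (c *\<^sub>R w) = c *\<^sub>R form_deriv \<beta> x u w"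
    by (rule form_deriv_eqI)
qed

lemma linear_W1: "x \<in> V \<Longrightarrow> linear (\<lambda>u. W x u w)"
  unfolding form_ext_def by (intro linear_compose_sub linear_form_deriv1 linear_form_deriv2)

lemma linear_W2: "x \<in> V \<Longrightarrow> linear (\<lambda>w. W x u w)"
  unfolding form_ext_def by (intro linear_compose_sub linear_form_deriv1 linear_form_deriv2)

lemma W_antisym: "W x u w = - W x w u"
  by (simp add: form_ext_def)

lemma smooth_form_deriv: "Ck_on k V (\<lambda>x. form_deriv \<beta> x u w)"
  unfolding form_deriv_def using smooth_form[of "Suc k" w] by simp

lemma smooth_W: "Ck_on k V (\<lambda>x. W x u w)"
  unfolding form_ext_def by (intro Ck_on_diff open_V smooth_form_deriv)

text \<open>The direction of differentiation \<open>v\<close> comes before the two arguments of the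
  form.\<close>

definition DW :: "'a \<Rightarrow> 'a \<Rightarrow> 'a \<Rightarrow> 'a \<Rightarrow> real" where
  "DW x v u w = frechet_derivative (\<lambda>x. W x u w) (at x) v"

lemma W_has_derivative: "x \<in> V \<Longrightarrow> ((\<lambda>x. W x u w) has_derivative (\<lambda>v. DW x v u w)) (at x)"
  unfolding DW_def using Ck_on_has_derivative[OF smooth_W[of "Suc 0"]] .

lemma DW_antisym: "x \<in> V \<Longrightarrow> DW x v u w = - DW x v w u"
proof -
  assume x: "x \<in> V"
  have "((\<lambda>x. W x u w) has_derivative (\<lambda>v. - DW x v w u)) (at x)"
    unfolding W_antisym[of _ u w] by (rule has_derivative_minus[OF W_has_derivative[OF x]])
  then show ?thesis by (simp add: DW_def frechet_derivative_eqI)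
qed

text \<open>This is \<open>d(d\<beta>) = 0\<close>: the cyclic sum consists of second derivatives of
  \<open>\<beta>\<close>, which cancel in pairs by symmetry.\<close>

lemma W_closed:
  assumes x: "x \<in> V"
  shows "DW x v u w + DW x u w v + DW x w v u = 0"
proof -
  define D where "D v u w = frechet_derivative (\<lambda>x. form_deriv \<beta> x u w) (at x) v" for v u w
  have "((\<lambda>x. form_deriv \<beta> x u w) has_derivative (\<lambda>v. D v u w)) (at x)" for u w
    unfolding D_def using Ck_on_has_derivative[OF smooth_form_deriv[of "Suc 0"] x] .
  from has_derivative_diff[OF this this]
  have DW: "DW x v u w = D v u w - D v w u" for v u w
    unfolding DW_def form_ext_def by (rule fun_cong[OF frechet_derivative_eqI])
  have "D v u w = D u v w" for v u w
    unfolding D_def form_deriv_def by (rule symmetric_second_derivative[OF open_V smooth_form x])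
  then show ?thesis unfolding DW by simp
qed

text \<open>The second derivatives of \<open>\<tau>\<close> cancel by symmetry.\<close>

lemma form_ext_pullback:
  fixes \<tau> :: "'b::euclidean_space \<Rightarrow> 'a"
  assumes S: "open S" "y \<in> S" and \<tau>: "\<And>k. Ck_on k S \<tau>" "\<tau> ` S \<subseteq> V"
    and \<beta>': "\<And>y u. y \<in> S \<Longrightarrow> \<beta>' y u = \<beta> (\<tau> y) (frechet_derivative \<tau> (at y) u)"
  shows "form_ext \<beta>' y u w = W (\<tau> y) (frechet_derivative \<tau> (at y) u) (frechet_derivative \<tau> (at y) w)"
proof -
  let ?D = "\<lambda>y w. frechet_derivative \<tau> (at y) w"
  let ?DD = "\<lambda>u w. frechet_derivative (\<lambda>y. ?D y w) (at y) u"
  have yV: "\<tau> y \<in> V" using S \<tau> by auto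
  have d\<tau>: "(\<tau> has_derivative ?D y) (at y)" by (rule Ck_on_has_derivative[OF \<tau>(1)[of "Suc 0"] S(2)])
  have CD: "Ck_on k S (\<lambda>y. ?D y w)" for k w using \<tau>(1)[of "Suc k"] by simp
  have dD: "((\<lambda>y. ?D y w) has_derivative (\<lambda>u. ?DD u w)) (at y)" for w
    by (rule Ck_on_has_derivative[OF CD[of "Suc 0"] S(2)])
  \<comment> \<open>Componentwise, because the symmetry lemma is about real-valued
    functions.\<close>
  have sym: "?DD u w = ?DD w u"
  proof (rule euclidean_eqI)
    fix i :: 'a assume "i \<in> Basis"
    have Ci: "Ck_on 2 S (\<lambda>y. \<tau> y \<bullet> i)" by (intro Ck_on_inner S \<tau> Ck_on_const)
    have di: "((\<lambda>y. \<tau> y \<bullet> i) has_derivative (\<lambda>w. ?D y w \<bullet> i)) (at y)" if "y \<in> S" for y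
      by (rule has_derivative_inner_left[OF Ck_on_has_derivative[OF \<tau>(1)[of "Suc 0"] that]])
    have ddi: "frechet_derivative (\<lambda>y. frechet_derivative (\<lambda>y. \<tau> y \<bullet> i) (at y) w) (at y) u = ?DD u w \<bullet> i" for u w
    proof -
      have "((\<lambda>y. frechet_derivative (\<lambda>y. \<tau> y \<bullet> i) (at y) w) has_derivative (\<lambda>u. ?DD u w \<bullet> i)) (at y)"
        by (rule has_derivative_transform_within_open[OF has_derivative_inner_left[OF dD] S])
          (simp add: frechet_derivative_eqI[OF di])
      then show ?thesis by (rule fun_cong[OF frechet_derivative_eqI])
    qed
    show "?DD u w \<bullet> i = ?DD w u \<bullet> i"
      using symmetric_second_derivative[OF S(1) Ci S(2), of w u] unfolding ddi .
  qed
  have fd: "form_deriv \<beta>' y u w = form_deriv \<beta> (\<tau> y) (?D y u) (?D y w) + \<beta> (\<tau> y) (?DD u w)" for u w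
  proof -
    have d1: "((\<lambda>y. \<beta> (\<tau> y) i) has_derivative (\<lambda>u. form_deriv \<beta> (\<tau> y) (?D y u) i)) (at y)" for i
      by (rule has_derivative_compose[OF d\<tau> form_has_derivative[OF yV]])
    have "((\<lambda>y. \<Sum>i\<in>Basis. (?D y w \<bullet> i) * \<beta> (\<tau> y) i) has_derivative (\<lambda>u. \<Sum>i\<in>Basis.
        (?D y w \<bullet> i) * form_deriv \<beta> (\<tau> y) (?D y u) i + (?DD u w \<bullet> i) * \<beta> (\<tau> y) i)) (at y)"
      by (intro has_derivative_sum has_derivative_mult has_derivative_inner_left dD d1)
    then have "((\<lambda>y. \<beta>' y w) has_derivative (\<lambda>u. \<Sum>i\<in>Basis.
        (?D y w \<bullet> i) * form_deriv \<beta> (\<tau> y) (?D y u) i + (?DD u w \<bullet> i) * \<beta> (\<tau> y) i)) (at y)"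
    proof (rule has_derivative_transform_within_open[OF _ S])
      fix x assume x: "x \<in> S"
      then have "\<tau> x \<in> V" using \<tau>(2) by auto
      from linear_sum_Basis[OF linear_form[OF this], of "?D x w"]
      show "(\<Sum>i\<in>Basis. (?D x w \<bullet> i) * \<beta> (\<tau> x) i) = \<beta>' x w" by (simp add: \<beta>'[OF x])
    qed
    from fun_cong[OF frechet_derivative_eqI[OF this], of u]
    show ?thesis
      using linear_sum_Basis[OF linear_form_deriv2[OF yV], of "?D y u" "?D y w"]
        linear_sum_Basis[OF linear_form[OF yV], of "?DD u w"]
      by (simp add: form_deriv_def sum.distrib)
  qed
  show ?thesis unfolding form_ext_def fd sym by simp
qed

end

text \<open>An exact symplectic form \<open>d\<beta>\<close> in a coordinate domain, with \<open>e\<close> the (constant) Liouville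
  vector field: translation along \<open>e\<close> rescales \<open>\<beta>\<close>.\<close>

locale exact_chart = coordinate_form V \<beta>
  for V :: "'a::euclidean_space set" and \<beta> :: "'a \<Rightarrow> 'a \<Rightarrow> real" +
  fixes e :: 'a
  assumes nondegenerate: "x \<in> V \<Longrightarrow> (\<And>w. form_ext \<beta> x u w = 0) \<Longrightarrow> u = 0"
    and translate_V: "x \<in> V \<Longrightarrow> x + c *\<^sub>R e \<in> V"
    and conformal: "x \<in> V \<Longrightarrow> \<beta> (x + c *\<^sub>R e) u = exp c * \<beta> x u"
    and form_e: "x \<in> V \<Longrightarrow> \<beta> x e = 0"
begin

lemma W_translate:
  assumes x: "x \<in> V"
  shows "W (x + c *\<^sub>R e) u w = exp c * W x u w"
proof -
  have "form_deriv \<beta> (x + c *\<^sub>R e) u w = exp c * form_deriv \<beta> x u w" for u w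
  proof -
    have "((\<lambda>y. \<beta> (y + c *\<^sub>R e) w) has_derivative (\<lambda>u. form_deriv \<beta> (x + c *\<^sub>R e) u w)) (at x)"
      by (rule has_derivative_eq_rhs[OF has_derivative_compose[of "\<lambda>y. y + c *\<^sub>R e" _ _ _ "\<lambda>y. \<beta> y w",
              OF _ form_has_derivative[OF translate_V[OF x]]]])
        (auto intro!: derivative_eq_intros)
    moreover have "((\<lambda>y. \<beta> (y + c *\<^sub>R e) w) has_derivative (\<lambda>u. exp c *\<^sub>R form_deriv \<beta> x u w)) (at x)"
      by (rule has_derivative_transform_within_open[OF
            has_derivative_scaleR_right[OF form_has_derivative[OF x]] open_V x]) (simp add: conformal)
    ultimately show ?thesis
      using has_derivative_unique by (metis real_scaleR_def)
  qed
  then show ?thesis by (simp add: form_ext_def right_diff_distrib)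
qed

text \<open>Cartan's formula for the Liouville field: differentiating \<open>conformal\<close> at
  \<open>c = 0\<close> gives the derivative of \<open>\<beta>\<close> along \<open>e\<close>, and
  \<open>form_e\<close> removes the other term of \<open>W\<close>.\<close>

lemma W_e:
  assumes x: "x \<in> V"
  shows "W x e w = \<beta> x w"
proof -
  have "((\<lambda>c. \<beta> (x + c *\<^sub>R e) w) has_derivative (\<lambda>c. form_deriv \<beta> x (c *\<^sub>R e) w)) (at 0)"
    by (rule has_derivative_compose[of "\<lambda>c. x + c *\<^sub>R e" _ _ _ "\<lambda>y. \<beta> y w"])
      (use form_has_derivative[OF x] in \<open>auto intro!: derivative_eq_intros\<close>)
  moreover have "((\<lambda>c. exp c * \<beta> x w) has_derivative (\<lambda>c. c * \<beta> x w)) (at 0)"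
    by (auto intro!: derivative_eq_intros)
  ultimately have "(\<lambda>c. form_deriv \<beta> x (c *\<^sub>R e) w) = (\<lambda>c. c * \<beta> x w)"
    unfolding conformal[OF x] by (rule has_derivative_unique)
  from fun_cong[OF this, of 1] have "form_deriv \<beta> x e w = \<beta> x w" by simp
  moreover have "((\<lambda>y. \<beta> y e) has_derivative (\<lambda>u. 0)) (at x)"
    by (rule has_derivative_transform_within_open[OF has_derivative_const open_V x]) (simp add: form_e)
  then have "form_deriv \<beta> x w e = 0" by (rule form_deriv_eqI)
  ultimately show ?thesis by (simp add: form_ext_def)
qed

lemma W_eq_imp_eq:
  assumes "x \<in> V" "\<And>w. W x u w = W x u' w"
  shows "u = u'"
proof -
  have "W x (u - u') w = 0" for w
    using linear_diff[OF linear_W1[OF assms(1)], of u u' w] assms(2)[of w] by simp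
  from nondegenerate[OF assms(1) this] show ?thesis by simp
qed

lemma W_field_has_derivative:
  assumes x: "x \<in> V" and X: "(X has_derivative X') (at x)"
  shows "((\<lambda>x. W x (X x) w) has_derivative (\<lambda>v. DW x v (X x) w + W x (X' v) w)) (at x)"
proof -
  have "((\<lambda>y. \<Sum>i\<in>Basis. (X y \<bullet> i) * W y i w) has_derivative
     (\<lambda>v. \<Sum>i\<in>Basis. (X x \<bullet> i) * DW x v i w + (X' v \<bullet> i) * W x i w)) (at x)"
    by (intro has_derivative_sum has_derivative_mult has_derivative_inner_left X W_has_derivative x)
  \<comment> \<open>Linearity of \<open>DW\<close> in the first argument of the form, obtained by
    differentiating the basis expansion of \<open>W\<close>.\<close>
  moreover have "(\<Sum>i\<in>Basis. (X x \<bullet> i) * DW x v i w) = DW x v (X x) w" for v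
  proof -
    have "((\<lambda>y. W y (X x) w) has_derivative (\<lambda>v. \<Sum>i\<in>Basis. (X x \<bullet> i) *\<^sub>R DW x v i w)) (at x)"
    proof (rule has_derivative_transform_within_open[OF _ open_V x])
      show "((\<lambda>y. \<Sum>i\<in>Basis. (X x \<bullet> i) *\<^sub>R W y i w) has_derivative (\<lambda>v. \<Sum>i\<in>Basis. (X x \<bullet> i) *\<^sub>R DW x v i w)) (at x)"
        by (intro has_derivative_sum has_derivative_scaleR_right W_has_derivative x)
      show "(\<Sum>i\<in>Basis. (X x \<bullet> i) *\<^sub>R W y i w) = W y (X x) w" if "y \<in> V" for y
        using linear_sum_Basis[OF linear_W1[OF that], of "X x" w] by simp
    qed
    then show ?thesis by (simp add: DW_def frechet_derivative_eqI)
  qed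
  moreover have "(\<Sum>i\<in>Basis. (X' v \<bullet> i) * W x i w) = W x (X' v) w" for v
    using linear_sum_Basis[OF linear_W1[OF x], of "X' v" w] by simp
  ultimately have D: "((\<lambda>y. \<Sum>i\<in>Basis. (X y \<bullet> i) * W y i w) has_derivative
     (\<lambda>v. DW x v (X x) w + W x (X' v) w)) (at x)"
    by (simp add: sum.distrib)
  show ?thesis
    by (rule has_derivative_transform_within_open[OF D open_V x])
      (use linear_sum_Basis[OF linear_W1] in simp)
qed

text \<open>On \<open>V\<close> the field solves a linear system with smooth invertible matrix, and
  it vanishes off \<open>K\<close> since \<open>g\<close> does. The open sets \<open>V\<close> and
  \<open>- K\<close> cover the space, so the extension by 0 is smooth.\<close>

lemma field_exists:
  assumes g: "\<And>k. Ck_on k UNIV g" and K: "compact K" "K \<subseteq> V" and g0: "\<And>x. x \<notin> K \<Longrightarrow> g x = 0"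
  obtains X where "\<And>k. Ck_on k UNIV X" "\<And>x. x \<notin> K \<Longrightarrow> X x = 0"
    "\<And>x w. x \<in> V \<Longrightarrow> W x (X x) w = frechet_derivative g (at x) w"
proof -
  \<comment> \<open>\<open>A\<close> and \<open>b\<close> represent \<open>W\<close> and the
    differential of \<open>g\<close> through the inner product:
    \<open>A x u \<bullet> w = W x u w\<close>.\<close>
  define A where "A x u = (\<Sum>j\<in>Basis. W x u j *\<^sub>R j)" for x u
  define b where "b x = (\<Sum>j\<in>Basis. frechet_derivative g (at x) j *\<^sub>R j)" for x
  have dg: "(g has_derivative frechet_derivative g (at x)) (at x)" for x
    using Ck_on_has_derivative[OF g[of "Suc 0"]] by simp
  have Aj: "A x u \<bullet> w = W x u w" if "x \<in> V" for x u w
    using linear_sum_Basis[OF linear_W2[OF that], of u w]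
    by (simp add: A_def inner_sum_left inner_commute[of w] mult.commute)
  have bj: "b x \<bullet> w = frechet_derivative g (at x) w" for x w
    using linear_sum_Basis[OF has_derivative_linear[OF dg], of x w]
    by (simp add: b_def inner_sum_left inner_commute[of w] mult.commute)
  have linA: "linear (A x)" if "x \<in> V" for x
    unfolding A_def
    by (intro linear_compose_sum ballI linearI)
      (simp_all add: linear_add[OF linear_W1[OF that]] linear_scale[OF linear_W1[OF that]] scaleR_add_left)
  have injA: "inj (A x)" if x: "x \<in> V" for x
    using Aj[OF x] W_eq_imp_eq[OF x] by (metis injI)
  define X where "X x = (if x \<in> V then inv (A x) (b x) else 0)" for x
  have AX: "A x (X x) = b x" if "x \<in> V" for x
    using surj_f_inv_f[OF linear_injective_imp_surjective[OF linA injA]] that by (simp add: X_def)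
  have WX: "W x (X x) w = frechet_derivative g (at x) w" if "x \<in> V" for x w
    using Aj[OF that, of "X x" w] AX[OF that] bj[of x w] by simp
  have X0: "X x = 0" if "x \<notin> K" for x
  proof (cases "x \<in> V")
    case True
    have "W x (X x) w = 0" for w
      using WX[OF True] frechet_derivative_zero_outside[OF compact_imp_closed[OF K(1)] g0 that] by simp
    then show ?thesis by (rule nondegenerate[OF True])
  qed (simp add: X_def)
  have "Ck_on k V X" for k
  proof (rule Ck_on_linear_solve[OF open_V linA injA _ _ AX])
    show "Ck_on k V (\<lambda>x. A x i)" for k i
      unfolding A_def by (intro Ck_on_sum Ck_on_scaleR smooth_W open_V Ck_on_const)
    have "Ck_on k UNIV (\<lambda>x. frechet_derivative g (at x) j)" for j using g[of "Suc k"] by simp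
    then show "Ck_on k V b"
      unfolding b_def by (intro Ck_on_sum Ck_on_scaleR open_V Ck_on_const) (auto intro: Ck_on_subset)
  qed
  moreover have "Ck_on k (- K) X" for k
    using Ck_on_cong[of "- K" X "\<lambda>_. 0" k] X0 compact_imp_closed[OF K(1)] by (simp add: open_Compl)
  ultimately have "Ck_on k UNIV X" for k
    using open_V compact_imp_closed[OF K(1)] K(2) by (intro Ck_on_local) (meson ComplI open_Compl subsetD)
  with X0 WX that show thesis by blast
qed

text \<open>The coordinate version of \<open>L_X W = 0\<close>. Differentiating \<open>ham\<close>
  and using the symmetry of the second derivative of \<open>g\<close> relates the two terms with
  \<open>X'\<close>; closedness of \<open>W\<close> then yields the derivative of \<open>W\<close>
  along \<open>X\<close>.\<close>

lemma hamiltonian_field_identity: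
  assumes x: "x \<in> V" and g: "Ck_on 2 UNIV g" and X: "(X has_derivative X') (at x)"
    and ham: "\<And>x w. x \<in> V \<Longrightarrow> W x (X x) w = frechet_derivative g (at x) w"
  shows "DW x (X x) u w + W x (X' u) w + W x u (X' w) = 0"
proof -
  have "((\<lambda>y. frechet_derivative g (at y) w) has_derivative (\<lambda>v. DW x v (X x) w + W x (X' v) w)) (at x)" for w
    by (rule has_derivative_transform_within_open[OF W_field_has_derivative[OF x X] open_V x]) (rule ham)
  then have H: "frechet_derivative (\<lambda>y. frechet_derivative g (at y) w) (at x) v = DW x v (X x) w + W x (X' v) w" for v w
    by (rule fun_cong[OF frechet_derivative_eqI])
  have "DW x u (X x) w + W x (X' u) w = DW x w (X x) u + W x (X' w) u"
    using symmetric_second_derivative[OF open_UNIV g UNIV_I, of w x u] unfolding H .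
  then show ?thesis
    using W_closed[OF x, of "X x" u w] DW_antisym[OF x, of u w "X x"] W_antisym[of x u "X' w"] by linarith
qed

definition symplectic :: "('a \<Rightarrow> 'a) \<Rightarrow> bool" where
  "symplectic \<eta> \<longleftrightarrow> (\<forall>x\<in>V. \<eta> x \<in> V \<and> (\<forall>u w.
     W (\<eta> x) (frechet_derivative \<eta> (at x) u) (frechet_derivative \<eta> (at x) w) = W x u w))"

text \<open>The derivative of the flow obeys the variational equation along a trajectory, so the
  time derivative of the pulled-back form is the expression that
  \<open>hamiltonian_field_identity\<close> shows to be 0.\<close>

lemma flow_preserves_W:
  assumes g: "\<And>k. Ck_on k UNIV g" and X: "small_field X K"
    and ham: "\<And>x w. x \<in> V \<Longrightarrow> W x (X x) w = frechet_derivative g (at x) w"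
    and V: "\<And>t. t \<in> {0..1} \<Longrightarrow> flow X t x \<in> V"
  shows "W (flow X 1 x) (frechet_derivative (flow X 1) (at x) u) (frechet_derivative (flow X 1) (at x) w) = W x u w"
proof -
  interpret X: small_field X K by (rule X)
  define y where "y u t = frechet_derivative (flow X t) (at x) u" for u t
  define F where "F t = W (flow X t x) (y u t) (y w t)" for t
  \<comment> \<open>As a double sum over the basis, a form with moving base point and two moving
    arguments can be differentiated by the scalar product rule.\<close>
  let ?S = "\<lambda>x u w. \<Sum>i\<in>Basis. \<Sum>j\<in>Basis. (u \<bullet> i) * (w \<bullet> j) * W x i j"
  have WS: "W x u w = ?S x u w" if "x \<in> V" for x u w
    using linear_sum_Basis[OF linear_W1[OF that], of u w] linear_sum_Basis[OF linear_W2[OF that], of _ w]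
    by (simp add: sum_distrib_left mult.assoc)
  have "(F has_vector_derivative 0) (at t within {0..1})" if t: "t \<in> {0..1}" for t
  proof -
    let ?x = "flow X t x" and ?X' = "frechet_derivative X (at (flow X t x))"
    have dy: "(y u has_vector_derivative ?X' (y u t)) (at t within {0..1})" for u
      unfolding y_def by (rule X.variational_equation[OF t])
    have dyi: "((\<lambda>s. y u s \<bullet> i) has_vector_derivative ?X' (y u t) \<bullet> i) (at t within {0..1})" for u i
      using bounded_linear.has_vector_derivative[OF bounded_linear_inner_left dy] .
    have dW: "((\<lambda>s. W (flow X s x) i j) has_vector_derivative DW ?x (X ?x) i j) (at t within {0..1})" for i j
      using vector_derivative_diff_chain_within[OF X.flow_has_vector_derivative[OF t]
          has_derivative_at_withinI[OF W_has_derivative[OF V[OF t]]]]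
      by (simp add: o_def)
    have "((\<lambda>s. ?S (flow X s x) (y u s) (y w s)) has_vector_derivative
       (\<Sum>i\<in>Basis. \<Sum>j\<in>Basis. (y u t \<bullet> i) * (y w t \<bullet> j) * DW ?x (X ?x) i j +
         ((y u t \<bullet> i) * (?X' (y w t) \<bullet> j) + (?X' (y u t) \<bullet> i) * (y w t \<bullet> j)) * W ?x i j)) (at t within {0..1})"
      by (intro has_vector_derivative_sum has_vector_derivative_mult dyi dW)
    moreover have "(\<Sum>i\<in>Basis. \<Sum>j\<in>Basis. (y u t \<bullet> i) * (y w t \<bullet> j) * DW ?x (X ?x) i j +
         ((y u t \<bullet> i) * (?X' (y w t) \<bullet> j) + (?X' (y u t) \<bullet> i) * (y w t \<bullet> j)) * W ?x i j) =
       DW ?x (X ?x) (y u t) (y w t) + W ?x (?X' (y u t)) (y w t) + W ?x (y u t) (?X' (y w t))"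
    proof -
      have "((\<lambda>x. ?S x (y u t) (y w t)) has_derivative
          (\<lambda>v. \<Sum>i\<in>Basis. \<Sum>j\<in>Basis. (y u t \<bullet> i) * (y w t \<bullet> j) * DW ?x v i j)) (at ?x)"
        by (intro has_derivative_sum has_derivative_mult_right W_has_derivative V t)
      then have "((\<lambda>x. W x (y u t) (y w t)) has_derivative
          (\<lambda>v. \<Sum>i\<in>Basis. \<Sum>j\<in>Basis. (y u t \<bullet> i) * (y w t \<bullet> j) * DW ?x v i j)) (at ?x)"
        by (rule has_derivative_transform_within_open[OF _ open_V V[OF t]]) (rule WS[symmetric])
      from has_derivative_unique[OF this W_has_derivative[OF V[OF t]]]
      have "DW ?x (X ?x) (y u t) (y w t) = (\<Sum>i\<in>Basis. \<Sum>j\<in>Basis. (y u t \<bullet> i) * (y w t \<bullet> j) * DW ?x (X ?x) i j)"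
        by metis
      moreover have "W ?x (?X' (y u t)) (y w t) = ?S ?x (?X' (y u t)) (y w t)"
        "W ?x (y u t) (?X' (y w t)) = ?S ?x (y u t) (?X' (y w t))" by (rule WS[OF V[OF t]])+
      ultimately show ?thesis by (simp only: sum.distrib distrib_right add.assoc add.commute)
    qed
    moreover have "DW ?x (X ?x) (y u t) (y w t) + W ?x (?X' (y u t)) (y w t) + W ?x (y u t) (?X' (y w t)) = 0"
      by (rule hamiltonian_field_identity[OF V[OF t] g X.X_has_derivative ham])
    ultimately have D: "((\<lambda>s. ?S (flow X s x) (y u s) (y w s)) has_vector_derivative 0) (at t within {0..1})"
      by simp
    show ?thesis
      by (rule has_vector_derivative_transform[OF t _ D]) (unfold F_def, rule WS[OF V])
  qed
  then have "norm (F 1 - F 0) \<le> 0 * \<bar>1 - 0\<bar>"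
    by (rule has_vector_derivative_norm_bound[where a = 0 and b = 1 and f' = "\<lambda>_. 0"]) auto
  moreover have "flow X 0 = (\<lambda>x. x)" using X.flow_0 by auto
  ultimately show ?thesis by (simp add: F_def y_def)
qed

end

text \<open>The maps \<open>\<Phi>\<close> and their inverses \<open>\<Psi>\<close> are parameters
  instead of \<open>flow X\<close>, so that translates and conjugates of a flow are instances again.
  One set \<open>K\<close> supports the Hamiltonian, the field and the motion.\<close>

locale compact_hamiltonian_flow = exact_chart V \<beta> e
  for V :: "'a::euclidean_space set" and \<beta> e +
  fixes g :: "'a \<Rightarrow> real" and X :: "'a \<Rightarrow> 'a" and K :: "'a set" and \<Phi> \<Psi> :: "real \<Rightarrow> 'a \<Rightarrow> 'a"
  assumes K: "compact K" "K \<subseteq> V"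
    and g: "Ck_on k UNIV g" "x \<notin> K \<Longrightarrow> g x = 0"
    and X: "Ck_on k UNIV X" "x \<notin> K \<Longrightarrow> X x = 0"
    and ham: "x \<in> V \<Longrightarrow> W x (X x) w = frechet_derivative g (at x) w"
    and \<Phi>: "t \<in> {0..1} \<Longrightarrow> Ck_on k UNIV (\<Phi> t)" "t \<in> {0..1} \<Longrightarrow> x \<notin> K \<Longrightarrow> \<Phi> t x = x" "\<Phi> 0 x = x"
    and \<Psi>: "t \<in> {0..1} \<Longrightarrow> Ck_on k UNIV (\<Psi> t)" "t \<in> {0..1} \<Longrightarrow> \<Psi> t (\<Phi> t x) = x"
      "t \<in> {0..1} \<Longrightarrow> \<Phi> t (\<Psi> t x) = x"
    and \<Phi>_deriv: "t \<in> {0..1} \<Longrightarrow> ((\<lambda>s. \<Phi> s x) has_vector_derivative X (\<Phi> t x)) (at t within {0..1})"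
begin

text \<open>Points outside \<open>K\<close> are fixed, so by injectivity no point of
  \<open>K\<close> can be sent there.\<close>

lemma \<Phi>_in_K: assumes "t \<in> {0..1}" "x \<in> K" shows "\<Phi> t x \<in> K"
proof (rule ccontr)
  assume "\<Phi> t x \<notin> K"
  then have "\<Phi> t (\<Phi> t x) = \<Phi> t x" using \<Phi>(2)[OF assms(1)] by blast
  then have "\<Phi> t x = x" using \<Psi>(2)[OF assms(1)] by metis
  with \<open>\<Phi> t x \<notin> K\<close> assms(2) show False by simp
qed

lemma \<Phi>_in_V: "t \<in> {0..1} \<Longrightarrow> x \<in> V \<Longrightarrow> \<Phi> t x \<in> V"
  using \<Phi>_in_K \<Phi>(2) K(2) by (metis subsetD)

lemma \<Psi>_outside: "t \<in> {0..1} \<Longrightarrow> x \<notin> K \<Longrightarrow> \<Psi> t x = x"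
  using \<Phi>(2) \<Psi>(2) by metis

lemma \<Psi>_in_V: "t \<in> {0..1} \<Longrightarrow> x \<in> V \<Longrightarrow> \<Psi> t x \<in> V"
  using \<Phi>_in_K \<Psi>_outside \<Psi>(3) \<Phi>(2) K(2) by (metis subsetD)

lemma X_lipschitz: "\<exists>L\<ge>0. \<forall>x y. norm (X x - X y) \<le> L * norm (x - y)"
  by (rule compact_support_lipschitz[OF X(1) K(1) X(2)])

text \<open>Translation by \<open>c *\<^sub>R e\<close> multiplies \<open>W\<close> by
  \<open>exp c\<close>. The Hamiltonian must carry the same factor for its field to be the
  translated field.\<close>

lemma translate:
  "compact_hamiltonian_flow V \<beta> e (\<lambda>x. exp c * g (x - c *\<^sub>R e)) (\<lambda>x. X (x - c *\<^sub>R e)) ((\<lambda>x. x + c *\<^sub>R e) ` K)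
     (\<lambda>t x. \<Phi> t (x - c *\<^sub>R e) + c *\<^sub>R e) (\<lambda>t x. \<Psi> t (x - c *\<^sub>R e) + c *\<^sub>R e)"
proof
  let ?\<tau> = "\<lambda>x. x - c *\<^sub>R e"
  have \<tau>: "Ck_on k UNIV ?\<tau>" for k
    by (intro Ck_on_diff open_UNIV Ck_on_const Ck_on_bounded_linear bounded_linear_ident)
  have comp: "Ck_on k UNIV (\<lambda>x. f (?\<tau> x))" if "Ck_on k UNIV f" for k and f :: "'a \<Rightarrow> 'b::real_normed_vector"
    by (rule Ck_on_compose[OF open_UNIV open_UNIV \<tau> that]) simp
  have out: "x - c *\<^sub>R e \<notin> K" if "x \<notin> (\<lambda>x. x + c *\<^sub>R e) ` K" for x
    using that by (metis diff_add_cancel image_eqI)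
  show "compact ((\<lambda>x. x + c *\<^sub>R e) ` K)"
    using K(1) by (intro compact_continuous_image continuous_intros)
  show "(\<lambda>x. x + c *\<^sub>R e) ` K \<subseteq> V" using K(2) translate_V by auto
  show "Ck_on k UNIV (\<lambda>x. exp c * g (x - c *\<^sub>R e))" for k
    by (intro Ck_on_mult open_UNIV Ck_on_const comp g)
  show "Ck_on k UNIV (\<lambda>x. X (x - c *\<^sub>R e))" for k by (intro comp X)
  show "exp c * g (x - c *\<^sub>R e) = 0" if "x \<notin> (\<lambda>x. x + c *\<^sub>R e) ` K" for x using g(2)[OF out[OF that]] by simp
  show "X (x - c *\<^sub>R e) = 0" if "x \<notin> (\<lambda>x. x + c *\<^sub>R e) ` K" for x using X(2)[OF out[OF that]] .
  show "W x (X (x - c *\<^sub>R e)) w = frechet_derivative (\<lambda>x. exp c * g (x - c *\<^sub>R e)) (at x) w" if x: "x \<in> V" for x w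
  proof -
    have x': "x - c *\<^sub>R e \<in> V" using translate_V[OF x, of "- c"] by simp
    have dg: "(g has_derivative frechet_derivative g (at (?\<tau> x))) (at (?\<tau> x))"
      using Ck_on_has_derivative[OF g(1)[of "Suc 0"]] by simp
    have "((\<lambda>x. g (?\<tau> x)) has_derivative frechet_derivative g (at (?\<tau> x))) (at x)"
      by (rule has_derivative_compose[of ?\<tau> "\<lambda>v. v" _ _ g, OF _ dg]) (auto intro!: derivative_eq_intros)
    from has_derivative_mult_right[OF this, of "exp c"]
    have "frechet_derivative (\<lambda>x. exp c * g (x - c *\<^sub>R e)) (at x) w = exp c * frechet_derivative g (at (?\<tau> x)) w"
      by (simp add: frechet_derivative_eqI)
    then show ?thesis using W_translate[OF x', of c] ham[OF x'] by simp
  qed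
  fix t :: real assume t: "t \<in> {0..1}"
  show "Ck_on k UNIV (\<lambda>x. \<Phi> t (x - c *\<^sub>R e) + c *\<^sub>R e)" "Ck_on k UNIV (\<lambda>x. \<Psi> t (x - c *\<^sub>R e) + c *\<^sub>R e)" for k
    by (intro Ck_on_add open_UNIV Ck_on_const comp[OF \<Phi>(1)[OF t]] comp[OF \<Psi>(1)[OF t]])+
  show "\<Phi> t (x - c *\<^sub>R e) + c *\<^sub>R e = x" if "x \<notin> (\<lambda>x. x + c *\<^sub>R e) ` K" for x
    using \<Phi>(2)[OF t out[OF that]] by simp
  show "((\<lambda>s. \<Phi> s (x - c *\<^sub>R e) + c *\<^sub>R e) has_vector_derivative
      X (\<Phi> t (x - c *\<^sub>R e) + c *\<^sub>R e - c *\<^sub>R e)) (at t within {0..1})" for x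
    using has_vector_derivative_add[OF \<Phi>_deriv[OF t] has_vector_derivative_const] by simp
qed (use \<Phi> \<Psi> in auto)

text \<open>A symplectic map carries the Hamiltonian field of \<open>g\<close> to that of
  \<open>g\<close> composed with the inverse map. The conjugated family is therefore a Hamiltonian
  flow in its own right, supported in the image of \<open>K\<close>.\<close>

lemma conjugate:
  assumes \<eta>: "\<And>k. Ck_on k UNIV \<eta>" "symplectic \<eta>" and \<theta>: "\<And>k. Ck_on k UNIV \<theta>"
    and inv: "\<And>x. \<theta> (\<eta> x) = x" "\<And>x. \<eta> (\<theta> x) = x"
  shows "compact_hamiltonian_flow V \<beta> e (\<lambda>x. g (\<theta> x)) (\<lambda>x. frechet_derivative \<eta> (at (\<theta> x)) (X (\<theta> x))) (\<eta> ` K)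
     (\<lambda>t x. \<eta> (\<Phi> t (\<theta> x))) (\<lambda>t x. \<eta> (\<Psi> t (\<theta> x)))"
proof
  have comp: "Ck_on k UNIV (\<lambda>x. f (h x))" if "Ck_on k UNIV f" "Ck_on k UNIV h"
    for k and f :: "'a \<Rightarrow> 'b::real_normed_vector" and h :: "'a \<Rightarrow> 'a"
    by (rule Ck_on_compose[OF open_UNIV open_UNIV that(2,1)]) simp
  have d\<eta>: "(\<eta> has_derivative frechet_derivative \<eta> (at x)) (at x)" for x
    using Ck_on_has_derivative[OF \<eta>(1)[of "Suc 0"]] by simp
  have d\<theta>: "(\<theta> has_derivative frechet_derivative \<theta> (at x)) (at x)" for x
    using Ck_on_has_derivative[OF \<theta>(1)[of "Suc 0"]] by simp
  have dg: "(g has_derivative frechet_derivative g (at x)) (at x)" for x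
    using Ck_on_has_derivative[OF g(1)[of "Suc 0"]] by simp
  have lin\<eta>: "linear (frechet_derivative \<eta> (at x))" for x by (rule has_derivative_linear[OF d\<eta>])
  have out: "\<theta> x \<notin> K" if "x \<notin> \<eta> ` K" for x using that inv(2) by (metis image_eqI)
  show "compact (\<eta> ` K)"
    using K(1) continuous_on_subset[OF Ck_on_imp_continuous_on[OF \<eta>(1)[of 0]]] by (intro compact_continuous_image) auto
  show "\<eta> ` K \<subseteq> V" using K(2) \<eta>(2) unfolding symplectic_def by auto
  show "Ck_on k UNIV (\<lambda>x. g (\<theta> x))" for k by (rule comp[OF g(1) \<theta>])
  show "Ck_on k UNIV (\<lambda>x. frechet_derivative \<eta> (at (\<theta> x)) (X (\<theta> x)))" for k
  proof -
    have "Ck_on k UNIV (\<lambda>x. \<Sum>i\<in>Basis. (X (\<theta> x) \<bullet> i) *\<^sub>R frechet_derivative \<eta> (at (\<theta> x)) i)"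
      using \<eta>(1)[of "Suc k"]
      by (intro Ck_on_sum Ck_on_scaleR Ck_on_inner open_UNIV Ck_on_const comp[OF X(1) \<theta>]
          comp[of _ "\<lambda>x. frechet_derivative \<eta> (at x) _", OF _ \<theta>]) simp
    then show ?thesis by (simp only: linear_sum_Basis[OF lin\<eta>, of _ "X _", symmetric])
  qed
  show "frechet_derivative \<eta> (at (\<theta> x)) (X (\<theta> x)) = 0" if "x \<notin> \<eta> ` K" for x
    using X(2)[OF out[OF that]] linear_0[OF lin\<eta>] by simp
  show "g (\<theta> x) = 0" if "x \<notin> \<eta> ` K" for x using g(2)[OF out[OF that]] .
  show "W x (frechet_derivative \<eta> (at (\<theta> x)) (X (\<theta> x))) w = frechet_derivative (\<lambda>x. g (\<theta> x)) (at x) w"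
    if x: "x \<in> V" for x w
  proof -
    let ?y = "\<theta> x"
    have "((\<lambda>z. \<eta> (\<theta> z)) has_derivative (\<lambda>v. frechet_derivative \<eta> (at ?y) (frechet_derivative \<theta> (at x) v))) (at x)"
      by (rule has_derivative_compose[OF d\<theta> d\<eta>])
    then have "((\<lambda>z. z) has_derivative (\<lambda>v. frechet_derivative \<eta> (at ?y) (frechet_derivative \<theta> (at x) v))) (at x)"
      by (simp add: inv)
    from has_derivative_unique[OF this has_derivative_ident]
    have w: "frechet_derivative \<eta> (at ?y) (frechet_derivative \<theta> (at x) w) = w" by metis
    have g': "frechet_derivative (\<lambda>x. g (\<theta> x)) (at x) w = frechet_derivative g (at ?y) (frechet_derivative \<theta> (at x) w)"
      by (rule fun_cong[OF frechet_derivative_eqI[OF has_derivative_compose[OF d\<theta> dg]]])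
    \<comment> \<open>\<open>symplectic\<close> speaks of points of \<open>V\<close>, and
      \<open>?y\<close> is known to lie there when it is in \<open>K\<close>; off \<open>K\<close>
      both sides are 0.\<close>
    show ?thesis
    proof (cases "?y \<in> K")
      case True
      then have y: "?y \<in> V" using K(2) by auto
      have "W (\<eta> ?y) (frechet_derivative \<eta> (at ?y) (X ?y)) (frechet_derivative \<eta> (at ?y) (frechet_derivative \<theta> (at x) w))
          = W ?y (X ?y) (frechet_derivative \<theta> (at x) w)"
        using \<eta>(2) y unfolding symplectic_def by blast
      then show ?thesis unfolding g' w inv ham[OF y] .
    next
      case False
      then show ?thesis
        using frechet_derivative_zero_outside[OF compact_imp_closed[OF K(1)] g(2) False]
        by (simp add: g' X(2) linear_0[OF lin\<eta>] linear_0[OF linear_W1[OF x]])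
    qed
  qed
  fix t :: real assume t: "t \<in> {0..1}"
  show "Ck_on k UNIV (\<lambda>x. \<eta> (\<Phi> t (\<theta> x)))" for k
    by (rule comp[OF \<eta>(1) comp[OF \<Phi>(1)[OF t] \<theta>]])
  show "Ck_on k UNIV (\<lambda>x. \<eta> (\<Psi> t (\<theta> x)))" for k
    by (rule comp[OF \<eta>(1) comp[OF \<Psi>(1)[OF t] \<theta>]])
  show "\<eta> (\<Phi> t (\<theta> x)) = x" if "x \<notin> \<eta> ` K" for x
    using \<Phi>(2)[OF t out[OF that]] inv by simp
  show "((\<lambda>s. \<eta> (\<Phi> s (\<theta> x))) has_vector_derivative
      frechet_derivative \<eta> (at (\<theta> (\<eta> (\<Phi> t (\<theta> x))))) (X (\<theta> (\<eta> (\<Phi> t (\<theta> x)))))) (at t within {0..1})" for x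
    using vector_derivative_diff_chain_within[OF \<Phi>_deriv[OF t] has_derivative_at_withinI[OF d\<eta>]]
    by (simp add: o_def inv)
qed (use \<Phi> \<Psi> inv in auto)

end

lemma Ck_on_scaled: "Ck_on k UNIV f \<Longrightarrow> Ck_on k UNIV (\<lambda>x. c *\<^sub>R f x)"
  by (intro Ck_on_scaleR open_UNIV Ck_on_const)

section \<open>Existence of flows, the pushing flow, and a nontrivial flow supported in a
  ball\<close>

context exact_chart
begin

text \<open>The factor \<open>c\<close> brings the field below the Lipschitz bound of the iteration.
  The last conjunct keeps the Euler step estimate, the only quantitative information on
  \<open>\<Phi> 1\<close> used later.\<close>

lemma scaled_flow_exists:
  assumes g: "\<And>k. Ck_on k UNIV g" and K: "compact K" "K \<subseteq> V" and g0: "\<And>x. x \<notin> K \<Longrightarrow> g x = 0"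
    and X: "\<And>k. Ck_on k UNIV X" "\<And>x. x \<notin> K \<Longrightarrow> X x = 0"
    and ham: "\<And>x w. x \<in> V \<Longrightarrow> W x (X x) w = frechet_derivative g (at x) w"
    and L: "L \<ge> 0" "\<And>x v. norm (frechet_derivative X (at x) v) \<le> L * norm v"
    and c: "c \<ge> 0" "c * L \<le> 1/2"
  shows "\<exists>\<Phi> \<Psi>. compact_hamiltonian_flow V \<beta> e (\<lambda>x. c * g x) (\<lambda>x. c *\<^sub>R X x) K \<Phi> \<Psi> \<and> symplectic (\<Phi> 1) \<and>
    (\<forall>x. norm (\<Phi> 1 x - x - c *\<^sub>R X x) \<le> 2 * (c * L) * norm (c *\<^sub>R X x))"
proof -
  let ?X = "\<lambda>x. c *\<^sub>R X x" and ?g = "\<lambda>x. c * g x"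
  have dX: "(X has_derivative frechet_derivative X (at x)) (at x)" for x
    using Ck_on_has_derivative[OF X(1)[of "Suc 0"]] by simp
  have dg: "(g has_derivative frechet_derivative g (at x)) (at x)" for x
    using Ck_on_has_derivative[OF g[of "Suc 0"]] by simp
  have fdX: "frechet_derivative ?X (at x) v = c *\<^sub>R frechet_derivative X (at x) v" for x v
    by (rule fun_cong[OF frechet_derivative_eqI[OF has_derivative_scaleR_right[OF dX]]])
  have fdg: "frechet_derivative ?g (at x) v = c * frechet_derivative g (at x) v" for x v
    by (rule fun_cong[OF frechet_derivative_eqI[OF has_derivative_mult_right[OF dg]]])
  have Cg: "Ck_on k UNIV ?g" for k by (intro Ck_on_mult open_UNIV Ck_on_const g)
  have sm: "small_field ?X (c * L)"
  proof
    show "Ck_on k UNIV ?X" for k by (rule Ck_on_scaled[OF X(1)])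
    show "norm (frechet_derivative ?X (at x) v) \<le> c * L * norm v" for x v
      unfolding fdX using mult_left_mono[OF L(2)[of x v] c(1)] c(1) by (simp add: mult.assoc)
  qed (use L c in auto)
  interpret X: small_field ?X "c * L" by (rule sm)
  interpret X': small_field "\<lambda>x. - ?X x" "c * L" by (rule X.small_field_uminus)
  have ham': "W x (?X x) w = frechet_derivative ?g (at x) w" if "x \<in> V" for x w
    using ham[OF that, of w] linear_scale[OF linear_W1[OF that], of c "X x" w] by (simp add: fdg)
  have 1: "compact_hamiltonian_flow V \<beta> e ?g ?X K (flow ?X) (flow (\<lambda>x. - ?X x))"
  proof
    show "flow ?X t (flow (\<lambda>x. - ?X x) t x) = x" if "t \<in> {0..1}" for t x
      using X'.flow_inverse[OF that, of x] by simp
  qed (use K g0 X(2) Cg ham' X.Ck_on_flow X'.Ck_on_flow X.flow_0 X.flow_inverse X.flow_stationary X.smooth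
        X.flow_has_vector_derivative in auto)
  interpret F: compact_hamiltonian_flow V \<beta> e ?g ?X K "flow ?X" "flow (\<lambda>x. - ?X x)" by (rule 1)
  have "symplectic (flow ?X 1)"
    unfolding symplectic_def
    using F.\<Phi>_in_V flow_preserves_W[OF Cg sm ham'] by auto
  with 1 X.flow_1_approx show ?thesis by blast
qed

text \<open>A quadratic polynomial with the wanted 2-jet, times a bump. The jet survives because the
  bump is 1 with derivative 0 at \<open>z\<close>, while its second derivative meets the factor
  \<open>h z = 0\<close>. The differential \<open>\<beta> z\<close> will produce the field value
  \<open>e\<close>, and the Hessian is the symmetric part of the derivative of
  \<open>\<beta>\<close>.\<close>

lemma jet_hamiltonian:
  assumes z: "z \<in> V"
  obtains H K where "\<And>k. Ck_on k UNIV H" "compact K" "K \<subseteq> V" "\<And>x. x \<notin> K \<Longrightarrow> H x = 0"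
    "\<And>w. frechet_derivative H (at z) w = \<beta> z w"
    "\<And>w. ((\<lambda>x. frechet_derivative H (at x) w) has_derivative
       (\<lambda>u. (form_deriv \<beta> z u w + form_deriv \<beta> z w u) / 2)) (at z)"
proof -
  obtain R where R: "R > 0" "cball z R \<subseteq> V" using open_V z open_contains_cball by blast
  define B where "B = form_deriv \<beta> z"
  \<comment> \<open>The value of the unnormalised bump at its centre; dividing by it gives
    \<open>b z = 1\<close>.\<close>
  define m where "m = exp_bump 0 (R\<^sup>2)"
  have m: "m > 0" using R by (simp add: m_def exp_bump_def)
  define q where "q x = R\<^sup>2 - (x - z) \<bullet> (x - z)" for x
  define b where "b x = exp_bump 0 (q x) / m" for x
  define h where "h x = \<beta> z (x - z) + B (x - z) (x - z) / 2" for x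
  define H where "H x = b x * h x" for x
  have lin: "linear (\<beta> z)" "linear (\<lambda>u. B u w)" "linear (\<lambda>w. B u w)" for u w
    unfolding B_def using z linear_form linear_form_deriv1 linear_form_deriv2 by auto
  have C\<tau>: "Ck_on k UNIV (\<lambda>x. x - z)" for k
    by (intro Ck_on_diff open_UNIV Ck_on_const Ck_on_bounded_linear bounded_linear_ident)
  have Bsum: "B u w = (\<Sum>i\<in>Basis. \<Sum>j\<in>Basis. (u \<bullet> i) * ((w \<bullet> j) * B i j))" for u w
  proof -
    have "B u w = (\<Sum>i\<in>Basis. (u \<bullet> i) *\<^sub>R B i w)" by (rule linear_sum_Basis[OF lin(2)])
    also have "\<dots> = (\<Sum>i\<in>Basis. (u \<bullet> i) *\<^sub>R (\<Sum>j\<in>Basis. (w \<bullet> j) *\<^sub>R B i j))"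
      by (intro sum.cong refl arg_cong2[where f = scaleR] linear_sum_Basis[OF lin(3)])
    finally show ?thesis by (simp add: sum_distrib_left)
  qed
  have Cq: "Ck_on k UNIV q" for k
    unfolding q_def[abs_def] by (intro Ck_on_diff[OF open_UNIV] Ck_on_inner[OF open_UNIV] C\<tau> Ck_on_const)
  have Cb: "Ck_on k UNIV b" for k
  proof -
    have "Ck_on k UNIV (\<lambda>x. exp_bump 0 (q x) * (1 / m))"
      by (intro Ck_on_mult open_UNIV Ck_on_const Ck_on_compose[OF _ open_UNIV Cq Ck_on_exp_bump]) simp
    then show ?thesis by (simp add: b_def[abs_def])
  qed
  have Ch: "Ck_on k UNIV h" for k
  proof -
    have 1: "Ck_on k UNIV (\<lambda>x. \<beta> z (x - z))"
      by (rule Ck_on_bounded_linear_compose[OF open_UNIV linear_conv_bounded_linear[THEN iffD1, OF lin(1)] C\<tau>])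
    have 2: "Ck_on k UNIV (\<lambda>x. \<Sum>i\<in>Basis. \<Sum>j\<in>Basis. ((x - z) \<bullet> i) * (((x - z) \<bullet> j) * B i j))"
      by (intro Ck_on_sum[OF open_UNIV] Ck_on_mult[OF open_UNIV] Ck_on_inner[OF open_UNIV] C\<tau> Ck_on_const)
    have "h = (\<lambda>x. \<beta> z (x - z) + (\<Sum>i\<in>Basis. \<Sum>j\<in>Basis. ((x - z) \<bullet> i) * (((x - z) \<bullet> j) * B i j)) * (1/2))"
      unfolding h_def[abs_def] Bsum[of "x - z" "x - z" for x] by simp
    then show ?thesis using Ck_on_add[OF open_UNIV 1 Ck_on_mult[OF open_UNIV 2 Ck_on_const[of _ _ "1/2"]]] by simp
  qed
  \<comment> \<open>\<open>p\<close> and \<open>s\<close> are the derivatives of \<open>h\<close>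
    and \<open>b\<close>; the index 2 arises from differentiating \<open>exp_bump 0\<close>.\<close>
  define p where "p x w = \<beta> z w + (B (x - z) w + B w (x - z)) / 2" for x w
  define s where "s x w = - 2 * ((x - z) \<bullet> w) * (exp_bump 2 (q x) / m)" for x w
  have d\<tau>: "((\<lambda>x. x - z) has_derivative (\<lambda>v. v)) (at x)" for x
    by (auto intro!: derivative_eq_intros)
  note d\<tau>i = has_derivative_inner_left[OF d\<tau>]
  have dlin: "((\<lambda>x. f (x - z)) has_derivative f) (at x)" if "linear f" for f :: "'a \<Rightarrow> real" and x
    by (rule bounded_linear.has_derivative[OF linear_conv_bounded_linear[THEN iffD1, OF that] d\<tau>])
  have dBB: "((\<lambda>x. B (x - z) (x - z)) has_derivative (\<lambda>w. B (x - z) w + B w (x - z))) (at x)" for x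
  proof -
    have "((\<lambda>y. \<Sum>i\<in>Basis. \<Sum>j\<in>Basis. ((y - z) \<bullet> i) * (((y - z) \<bullet> j) * B i j)) has_derivative
      (\<lambda>w. \<Sum>i\<in>Basis. \<Sum>j\<in>Basis. ((x - z) \<bullet> i) * ((w \<bullet> j) * B i j) + (w \<bullet> i) * (((x - z) \<bullet> j) * B i j))) (at x)"
      by (intro has_derivative_sum has_derivative_mult[OF d\<tau>i has_derivative_mult_left[OF d\<tau>i]])
    moreover have "(\<Sum>i\<in>Basis. \<Sum>j\<in>Basis. ((x - z) \<bullet> i) * ((w \<bullet> j) * B i j) + (w \<bullet> i) * (((x - z) \<bullet> j) * B i j))
       = B (x - z) w + B w (x - z)" for w
      unfolding Bsum[of "x - z" w] Bsum[of w "x - z"] by (simp only: sum.distrib)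
    moreover have "(\<lambda>x. B (x - z) (x - z)) =
        (\<lambda>y. \<Sum>i\<in>Basis. \<Sum>j\<in>Basis. ((y - z) \<bullet> i) * (((y - z) \<bullet> j) * B i j))"
      by (rule ext, rule Bsum)
    ultimately show ?thesis by simp
  qed
  have dh: "(h has_derivative p x) (at x)" for x
    unfolding h_def[abs_def] p_def
    by (intro has_derivative_add dlin lin bounded_linear.has_derivative[OF bounded_linear_divide dBB])
  have dq: "(q has_derivative (\<lambda>w. - 2 * ((x - z) \<bullet> w))) (at x)" for x
    unfolding q_def[abs_def] by (auto intro!: derivative_eq_intros simp: inner_commute)
  have db: "(b has_derivative s x) (at x)" for x
  proof -
    have "(exp_bump 0 has_derivative (*) (exp_bump 2 (q x))) (at (q x))"
      using exp_bump_derivative[of 0 "q x"] by (simp add: has_field_derivative_def numeral_2_eq_2)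
    from has_derivative_mult_right[OF has_derivative_compose[OF dq this], of "1 / m"]
    show ?thesis unfolding b_def[abs_def] s_def by (simp add: mult_ac)
  qed
  have b1: "b z = 1" using m by (simp add: b_def q_def m_def)
  have h0: "h z = 0" using linear_0[OF lin(1)] linear_0[OF lin(2)] by (simp add: h_def)
  have s0: "s z w = 0" for w by (simp add: s_def)
  have pz: "p z w = \<beta> z w" for w using linear_0[OF lin(2)] linear_0[OF lin(3)] by (simp add: p_def)
  have dH: "frechet_derivative H (at x) w = b x * p x w + s x w * h x" for x w
    unfolding H_def[abs_def] by (rule fun_cong[OF frechet_derivative_eqI[OF has_derivative_mult[OF db dh]]])
  show thesis
  proof (rule that)
    show "Ck_on k UNIV H" for k unfolding H_def[abs_def] by (intro Ck_on_mult open_UNIV Cb Ch)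
    show "compact (cball z R)" "cball z R \<subseteq> V" using R by auto
    show "H x = 0" if "x \<notin> cball z R" for x
    proof -
      have "R < norm (x - z)" using that by (simp add: dist_norm norm_minus_commute)
      then have "R\<^sup>2 < (norm (x - z))\<^sup>2" using R by (intro power_strict_mono) auto
      then have "q x < 0" by (simp add: q_def power2_norm_eq_inner)
      then show ?thesis by (simp add: H_def b_def exp_bump_def)
    qed
    show "frechet_derivative H (at z) w = \<beta> z w" for w
      by (simp add: dH b1 h0 s0 pz)
    fix w
    have dp: "((\<lambda>x. p x w) has_derivative (\<lambda>u. (B u w + B w u) / 2)) (at z)"
      unfolding p_def
      by (rule has_derivative_eq_rhs[OF has_derivative_add[OF has_derivative_const
              bounded_linear.has_derivative[OF bounded_linear_divide
                has_derivative_add[OF dlin[OF lin(2)] dlin[OF lin(3)]]]]]) simp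
    \<comment> \<open>Only the existence of this derivative matters, since it enters with the factor
      \<open>(z - z) \<bullet> w\<close>.\<close>
    have "((\<lambda>x. exp_bump 2 (q x)) has_derivative frechet_derivative (\<lambda>x. exp_bump 2 (q x)) (at z)) (at z)"
      using Ck_on_has_derivative[OF Ck_on_compose[OF open_UNIV open_UNIV Cq Ck_on_exp_bump, of "Suc 0" 2]] by simp
    then obtain E where E: "((\<lambda>x. exp_bump 2 (q x)) has_derivative E) (at z)" by blast
    have ds: "((\<lambda>x. s x w) has_derivative (\<lambda>u. (- 2 * ((z - z) \<bullet> w)) * (E u / m) + (- 2 * (u \<bullet> w)) * (exp_bump 2 (q z) / m))) (at z)"
      unfolding s_def
      by (rule has_derivative_mult[OF has_derivative_mult_right[OF d\<tau>i]
            bounded_linear.has_derivative[OF bounded_linear_divide E]])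
    have "((\<lambda>x. b x * p x w + s x w * h x) has_derivative
        (\<lambda>u. (b z * ((B u w + B w u) / 2) + s z u * p z w) +
          (s z w * p z u + ((- 2 * ((z - z) \<bullet> w)) * (E u / m) + (- 2 * (u \<bullet> w)) * (exp_bump 2 (q z) / m)) * h z))) (at z)"
      by (intro has_derivative_add has_derivative_mult db dp ds dh)
    then show "((\<lambda>x. frechet_derivative H (at x) w) has_derivative
       (\<lambda>u. (form_deriv \<beta> z u w + form_deriv \<beta> z w u) / 2)) (at z)"
      unfolding dH[abs_def] by (simp add: b1 h0 s0 B_def)
  qed
qed

text \<open>The field \<open>X - e\<close> vanishes at \<open>z\<close> with linearisation \<open>-1/2\<close>: the conformal factor of the
  Liouville flow leaves exactly this much room for contraction.\<close>

lemma contracting_field: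
  assumes z: "z \<in> V"
  obtains H X K where "\<And>k. Ck_on k UNIV H" "compact K" "K \<subseteq> V" "\<And>x. x \<notin> K \<Longrightarrow> H x = 0"
    "\<And>k. Ck_on k UNIV X" "\<And>x. x \<notin> K \<Longrightarrow> X x = 0"
    "\<And>x w. x \<in> V \<Longrightarrow> W x (X x) w = frechet_derivative H (at x) w"
    "X z = e" "(X has_derivative (\<lambda>u. - (u /\<^sub>R 2))) (at z)"
proof -
  obtain H K where H: "\<And>k. Ck_on k UNIV H" "compact K" "K \<subseteq> V" "\<And>x. x \<notin> K \<Longrightarrow> H x = 0"
    "\<And>w. frechet_derivative H (at z) w = \<beta> z w"
    "\<And>w. ((\<lambda>x. frechet_derivative H (at x) w) has_derivative
       (\<lambda>u. (form_deriv \<beta> z u w + form_deriv \<beta> z w u) / 2)) (at z)"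
    by (rule jet_hamiltonian[OF z]) blast
  obtain X where X: "\<And>k. Ck_on k UNIV X" "\<And>x. x \<notin> K \<Longrightarrow> X x = 0"
    "\<And>x w. x \<in> V \<Longrightarrow> W x (X x) w = frechet_derivative H (at x) w"
    using field_exists[OF H(1-4)] by blast
  have Xz: "X z = e"
    by (rule W_eq_imp_eq[OF z]) (simp add: X(3)[OF z] H(5) W_e[OF z])
  let ?D = "frechet_derivative X (at z)"
  have dX: "(X has_derivative ?D) (at z)"
    using Ck_on_has_derivative[OF X(1)[of "Suc 0"]] by simp
  \<comment> \<open>Differentiate \<open>W x (X x) w = dH w\<close> at \<open>z\<close>. Since
    \<open>W x e w = \<beta> x w\<close>, the derivative of \<open>W\<close> contributes
    \<open>form_deriv \<beta> z u w\<close>; removing it from the symmetrised Hessian leaves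
    \<open>- W z u w / 2\<close>.\<close>
  have "?D u = - (u /\<^sub>R 2)" for u
  proof (rule W_eq_imp_eq[OF z])
    fix w
    have "((\<lambda>x. frechet_derivative H (at x) w) has_derivative (\<lambda>v. DW z v (X z) w + W z (?D v) w)) (at z)"
      by (rule has_derivative_transform_within_open[OF W_field_has_derivative[OF z dX] open_V z]) (rule X(3))
    from fun_cong[OF has_derivative_unique[OF H(6) this], of u]
    have "(form_deriv \<beta> z u w + form_deriv \<beta> z w u) / 2 = DW z u e w + W z (?D u) w" by (simp add: Xz)
    moreover have "((\<lambda>x. W x e w) has_derivative (\<lambda>u. form_deriv \<beta> z u w)) (at z)"
      by (rule has_derivative_transform_within_open[OF form_has_derivative[OF z] open_V z]) (simp add: W_e)
    then have "DW z u e w = form_deriv \<beta> z u w"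
      unfolding DW_def by (rule fun_cong[OF frechet_derivative_eqI])
    ultimately have "W z (?D u) w = - (1/2) * W z u w" by (simp add: form_ext_def field_simps)
    also have "\<dots> = W z ((- (1/2)) *\<^sub>R u) w"
      using linear_scale[OF linear_W1[OF z], of "- (1/2)" u w] by simp
    finally show "W z (?D u) w = W z (- (u /\<^sub>R 2)) w" by simp
  qed
  then have "?D = (\<lambda>u. - (u /\<^sub>R 2))" by (rule ext)
  with dX have "(X has_derivative (\<lambda>u. - (u /\<^sub>R 2))) (at z)" by simp
  from that[OF H(1-4) X Xz this] show thesis .
qed

text \<open>From \<open>z + y\<close> the Euler step leads to
  \<open>z + c *\<^sub>R e + (1 - c / 2) *\<^sub>R y\<close>, up to \<open>c\<close> times the
  nonlinear remainder of the field. The contraction has to outweigh this remainder and the error of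
  the Euler step.\<close>

lemma pushing_flow:
  assumes z: "z \<in> V"
  obtains H X K \<Phi> \<Psi> r c where "compact_hamiltonian_flow V \<beta> e H X K \<Phi> \<Psi>" "symplectic (\<Phi> 1)"
    "r > 0" "c > 0" "cball z r \<subseteq> V" "\<Phi> 1 ` cball z r \<subseteq> cball (z + c *\<^sub>R e) r"
proof -
  obtain H X K where H: "\<And>k. Ck_on k UNIV H" and K: "compact K" "K \<subseteq> V" and H0: "\<And>x. x \<notin> K \<Longrightarrow> H x = 0"
    and X: "\<And>k. Ck_on k UNIV X" "\<And>x. x \<notin> K \<Longrightarrow> X x = 0"
    and ham: "\<And>x w. x \<in> V \<Longrightarrow> W x (X x) w = frechet_derivative H (at x) w"
    and Xz: "X z = e" and dX: "(X has_derivative (\<lambda>u. - (u /\<^sub>R 2))) (at z)"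
    using contracting_field[OF z] by blast
  obtain L where L: "L \<ge> 0" "\<And>x v. norm (frechet_derivative X (at x) v) \<le> L * norm v"
    using compact_support_derivative_bounded[OF X(1) K(1) X(2)] by auto
  \<comment> \<open>The budget on a ball of radius \<open>r\<close>: of the gain
    \<open>c * r / 2\<close>, the remainder costs \<open>c * r / 8\<close> by this choice and the
    Euler error \<open>c * r / 4\<close>, so \<open>c * r / 8\<close> is left.\<close>
  obtain d where d: "d > 0" "\<And>x. norm (x - z) < d \<Longrightarrow> norm (X x - X z - - ((x - z) /\<^sub>R 2)) \<le> 1/8 * norm (x - z)"
    using conjunct2[OF dX[unfolded has_derivative_at_alt], rule_format, of "1/8"] by auto
  obtain R where R: "R > 0" "cball z R \<subseteq> V" using open_V z open_contains_cball by blast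
  define r where "r = min (d / 2) R"
  have r: "r > 0" "r < d" "cball z r \<subseteq> V"
    using d(1) R subset_cball[of r R z] by (auto simp: r_def)
  have "continuous_on (cball z r) X"
    using continuous_on_subset[OF Ck_on_imp_continuous_on[OF X(1)[of 0]]] by auto
  from compact_imp_bounded[OF compact_continuous_image[OF this compact_cball]]
  obtain M where "\<forall>x\<in>cball z r. norm (X x) \<le> M" unfolding bounded_iff by auto
  then have M: "norm (X x) \<le> M" if "x \<in> cball z r" for x using that by blast
  have M0: "M \<ge> 0" using order_trans[OF norm_ge_zero M[of z]] r(1) by simp
  \<comment> \<open>The first bound gives \<open>c * L \<le> 1/2\<close> and
    \<open>c \<le> 1\<close>; the second makes the quadratic Euler error at most
    \<open>c * r / 4\<close>. The added 1s avoid division by 0.\<close>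
  define c where "c = min (1 / (2 * L + 1)) (r / (8 * L * M + 1))"
  have c: "c > 0" using r L M0 by (simp add: c_def add_nonneg_pos)
  have c1: "c * L \<le> 1/2" "c \<le> 1"
  proof -
    have "c * (2 * L + 1) \<le> 1 / (2 * L + 1) * (2 * L + 1)"
      using L(1) by (intro mult_right_mono) (auto simp: c_def)
    also have "\<dots> = 1" using L(1) by simp
    finally have "2 * (c * L) + c \<le> 1" by (simp add: algebra_simps)
    then show "c * L \<le> 1/2" "c \<le> 1"
      using c L(1) mult_nonneg_nonneg[of c L] by linarith+
  qed
  have c2: "c * (8 * L * M) \<le> r"
  proof -
    have p: "8 * L * M + 1 > 0" using L M0 by (simp add: add_nonneg_pos)
    have "c * (8 * L * M + 1) \<le> r / (8 * L * M + 1) * (8 * L * M + 1)"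
      using p by (intro mult_right_mono) (auto simp: c_def)
    also have "\<dots> = r" using p by simp
    finally show ?thesis using c by (simp add: algebra_simps)
  qed
  obtain \<Phi> \<Psi> where F: "compact_hamiltonian_flow V \<beta> e (\<lambda>x. c * H x) (\<lambda>x. c *\<^sub>R X x) K \<Phi> \<Psi>" "symplectic (\<Phi> 1)"
    "\<And>x. norm (\<Phi> 1 x - x - c *\<^sub>R X x) \<le> 2 * (c * L) * norm (c *\<^sub>R X x)"
    using scaled_flow_exists[OF H K H0 X ham L less_imp_le[OF c] c1(1)] by blast
  have "\<Phi> 1 x \<in> cball (z + c *\<^sub>R e) r" if x: "x \<in> cball z r" for x
  proof -
    define y where "y = x - z"
    have y: "norm y \<le> r" using x by (simp add: y_def dist_norm norm_minus_commute)
    define \<rho> where "\<rho> = X x - e + y /\<^sub>R 2"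
    have \<rho>: "norm \<rho> \<le> norm y / 8"
      using d(2)[of x] y r(2) by (simp add: \<rho>_def y_def Xz)
    have eq: "\<Phi> 1 x - (z + c *\<^sub>R e) = (1 - c / 2) *\<^sub>R y + c *\<^sub>R \<rho> + (\<Phi> 1 x - x - c *\<^sub>R X x)"
      by (simp add: y_def \<rho>_def algebra_simps scaleR_left_diff_distrib)
    have "norm (\<Phi> 1 x - (z + c *\<^sub>R e)) \<le> norm ((1 - c / 2) *\<^sub>R y) + norm (c *\<^sub>R \<rho>) + norm (\<Phi> 1 x - x - c *\<^sub>R X x)"
      unfolding eq
      using norm_triangle_ineq[of "(1 - c / 2) *\<^sub>R y + c *\<^sub>R \<rho>" "\<Phi> 1 x - x - c *\<^sub>R X x"]
        norm_triangle_ineq[of "(1 - c / 2) *\<^sub>R y" "c *\<^sub>R \<rho>"] by linarith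
    also have "norm ((1 - c / 2) *\<^sub>R y) = (1 - c / 2) * norm y" using c c1(2) by simp
    also have "norm (c *\<^sub>R \<rho>) \<le> c * (norm y / 8)" using \<rho> c by (simp add: mult_left_mono)
    also have "norm (\<Phi> 1 x - x - c *\<^sub>R X x) \<le> c * (r / 4)"
    proof -
      have "norm (\<Phi> 1 x - x - c *\<^sub>R X x) \<le> 2 * (c * L) * norm (c *\<^sub>R X x)" by (rule F(3))
      also have "\<dots> = c * (c * (2 * L * norm (X x)))" using c by (simp add: mult_ac)
      also have "\<dots> \<le> c * (c * (2 * L * M))"
        using c L(1) M[OF x] by (intro mult_left_mono) auto
      also have "\<dots> \<le> c * (r / 4)" using c c2 by (intro mult_left_mono) auto
      finally show ?thesis .
    qed
    also have "(1 - c / 2) * norm y + c * (norm y / 8) + c * (r / 4) \<le> r"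
    proof -
      have "(1 - c / 2) * norm y + c * (norm y / 8) + c * (r / 4) = (1 - c * 3 / 8) * norm y + c * (r / 4)"
        by (simp add: algebra_simps)
      also have "\<dots> \<le> (1 - c * 3 / 8) * r + c * (r / 4)" using y c c1(2) by (intro add_mono mult_left_mono) auto
      also have "\<dots> = r - c * r / 8" by (simp add: algebra_simps)
      also have "\<dots> \<le> r" using c r by simp
      finally show ?thesis .
    qed
    finally show ?thesis by (simp add: dist_norm norm_minus_commute)
  qed
  then show thesis using that[OF F(1,2) r(1) c r(3)] by blast
qed

text \<open>A radial bump, positive at the centre and 0 on the boundary, has nonzero differential
  somewhere in the ball. For small \<open>c\<close> a point with nonzero field moves, because the
  Euler error is at most half the step.\<close>

lemma nontrivial_flow:
  assumes r: "r > 0" "cball z r \<subseteq> V"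
  obtains g X \<Phi> \<Psi> y where "compact_hamiltonian_flow V \<beta> e g X (cball z r) \<Phi> \<Psi>" "y \<in> V" "\<Phi> 1 y \<noteq> y"
proof -
  define g where "g x = exp_bump 0 (r\<^sup>2 - (x - z) \<bullet> (x - z))" for x
  have g: "Ck_on k UNIV g" for k
    unfolding g_def[abs_def]
    by (intro Ck_on_compose[OF open_UNIV open_UNIV _ Ck_on_exp_bump] Ck_on_diff[OF open_UNIV]
        Ck_on_inner[OF open_UNIV] Ck_on_const Ck_on_bounded_linear bounded_linear_ident) simp
  have g0: "g x = 0" if "x \<notin> cball z r" for x
  proof -
    have "r < norm (x - z)" using that by (simp add: dist_norm norm_minus_commute)
    then have "r\<^sup>2 < (norm (x - z))\<^sup>2" using r by (intro power_strict_mono) auto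
    then show ?thesis by (simp add: g_def exp_bump_def power2_norm_eq_inner)
  qed
  obtain X where X: "\<And>k. Ck_on k UNIV X" "\<And>x. x \<notin> cball z r \<Longrightarrow> X x = 0"
    "\<And>x w. x \<in> V \<Longrightarrow> W x (X x) w = frechet_derivative g (at x) w"
    using field_exists[OF g compact_cball r(2) g0] by blast
  have "\<exists>y\<in>V. X y \<noteq> 0"
  proof (rule ccontr)
    assume "\<not> ?thesis"
    then have "frechet_derivative g (at x) = (\<lambda>w. 0)" if "x \<in> cball z r" for x
      using X(3)[of x] linear_0[OF linear_W1, of x] that r(2) by (intro ext) force
    then have d0: "(g has_derivative (\<lambda>w. 0)) (at x within cball z r)" if "x \<in> cball z r" for x
      using has_derivative_at_withinI[OF Ck_on_has_derivative[OF g[of "Suc 0"] UNIV_I]] that by metis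
    obtain i :: 'a where i: "i \<in> Basis" using nonempty_Basis by blast
    have "z + r *\<^sub>R i \<in> cball z r" "z \<in> cball z r" using r i by (auto simp: dist_norm)
    then have "g (z + r *\<^sub>R i) = g z"
      by (intro has_derivative_zero_unique[of "cball z r" g] d0 convex_cball)
    moreover have "g z \<noteq> 0" "g (z + r *\<^sub>R i) = 0" using r i by (simp_all add: g_def exp_bump_def power2_eq_square)
    ultimately show False by simp
  qed
  then obtain y where y: "y \<in> V" "X y \<noteq> 0" by blast
  obtain L where L: "L \<ge> 0" "\<And>x v. norm (frechet_derivative X (at x) v) \<le> L * norm v"
    using compact_support_derivative_bounded[of X "cball z r", OF X(1) compact_cball X(2)] by auto
  define c where "c = 1 / (4 * L + 1)"
  have c: "c > 0" "c * L \<le> 1/4" using L(1) by (auto simp: c_def field_simps)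
  obtain \<Phi> \<Psi> where F: "compact_hamiltonian_flow V \<beta> e (\<lambda>x. c * g x) (\<lambda>x. c *\<^sub>R X x) (cball z r) \<Phi> \<Psi>"
    "\<And>x. norm (\<Phi> 1 x - x - c *\<^sub>R X x) \<le> 2 * (c * L) * norm (c *\<^sub>R X x)"
    using scaled_flow_exists[OF g compact_cball r(2) g0 X L, of c] c by auto
  have "\<Phi> 1 y \<noteq> y"
  proof
    assume "\<Phi> 1 y = y"
    then have "norm (c *\<^sub>R X y) \<le> 2 * (c * L) * norm (c *\<^sub>R X y)" using F(2)[of y] by simp
    also have "\<dots> \<le> 1/2 * norm (c *\<^sub>R X y)" using c(2) by (intro mult_right_mono) auto
    finally have "norm (c *\<^sub>R X y) \<le> 0" by simp
    then show False using y c by (simp add: mult_le_0_iff)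
  qed
  with F(1) y(1) that show thesis by blast
qed

end

section \<open>Change of charts\<close>

locale atlas_manifold =
  fixes M :: "('p, 'e::euclidean_space) manifold"
  assumes hausdorff: "Hausdorff_space (man_top M)"
    and chart_open: "c \<in> atlas M \<Longrightarrow> openin (man_top M) (fst c)"
    and image_open: "c \<in> atlas M \<Longrightarrow> open (snd c ` fst c)"
    and chart_homeomorphic: "c \<in> atlas M \<Longrightarrow>
      homeomorphic_map (subtopology (man_top M) (fst c)) (top_of_set (snd c ` fst c)) (snd c)"
    and charts_cover: "(\<Union>c\<in>atlas M. fst c) = points M"
    and transition_smooth_on: "c \<in> atlas M \<Longrightarrow> c' \<in> atlas M \<Longrightarrow>
      smooth_on (snd c ` (fst c \<inter> fst c')) (snd c' \<circ> chart_inv c)"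

lemma smooth_manifold_imp_atlas_manifold: "smooth_manifold M \<Longrightarrow> atlas_manifold M"
  unfolding smooth_manifold_def by unfold_locales auto

context atlas_manifold
begin

abbreviation trans_deriv :: "('p, 'e) chart \<Rightarrow> ('p, 'e) chart \<Rightarrow> 'p \<Rightarrow> 'e \<Rightarrow> 'e" where
  "trans_deriv c c' p \<equiv> frechet_derivative (snd c' \<circ> chart_inv c) (at (snd c p))"

lemma charts_at_iff: "c \<in> charts_at M p \<longleftrightarrow> c \<in> atlas M \<and> p \<in> fst c"
  by (simp add: charts_at_def)

lemma chart_subset: "c \<in> atlas M \<Longrightarrow> fst c \<subseteq> points M"
  using chart_open openin_subset by blast

lemma points_charts_at: "p \<in> points M \<Longrightarrow> \<exists>c. c \<in> charts_at M p"
  using charts_cover unfolding charts_at_iff by blast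

lemma chart_at_in: "p \<in> points M \<Longrightarrow> chart_at M p \<in> charts_at M p"
  unfolding chart_at_def using points_charts_at by (rule someI_ex)

lemma chart_inj: "c \<in> atlas M \<Longrightarrow> inj_on (snd c) (fst c)"
  using homeomorphic_imp_injective_map[OF chart_homeomorphic, of c] chart_subset[of c]
  by (simp add: inf.absorb2)

lemma chart_inv_left [simp]: "c \<in> atlas M \<Longrightarrow> p \<in> fst c \<Longrightarrow> chart_inv c (snd c p) = p"
  using chart_inj by simp

lemma chart_inv_right [simp]: "x \<in> snd c ` fst c \<Longrightarrow> snd c (chart_inv c x) = x"
  by (rule f_inv_into_f)

lemma chart_inv_in: "x \<in> snd c ` fst c \<Longrightarrow> chart_inv c x \<in> fst c"
  by (rule inv_into_into)

lemma open_chart_image: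
  assumes c: "c \<in> atlas M" and W: "openin (man_top M) W"
  shows "open (snd c ` (fst c \<inter> W))"
proof -
  have "openin (subtopology (man_top M) (fst c)) (fst c \<inter> W)"
    using W by (auto simp: openin_subtopology)
  then have "openin (top_of_set (snd c ` fst c)) (snd c ` (fst c \<inter> W))"
    using homeomorphic_imp_open_map[OF chart_homeomorphic[OF c]] by (simp add: open_map_def)
  then show ?thesis using openin_open_eq[OF image_open[OF c]] by blast
qed

lemma continuous_chart:
  "c \<in> atlas M \<Longrightarrow> continuous_map (subtopology (man_top M) (fst c)) euclidean (snd c)"
  using homeomorphic_imp_continuous_map[OF chart_homeomorphic] continuous_map_into_fulltopology by blast

lemma continuous_chart_inv:
  assumes c: "c \<in> atlas M"
  shows "continuous_map (top_of_set (snd c ` fst c)) (man_top M) (chart_inv c)"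
  unfolding continuous_map_def
proof (intro conjI allI impI)
  show "chart_inv c \<in> topspace (top_of_set (snd c ` fst c)) \<rightarrow> points M"
    using chart_inv_in[of _ c] chart_subset[OF c] by auto
  fix W assume W: "openin (man_top M) W"
  have "{x \<in> snd c ` fst c. chart_inv c x \<in> W} = snd c ` (fst c \<inter> W)"
    using c by force
  then show "openin (top_of_set (snd c ` fst c)) {x \<in> topspace (top_of_set (snd c ` fst c)). chart_inv c x \<in> W}"
    using open_chart_image[OF c W] openin_open_eq[OF image_open[OF c]] by auto
qed

lemma Ck_on_transition:
  assumes "c \<in> atlas M" "c' \<in> atlas M"
  shows "Ck_on k (snd c ` (fst c \<inter> fst c')) (snd c' \<circ> chart_inv c)"
  using smooth_on_open[OF open_chart_image[OF assms(1) chart_open[OF assms(2)]]]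
    transition_smooth_on[OF assms] by blast

lemma transition_has_derivative:
  assumes "c \<in> atlas M" "c' \<in> atlas M" "p \<in> fst c" "p \<in> fst c'"
  shows "((snd c' \<circ> chart_inv c) has_derivative trans_deriv c c' p) (at (snd c p))"
  by (rule Ck_on_has_derivative[OF Ck_on_transition[OF assms(1,2), of "Suc 0"]]) (use assms in auto)

lemma has_derivative_change_chart:
  assumes c: "c \<in> atlas M" "p \<in> fst c" and c': "c' \<in> atlas M" "p \<in> fst c'"
    and h: "((h \<circ> chart_inv c) has_derivative D) (at (snd c p))"
  shows "((h \<circ> chart_inv c') has_derivative (\<lambda>u. D (trans_deriv c' c p u))) (at (snd c' p))"
proof -
  have "(((h \<circ> chart_inv c) \<circ> (snd c \<circ> chart_inv c')) has_derivative (D \<circ> trans_deriv c' c p)) (at (snd c' p))"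
    by (rule diff_chain_at[OF transition_has_derivative[OF c'(1) c(1) c'(2) c(2)]]) (use h c' in simp)
  then have "((h \<circ> chart_inv c') has_derivative (D \<circ> trans_deriv c' c p)) (at (snd c' p))"
  proof (rule has_derivative_transform_within_open)
    show "open (snd c' ` (fst c' \<inter> fst c))" by (rule open_chart_image[OF c'(1) chart_open[OF c(1)]])
  qed (use c c' in auto)
  then show ?thesis by (simp add: o_def)
qed

lemma trans_deriv_refl:
  assumes "c \<in> atlas M" "p \<in> fst c"
  shows "trans_deriv c c p u = u"
proof -
  have "((snd c \<circ> chart_inv c) has_derivative (\<lambda>u. u)) (at (snd c p))"
    by (rule has_derivative_transform_within_open[OF has_derivative_ident image_open[OF assms(1)]])
      (use assms in auto)
  then show ?thesis by (simp add: frechet_derivative_eqI)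
qed

lemma trans_deriv_chain:
  assumes "c \<in> charts_at M p" "c' \<in> charts_at M p" "c'' \<in> charts_at M p"
  shows "trans_deriv c' c'' p (trans_deriv c c' p u) = trans_deriv c c'' p u"
  using frechet_derivative_eqI[OF has_derivative_change_chart[of c' p c "snd c''", OF _ _ _ _ transition_has_derivative[of c' c'' p]]] assms
  by (simp add: charts_at_iff)

lemma tangent_of_in: "c \<in> charts_at M p \<Longrightarrow> tangent_of M p c u \<in> tangent_space M p"
  by (auto simp: tangent_space_def tangent_of_def trans_deriv_chain)

lemma tangent_of_apply: "c' \<in> charts_at M p \<Longrightarrow> tangent_of M p c u c' = trans_deriv c c' p u"
  by (simp add: tangent_of_def)

lemma tangent_of_self: "c \<in> charts_at M p \<Longrightarrow> tangent_of M p c u c = u"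
  by (simp add: tangent_of_def trans_deriv_refl charts_at_iff)

lemma tangent_space_change:
  "v \<in> tangent_space M p \<Longrightarrow> c \<in> charts_at M p \<Longrightarrow> c' \<in> charts_at M p \<Longrightarrow> v c' = trans_deriv c c' p (v c)"
  unfolding tangent_space_def by blast

lemma tangent_of_coordinates:
  assumes "v \<in> tangent_space M p" "c \<in> charts_at M p"
  shows "tangent_of M p c (v c) = v"
proof
  fix c'
  show "tangent_of M p c (v c) c' = v c'"
  proof (cases "c' \<in> charts_at M p")
    case True
    then show ?thesis using tangent_space_change[OF assms True] by (simp add: tangent_of_apply)
  next
    case False
    then have "v c' = undefined" using assms(1) unfolding tangent_space_def extensional_def by blast
    with False show ?thesis by (simp add: tangent_of_def)
  qed
qed

lemma tangent_eqI:
  "v \<in> tangent_space M p \<Longrightarrow> w \<in> tangent_space M p \<Longrightarrow> c \<in> charts_at M p \<Longrightarrow> v c = w c \<Longrightarrow> v = w"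
  using tangent_of_coordinates by metis

lemma tangent_of_change:
  assumes "c \<in> charts_at M p" "c' \<in> charts_at M p"
  shows "tangent_of M p c' (trans_deriv c c' p u) = tangent_of M p c u"
  by (rule tangent_eqI[OF tangent_of_in[OF assms(2)] tangent_of_in[OF assms(1)] assms(2)])
    (simp add: assms tangent_of_self tangent_of_apply)

lemma zero_tangent_eq: "c \<in> charts_at M p \<Longrightarrow> zero_tangent M p = tangent_of M p c 0"
  using linear_0[OF has_derivative_linear[OF transition_has_derivative]]
  unfolding zero_tangent_def tangent_of_def by (intro restrict_ext) (simp add: charts_at_iff)

text \<open>The definition evaluates in the chart picked by \<open>chart_at\<close>; the chain rule
  through the transition map allows any chart.\<close>

lemma differential_eq:
  assumes v: "v \<in> tangent_space M p" and c: "c \<in> charts_at M p"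
    and h: "((h \<circ> chart_inv c) has_derivative D) (at (snd c p))"
  shows "differential M h p v = D (v c)"
proof -
  have "p \<in> points M" using c chart_subset unfolding charts_at_iff by blast
  then have c': "chart_at M p \<in> charts_at M p" by (rule chart_at_in)
  have "((h \<circ> chart_inv (chart_at M p)) has_derivative (\<lambda>u. D (trans_deriv (chart_at M p) c p u)))
      (at (snd (chart_at M p) p))"
    by (rule has_derivative_change_chart[OF _ _ _ _ h]) (use c c' in \<open>auto simp: charts_at_iff\<close>)
  then show ?thesis
    unfolding differential_def Let_def tangent_space_change[OF v c' c] by (simp add: frechet_derivative_eqI)
qed

lemma local_form_change:
  assumes "c \<in> charts_at M q" "c' \<in> charts_at M q"
  shows "local_form M \<beta> c' (snd c' q) u = local_form M \<beta> c (snd c q) (trans_deriv c' c q u)"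
  using assms tangent_of_change[OF assms(2,1)] by (simp add: local_form_def charts_at_iff)

lemma coordinate_form_local:
  assumes "smooth_one_form M \<beta>" "c \<in> atlas M"
  shows "coordinate_form (snd c ` fst c) (local_form M \<beta> c)"
proof (rule coordinate_form.intro)
  show "open (snd c ` fst c)" by (rule image_open[OF assms(2)])
  show "linear (local_form M \<beta> c x)" if "x \<in> snd c ` fst c" for x
    using assms that unfolding smooth_one_form_def by blast
  show "Ck_on k (snd c ` fst c) (\<lambda>x. local_form M \<beta> c x u)" for k u
    using assms smooth_on_open[OF image_open[OF assms(2)]] unfolding smooth_one_form_def by blast
qed

text \<open>In one chart the form is the pullback of its expression in the other under the
  transition map, and exterior derivatives commute with pullbacks.\<close>

lemma form_ext_change:
  assumes \<beta>: "smooth_one_form M \<beta>" and c: "c \<in> charts_at M p" and c': "c' \<in> charts_at M p"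
  shows "form_ext (local_form M \<beta> c') (snd c' p) u w =
    form_ext (local_form M \<beta> c) (snd c p) (trans_deriv c' c p u) (trans_deriv c' c p w)"
proof -
  have cA: "c \<in> atlas M" "c' \<in> atlas M" "p \<in> fst c" "p \<in> fst c'" using c c' by (auto simp: charts_at_iff)
  interpret c: coordinate_form "snd c ` fst c" "local_form M \<beta> c"
    by (rule coordinate_form_local[OF \<beta> cA(1)])
  let ?S = "snd c' ` (fst c' \<inter> fst c)"
  have "form_ext (local_form M \<beta> c') (snd c' p) u w = form_ext (local_form M \<beta> c) ((snd c \<circ> chart_inv c') (snd c' p))
     (trans_deriv c' c p u) (trans_deriv c' c p w)"
  proof (rule c.form_ext_pullback)
    show "open ?S" by (rule open_chart_image[OF cA(2) chart_open[OF cA(1)]])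
    show "snd c' p \<in> ?S" using cA by auto
    show "Ck_on k ?S (snd c \<circ> chart_inv c')" for k by (rule Ck_on_transition[OF cA(2,1)])
    show "(snd c \<circ> chart_inv c') ` ?S \<subseteq> snd c ` fst c" using cA by auto
    fix y u assume "y \<in> ?S"
    then obtain q where q: "q \<in> fst c" "q \<in> fst c'" "y = snd c' q" by auto
    show "local_form M \<beta> c' y u = local_form M \<beta> c ((snd c \<circ> chart_inv c') y)
        (frechet_derivative (snd c \<circ> chart_inv c') (at y) u)"
      using local_form_change[of c q c' \<beta> u] q cA by (simp add: charts_at_iff)
  qed
  then show ?thesis using cA by simp
qed

lemma ext_deriv_eq:
  assumes \<beta>: "smooth_one_form M \<beta>" and c: "c \<in> charts_at M p"
    and v: "v \<in> tangent_space M p" and w: "w \<in> tangent_space M p"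
  shows "ext_deriv M \<beta> p v w = form_ext (local_form M \<beta> c) (snd c p) (v c) (w c)"
proof -
  have "p \<in> points M" using c chart_subset unfolding charts_at_iff by blast
  then have c': "chart_at M p \<in> charts_at M p" by (rule chart_at_in)
  have "ext_deriv M \<beta> p v w =
      form_ext (local_form M \<beta> (chart_at M p)) (snd (chart_at M p) p) (v (chart_at M p)) (w (chart_at M p))"
    by (simp add: ext_deriv_def form_ext_def form_deriv_def Let_def)
  also have "\<dots> = form_ext (local_form M \<beta> c) (snd c p) (v c) (w c)"
    unfolding form_ext_change[OF \<beta> c c']
    using tangent_space_change[OF v c' c] tangent_space_change[OF w c' c] by simp
  finally show ?thesis .
qed

end

section \<open>The symplectization\<close>

lemma Ck_on_exp: "Ck_on k UNIV (exp :: real \<Rightarrow> real)"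
proof (induction k)
  case 0
  show ?case by (simp add: continuous_on_exp)
next
  case (Suc k)
  have d: "((exp :: real \<Rightarrow> real) has_derivative (\<lambda>v. exp x * v)) (at x)" for x
    using DERIV_exp[of x] by (simp add: has_field_derivative_def)
  then have "(exp :: real \<Rightarrow> real) differentiable (at x)" for x by (rule differentiableI)
  moreover have "Ck_on k UNIV (\<lambda>x::real. exp x * v)" for v
    by (rule Ck_on_mult[OF open_UNIV Suc Ck_on_const])
  ultimately show ?case by (simp add: frechet_derivative_eqI[OF d])
qed

lemma Ck_on_compose_snd:
  fixes f :: "'a::euclidean_space \<Rightarrow> 'b::real_normed_vector"
  assumes "open S" "Ck_on k S f"
  shows "Ck_on k ((UNIV :: 'c::euclidean_space set) \<times> S) (\<lambda>z. f (snd z))"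
  by (rule Ck_on_compose[OF _ assms(1) Ck_on_bounded_linear[OF bounded_linear_snd] assms(2)])
    (use assms(1) in \<open>auto simp: open_Times\<close>)

definition lift_chart :: "('p, 'e) chart \<Rightarrow> (real \<times> 'p, real \<times> 'e) chart" where
  "lift_chart c = (UNIV \<times> fst c, map_prod id (snd c))"

lemma atlas_symplectization: "atlas (symplectization N) = lift_chart ` atlas N"
  by (simp add: symplectization_def lift_chart_def[abs_def])

lemma man_top_symplectization: "man_top (symplectization N) = prod_topology euclideanreal (man_top N)"
  by (simp add: symplectization_def)

lemma points_symplectization: "points (symplectization N) = UNIV \<times> points N"
  by (simp add: man_top_symplectization)

lemma fst_lift_chart: "fst (lift_chart c) = UNIV \<times> fst c"
  by (simp add: lift_chart_def)

lemma snd_lift_chart: "snd (lift_chart c) (s, p) = (s, snd c p)"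
  by (simp add: lift_chart_def)

lemma lift_chart_image: "snd (lift_chart c) ` (UNIV \<times> U) = UNIV \<times> snd c ` U"
  by (auto simp: lift_chart_def image_iff)

context atlas_manifold
begin

lemma lift_chart_inv:
  assumes "c \<in> atlas M" "x \<in> snd c ` fst c"
  shows "chart_inv (lift_chart c) (s, x) = (s, chart_inv c x)"
proof (rule inv_into_f_eq)
  show "inj_on (snd (lift_chart c)) (fst (lift_chart c))"
    using chart_inj[OF assms(1)] by (auto simp: inj_on_def lift_chart_def)
qed (use assms chart_inv_in in \<open>auto simp: fst_lift_chart snd_lift_chart\<close>)

lemma atlas_manifold_symplectization: "atlas_manifold (symplectization M)"
proof
  show "Hausdorff_space (man_top (symplectization M))"
    using hausdorff by (simp add: man_top_symplectization Hausdorff_space_prod_topology)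
  show "(\<Union>C\<in>atlas (symplectization M). fst C) = points (symplectization M)"
    using charts_cover by (auto simp: atlas_symplectization fst_lift_chart points_symplectization)
next
  fix C assume "C \<in> atlas (symplectization M)"
  then obtain c where c: "c \<in> atlas M" "C = lift_chart c" by (auto simp: atlas_symplectization)
  show "openin (man_top (symplectization M)) (fst C)"
    using chart_open[OF c(1)] by (simp add: c man_top_symplectization fst_lift_chart openin_prod_Times_iff)
  show "open (snd C ` fst C)"
    using image_open[OF c(1)] by (simp add: c fst_lift_chart lift_chart_image open_Times)
  have "subtopology (prod_topology euclideanreal (man_top M)) (UNIV \<times> fst c) =
      prod_topology euclideanreal (subtopology (man_top M) (fst c))"
    by (simp add: subtopology_Times)
  moreover have "top_of_set (UNIV \<times> snd c ` fst c :: (real \<times> 'e) set) =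
      prod_topology euclideanreal (top_of_set (snd c ` fst c))"
    using subtopology_Times[of euclideanreal euclidean UNIV "snd c ` fst c"] by simp
  moreover obtain g where g: "homeomorphic_maps (subtopology (man_top M) (fst c)) (top_of_set (snd c ` fst c)) (snd c) g"
    using chart_homeomorphic[OF c(1)] unfolding homeomorphic_map_maps by blast
  have "homeomorphic_maps euclideanreal euclideanreal id id" by (simp add: homeomorphic_maps_id)
  with g have "homeomorphic_maps (prod_topology euclideanreal (subtopology (man_top M) (fst c)))
     (prod_topology euclideanreal (top_of_set (snd c ` fst c))) (\<lambda>(s, p). (id s, snd c p)) (\<lambda>(s, x). (id s, g x))"
    unfolding homeomorphic_maps_prod by blast
  moreover have "(\<lambda>(s, p). (id s, snd c p)) = snd (lift_chart c)"
    by (auto simp: lift_chart_def)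
  ultimately show "homeomorphic_map (subtopology (man_top (symplectization M)) (fst C))
      (top_of_set (snd C ` fst C)) (snd C)"
    unfolding homeomorphic_map_maps c(2) man_top_symplectization fst_lift_chart lift_chart_image by auto
  fix C' assume "C' \<in> atlas (symplectization M)"
  then obtain c' where c': "c' \<in> atlas M" "C' = lift_chart c'" by (auto simp: atlas_symplectization)
  let ?S = "snd c ` (fst c \<inter> fst c')"
  have op: "open ?S" by (rule open_chart_image[OF c(1) chart_open[OF c'(1)]])
  have S: "snd C ` (fst C \<inter> fst C') = UNIV \<times> ?S"
    by (simp add: c c' fst_lift_chart Times_Int_Times lift_chart_image)
  have opS: "open ((UNIV :: real set) \<times> ?S)" using op by (simp add: open_Times)
  have "Ck_on k (UNIV \<times> ?S) (snd C' \<circ> chart_inv C)" for k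
  proof (subst Ck_on_cong[OF opS])
    \<comment> \<open>Split into a linear part and a part depending on \<open>snd z\<close>, to
      which the rules for \<open>Ck_on\<close> apply.\<close>
    show "(snd C' \<circ> chart_inv C) z = (fst z, 0) + (0, (snd c' \<circ> chart_inv c) (snd z))" if "z \<in> UNIV \<times> ?S" for z
    proof -
      have "chart_inv (lift_chart c) (fst z, snd z) = (fst z, chart_inv c (snd z))"
        by (rule lift_chart_inv[OF c(1)]) (use that in auto)
      then show ?thesis by (simp add: c c' snd_lift_chart)
    qed
    have "Ck_on k (UNIV \<times> ?S) (\<lambda>z::real\<times>'e. (snd c' \<circ> chart_inv c) (snd z))"
      by (rule Ck_on_compose_snd[OF op Ck_on_transition[OF c(1) c'(1)]])
    from Ck_on_bounded_linear_compose[OF opS _ this, of "\<lambda>x. (0::real, x)"]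
    have 2: "Ck_on k (UNIV \<times> ?S) (\<lambda>z::real\<times>'e. (0::real, (snd c' \<circ> chart_inv c) (snd z)))"
      by (simp add: bounded_linear_Pair bounded_linear_zero bounded_linear_ident)
    have 1: "Ck_on k (UNIV \<times> ?S) (\<lambda>z::real\<times>'e. (fst z, 0::'e))"
      by (intro Ck_on_bounded_linear bounded_linear_Pair bounded_linear_zero bounded_linear_fst)
    show "Ck_on k (UNIV \<times> ?S) (\<lambda>z::real\<times>'e. (fst z, 0::'e) + (0::real, (snd c' \<circ> chart_inv c) (snd z)))"
      by (rule Ck_on_add[OF opS 1 2])
  qed
  then show "smooth_on (snd C ` (fst C \<inter> fst C')) (snd C' \<circ> chart_inv C)"
    unfolding S smooth_on_open[OF opS] by blast
qed

end

definition liouville_form :: "('p, 'e::euclidean_space) manifold \<Rightarrow> ('p, 'e) one_form \<Rightarrow> (real \<times> 'p, real \<times> 'e) one_form" where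
  "liouville_form N \<alpha> z v = exp (fst z) * \<alpha> (snd z) (pushforward (symplectization N) N snd z v)"

lemma symplectization_form_eq: "symplectization_form N \<alpha> = ext_deriv (symplectization N) (liouville_form N \<alpha>)"
  by (simp add: symplectization_form_def liouville_form_def[abs_def])

context atlas_manifold
begin

lemma lift_trans_deriv:
  assumes c: "c \<in> charts_at M p" and c': "c' \<in> charts_at M p"
  shows "frechet_derivative (snd (lift_chart c') \<circ> chart_inv (lift_chart c)) (at (s, snd c p)) (\<sigma>, u) =
    (\<sigma>, trans_deriv c c' p u)"
proof -
  have cA: "c \<in> atlas M" "c' \<in> atlas M" "p \<in> fst c" "p \<in> fst c'" using c c' by (auto simp: charts_at_iff)
  have d: "((\<lambda>z. (snd c' \<circ> chart_inv c) (snd z)) has_derivative (\<lambda>w. trans_deriv c c' p (snd w))) (at (s, snd c p))"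
    by (rule has_derivative_compose[OF has_derivative_snd[OF has_derivative_ident]])
      (use transition_has_derivative[OF cA] in \<open>simp only: snd_conv\<close>)
  have "((snd (lift_chart c') \<circ> chart_inv (lift_chart c)) has_derivative (\<lambda>w. (fst w, trans_deriv c c' p (snd w))))
      (at (s, snd c p))"
  proof (rule has_derivative_transform_within_open[OF has_derivative_Pair[OF has_derivative_fst[OF has_derivative_ident] d]])
    show "open ((UNIV :: real set) \<times> snd c ` fst c)" using image_open[OF cA(1)] by (simp add: open_Times)
    show "(fst z, (snd c' \<circ> chart_inv c) (snd z)) = (snd (lift_chart c') \<circ> chart_inv (lift_chart c)) z"
      if "z \<in> UNIV \<times> snd c ` fst c" for z
      using lift_chart_inv[OF cA(1), of "snd z" "fst z"] that by (auto simp: snd_lift_chart)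
  qed (use cA in auto)
  then show ?thesis by (simp add: frechet_derivative_eqI)
qed

text \<open>\<open>pushforward\<close> computes in a chart of its own choice, the lift of some
  \<open>c1\<close> instead of \<open>c\<close>; the chain rule for transition maps removes
  \<open>c1\<close> from the result.\<close>

lemma pushforward_snd:
  assumes c: "c \<in> charts_at M p"
  shows "pushforward (symplectization M) M snd (s, p) (tangent_of (symplectization M) (s, p) (lift_chart c) (\<sigma>, u)) =
    tangent_of M p c u"
proof -
  interpret S: atlas_manifold "symplectization M" by (rule atlas_manifold_symplectization)
  have charts: "C \<in> charts_at (symplectization M) (s, p) \<longleftrightarrow> (\<exists>c\<in>charts_at M p. C = lift_chart c)" for C
    by (auto simp: S.charts_at_iff charts_at_iff atlas_symplectization fst_lift_chart)
  have "p \<in> points M" using c chart_subset unfolding charts_at_iff by blast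
  then have "chart_at (symplectization M) (s, p) \<in> charts_at (symplectization M) (s, p)"
    by (intro S.chart_at_in) (simp add: points_symplectization)
  then obtain c1 where c1: "c1 \<in> charts_at M p" "chart_at (symplectization M) (s, p) = lift_chart c1"
    unfolding charts by blast
  have c1A: "c1 \<in> atlas M" "p \<in> fst c1" using c1 by (auto simp: charts_at_iff)
  have "lift_chart c1 \<in> charts_at (symplectization M) (s, p)" using c1 charts by blast
  then have v: "tangent_of (symplectization M) (s, p) (lift_chart c) (\<sigma>, u) (lift_chart c1) = (\<sigma>, trans_deriv c c1 p u)"
    using lift_trans_deriv[OF c c1(1)] by (simp add: S.tangent_of_apply snd_lift_chart)
  have "frechet_derivative (snd c' \<circ> snd \<circ> chart_inv (lift_chart c1)) (at (snd (lift_chart c1) (s, p)))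
      (\<sigma>, trans_deriv c c1 p u) = trans_deriv c c' p u" if c': "c' \<in> charts_at M p" for c'
  proof -
    have c'A: "c' \<in> atlas M" "p \<in> fst c'" using c' by (auto simp: charts_at_iff)
    have d: "((\<lambda>z. (snd c' \<circ> chart_inv c1) (snd z)) has_derivative (\<lambda>w. trans_deriv c1 c' p (snd w))) (at (s, snd c1 p))"
      by (rule has_derivative_compose[OF has_derivative_snd[OF has_derivative_ident]])
        (use transition_has_derivative[OF c1A(1) c'A(1) c1A(2) c'A(2)] in \<open>simp only: snd_conv\<close>)
    have "((snd c' \<circ> snd \<circ> chart_inv (lift_chart c1)) has_derivative (\<lambda>w. trans_deriv c1 c' p (snd w))) (at (s, snd c1 p))"
    proof (rule has_derivative_transform_within_open[OF d])
      show "open ((UNIV :: real set) \<times> snd c1 ` fst c1)" using image_open[OF c1A(1)] by (simp add: open_Times)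
      show "(snd c' \<circ> chart_inv c1) (snd z) = (snd c' \<circ> snd \<circ> chart_inv (lift_chart c1)) z"
        if "z \<in> UNIV \<times> snd c1 ` fst c1" for z
        using lift_chart_inv[OF c1A(1), of "snd z" "fst z"] that by auto
    qed (use c1A in auto)
    then show ?thesis
      using trans_deriv_chain[OF c c1(1) c', of u] by (simp add: frechet_derivative_eqI snd_lift_chart)
  qed
  then show ?thesis
    unfolding pushforward_def Let_def c1(2) v by (intro ext) (simp add: tangent_of_def restrict_def)
qed

lemma local_liouville_form:
  assumes c: "c \<in> atlas M" and x: "x \<in> snd c ` fst c"
  shows "local_form (symplectization M) (liouville_form M \<alpha>) (lift_chart c) (s, x) w =
    exp s * local_form M \<alpha> c x (snd w)"
proof -
  have "c \<in> charts_at M (chart_inv c x)" using c chart_inv_in[OF x] by (simp add: charts_at_iff)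
  from pushforward_snd[OF this, of s "fst w" "snd w"] show ?thesis
    by (simp add: local_form_def lift_chart_inv[OF c x] liouville_form_def)
qed

lemma smooth_one_form_liouville:
  assumes \<alpha>: "smooth_one_form M \<alpha>"
  shows "smooth_one_form (symplectization M) (liouville_form M \<alpha>)"
  unfolding smooth_one_form_def
proof (intro ballI conjI allI)
  fix C assume "C \<in> atlas (symplectization M)"
  then obtain c where c: "c \<in> atlas M" "C = lift_chart c" by (auto simp: atlas_symplectization)
  interpret c: coordinate_form "snd c ` fst c" "local_form M \<alpha> c" by (rule coordinate_form_local[OF \<alpha> c(1)])
  have im: "snd C ` fst C = UNIV \<times> snd c ` fst c" by (simp add: c fst_lift_chart lift_chart_image)
  have op: "open ((UNIV :: real set) \<times> snd c ` fst c)" using c.open_V by (simp add: open_Times)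
  show "linear (local_form (symplectization M) (liouville_form M \<alpha>) C z)" if z: "z \<in> snd C ` fst C" for z
  proof -
    obtain s x where sx: "z = (s, x)" "x \<in> snd c ` fst c" using z unfolding im by auto
    have "linear (\<lambda>w. exp s * local_form M \<alpha> c x (snd w))"
      using linear_add[OF c.linear_form[OF sx(2)]] linear_scale[OF c.linear_form[OF sx(2)]]
      by (intro linearI) (simp_all add: algebra_simps)
    moreover have "local_form (symplectization M) (liouville_form M \<alpha>) C z = (\<lambda>w. exp s * local_form M \<alpha> c x (snd w))"
      unfolding c(2) sx(1) by (rule ext, rule local_liouville_form[OF c(1) sx(2)])
    ultimately show ?thesis by (simp only:)
  qed
  fix w :: "real \<times> 'e"
  have "Ck_on k (UNIV \<times> snd c ` fst c) (\<lambda>z. exp (fst z) * local_form M \<alpha> c (snd z) (snd w))" for k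
    by (intro Ck_on_mult[OF op] Ck_on_compose_snd[OF c.open_V c.smooth_form]
        Ck_on_compose[OF op open_UNIV Ck_on_bounded_linear[OF bounded_linear_fst] Ck_on_exp]) simp
  then have "Ck_on k (UNIV \<times> snd c ` fst c) (\<lambda>z. local_form (symplectization M) (liouville_form M \<alpha>) C z w)" for k
    by (subst Ck_on_cong[OF op, where g = "\<lambda>z. exp (fst z) * local_form M \<alpha> c (snd z) (snd w)"])
      (auto simp: c local_liouville_form)
  then show "smooth_on (snd C ` fst C) (\<lambda>z. local_form (symplectization M) (liouville_form M \<alpha>) C z w)"
    unfolding im smooth_on_open[OF op] by blast
qed

end

text \<open>In a lifted chart the form is \<open>e^s\<close> times the sum of the wedge product of
  \<open>ds\<close> with \<open>\<alpha>\<close> and of \<open>d\<alpha>\<close>. Non-degeneracy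
  follows by testing with three kinds of vectors; \<open>(1, 0)\<close> is
  \<open>\<partial>_s\<close>.\<close>

lemma exact_chart_liouville:
  assumes contact: "contact_manifold N \<alpha>" and c: "c \<in> atlas N"
  shows "exact_chart (UNIV \<times> snd c ` fst c)
    (local_form (symplectization N) (liouville_form N \<alpha>) (lift_chart c)) (1, 0)"
proof -
  have \<alpha>: "smooth_one_form N \<alpha>" and nondeg: "\<And>p. p \<in> points N \<Longrightarrow>
     (\<exists>v\<in>tangent_space N p. \<alpha> p v \<noteq> 0) \<and> (\<forall>v\<in>tangent_space N p. \<alpha> p v = 0 \<longrightarrow>
           (\<forall>w\<in>tangent_space N p. \<alpha> p w = 0 \<longrightarrow> ext_deriv N \<alpha> p v w = 0) \<longrightarrow> v = zero_tangent N p)"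
    and sm: "smooth_manifold N"
    using contact unfolding contact_manifold_def by auto
  interpret N: atlas_manifold N by (rule smooth_manifold_imp_atlas_manifold[OF sm])
  interpret S: atlas_manifold "symplectization N" by (rule N.atlas_manifold_symplectization)
  interpret c: coordinate_form "snd c ` fst c" "local_form N \<alpha> c" by (rule N.coordinate_form_local[OF \<alpha> c])
  let ?V = "UNIV \<times> snd c ` fst c :: (real \<times> 'b) set"
  let ?a = "local_form N \<alpha> c"
  let ?B = "local_form (symplectization N) (liouville_form N \<alpha>) (lift_chart c)"
  have V: "snd (lift_chart c) ` fst (lift_chart c) = ?V" by (simp add: fst_lift_chart lift_chart_image)
  have op: "open ?V" using c.open_V by (simp add: open_Times)
  have B: "?B (s, x) w = exp s * ?a x (snd w)" if "x \<in> snd c ` fst c" for s x w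
    by (rule N.local_liouville_form[OF c that])
  have cS: "lift_chart c \<in> atlas (symplectization N)" using c by (simp add: atlas_symplectization)
  have 1: "coordinate_form ?V ?B"
    using S.coordinate_form_local[OF N.smooth_one_form_liouville[OF \<alpha>] cS] unfolding V .
  have fd: "form_deriv ?B (s, x) (\<sigma>, u) (\<tau>, w) = exp s * (\<sigma> * ?a x w + form_deriv ?a x u w)"
    if x: "x \<in> snd c ` fst c" for s x \<sigma> u \<tau> w
  proof -
    have "((\<lambda>z. exp (fst z) * ?a (snd z) w) has_derivative
       (\<lambda>v. exp (fst (s, x)) * form_deriv ?a x (snd v) w + exp s * fst v * ?a (snd (s, x)) w)) (at (s, x))"
    proof (rule has_derivative_mult)
      show "((\<lambda>z::real\<times>'b. exp (fst z)) has_derivative (\<lambda>v. exp s * fst v)) (at (s, x))"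
        by (auto intro!: derivative_eq_intros)
      show "((\<lambda>z::real\<times>'b. ?a (snd z) w) has_derivative (\<lambda>v. form_deriv ?a x (snd v) w)) (at (s, x))"
        by (rule has_derivative_compose[OF has_derivative_snd[OF has_derivative_ident]])
          (use c.form_has_derivative[OF x] in simp)
    qed
    then have "((\<lambda>z. ?B z (\<tau>, w)) has_derivative
       (\<lambda>v. exp (fst (s, x)) * form_deriv ?a x (snd v) w + exp s * fst v * ?a (snd (s, x)) w)) (at (s, x))"
      by (rule has_derivative_transform_within_open[OF _ op]) (use x B in auto)
    then show ?thesis by (simp add: form_deriv_def frechet_derivative_eqI algebra_simps)
  qed
  have fe: "form_ext ?B (s, x) (\<sigma>, u) (\<tau>, w) = exp s * (\<sigma> * ?a x w - \<tau> * ?a x u + form_ext ?a x u w)"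
    if x: "x \<in> snd c ` fst c" for s x \<sigma> u \<tau> w
    by (simp add: form_ext_def fd[OF x] algebra_simps)
  show ?thesis
  proof (rule exact_chart.intro[OF 1 exact_chart_axioms.intro])
    fix z u assume z: "z \<in> ?V" and W0: "\<And>w. form_ext ?B z u w = 0"
    obtain s x \<sigma> u' where sx: "z = (s, x)" "u = (\<sigma>, u')" "x \<in> snd c ` fst c" using z by (cases z, cases u) auto
    define p where "p = chart_inv c x"
    have p: "c \<in> charts_at N p" "snd c p = x" "p \<in> points N"
      using sx(3) c N.chart_inv_in[OF sx(3)] N.chart_subset[OF c] by (auto simp: p_def N.charts_at_iff)
    have W0': "\<sigma> * ?a x w - \<tau> * ?a x u' + form_ext ?a x u' w = 0" for \<tau> w
      using W0[of "(\<tau>, w)"] unfolding sx fe[OF sx(3)] by simp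
    \<comment> \<open>Testing with \<open>\<partial>_s\<close> shows that \<open>u'\<close> lies in
      the contact hyperplane.\<close>
    have au: "?a x u' = 0"
      using W0'[of 0 1] linear_0[OF c.linear_form[OF sx(3)]] linear_0[OF c.linear_W2[OF sx(3)]] by simp
    have \<alpha>a: "\<alpha> p v = ?a x (v c)" if "v \<in> tangent_space N p" for v
      using N.tangent_of_coordinates[OF that p(1)] by (simp add: local_form_def p_def)
    let ?v = "tangent_of N p c u'"
    have v: "?v \<in> tangent_space N p" "?v c = u'"
      by (rule N.tangent_of_in[OF p(1)], rule N.tangent_of_self[OF p(1)])
    \<comment> \<open>Testing with vectors of the contact hyperplane, where the terms with
      \<open>\<alpha>\<close> drop out.\<close>
    have "ext_deriv N \<alpha> p ?v w = 0" if w: "w \<in> tangent_space N p" "\<alpha> p w = 0" for w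
      using W0'[of "w c" 0] \<alpha>a[OF w(1)] w(2) by (simp add: N.ext_deriv_eq[OF \<alpha> p(1) v(1) w(1)] p(2) v(2))
    moreover have "\<alpha> p ?v = 0" using \<alpha>a[OF v(1)] v(2) au by simp
    ultimately have "?v = zero_tangent N p" using nondeg[OF p(3)] v(1) by blast
    then have u0: "u' = 0" using v(2) N.zero_tangent_eq[OF p(1)] N.tangent_of_self[OF p(1), of 0] by simp
    \<comment> \<open>A vector transverse to the hyperplane finally detects
      \<open>\<sigma>\<close>.\<close>
    obtain v' where v': "v' \<in> tangent_space N p" "\<alpha> p v' \<noteq> 0" using nondeg[OF p(3)] by blast
    then have "\<sigma> = 0"
      using W0'[of "v' c" 0] \<alpha>a[OF v'(1)] linear_0[OF c.linear_W1[OF sx(3)]] by (simp add: u0)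
    with u0 sx show "u = 0" by (simp add: zero_prod_def)
  next
    fix z :: "real \<times> 'b" and r assume "z \<in> ?V"
    then show "z + r *\<^sub>R (1, 0) \<in> ?V" by (cases z) auto
  next
    fix z :: "real \<times> 'b" and r u assume "z \<in> ?V"
    then show "?B (z + r *\<^sub>R (1, 0)) u = exp r * ?B z u" by (cases z) (auto simp: B exp_add)
  next
    fix z :: "real \<times> 'b" assume "z \<in> ?V"
    then show "?B z (1, 0) = 0"
      using linear_0[OF c.linear_form] by (cases z) (auto simp: B)
  qed
qed

section \<open>Hamiltonian flows supported in a chart\<close>

lemma smooth_on_cong: "smooth_on S f \<Longrightarrow> (\<And>x. x \<in> S \<Longrightarrow> f x = g x) \<Longrightarrow> smooth_on S g"
  unfolding smooth_on_def by (intro ballI, drule bspec, assumption) auto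

section \<open>Extension of maps and Hamiltonians from a chart to the manifold\<close>

definition lift_map :: "('p, 'e) manifold \<Rightarrow> ('p, 'e) chart \<Rightarrow> ('e \<Rightarrow> 'e) \<Rightarrow> 'p \<Rightarrow> 'p" where
  "lift_map M c f = (\<lambda>p\<in>points M. if p \<in> fst c then chart_inv c (f (snd c p)) else p)"

text \<open>The path of functions is constant in time. Both lifts are restricted to the carrier
  because \<open>Diff\<close> and \<open>Ham\<close> consist of extensional functions.\<close>

definition lift_ham :: "('p, 'e) manifold \<Rightarrow> ('p, 'e) chart \<Rightarrow> ('e \<Rightarrow> real) \<Rightarrow> real \<times> 'p \<Rightarrow> real" where
  "lift_ham M c g = (\<lambda>(t, p)\<in>{0..1} \<times> points M. if p \<in> fst c then g (snd c p) else 0)"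

locale exact_manifold = atlas_manifold M
  for M :: "('p, 'e::euclidean_space) manifold" +
  fixes \<beta> :: "('p, 'e) one_form"
  assumes smooth_one_form: "smooth_one_form M \<beta>"
    and nondegenerate_form: "c \<in> atlas M \<Longrightarrow> x \<in> snd c ` fst c \<Longrightarrow>
      (\<And>w. form_ext (local_form M \<beta> c) x u w = 0) \<Longrightarrow> u = 0"
begin

text \<open>\<open>ham_field\<close> is a definite description: existence is verified in one chart,
  and uniqueness is non-degeneracy.\<close>

lemma ham_field_eq:
  assumes c: "c \<in> charts_at M p" and h: "((h \<circ> chart_inv c) has_derivative D) (at (snd c p))"
    and Y: "\<And>w. form_ext (local_form M \<beta> c) (snd c p) Y w = D w"
  shows "ham_field M (ext_deriv M \<beta>) h p = tangent_of M p c Y"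
  unfolding ham_field_def
proof (rule the_equality)
  have cA: "c \<in> atlas M" "snd c p \<in> snd c ` fst c" using c by (auto simp: charts_at_iff)
  interpret c: coordinate_form "snd c ` fst c" "local_form M \<beta> c"
    by (rule coordinate_form_local[OF smooth_one_form cA(1)])
  show "tangent_of M p c Y \<in> tangent_space M p \<and>
      (\<forall>w\<in>tangent_space M p. differential M h p w = ext_deriv M \<beta> p (tangent_of M p c Y) w)"
    using tangent_of_in[OF c]
    by (simp add: differential_eq[OF _ c h] ext_deriv_eq[OF smooth_one_form c] tangent_of_self[OF c] Y)
  fix v assume v: "v \<in> tangent_space M p \<and> (\<forall>w\<in>tangent_space M p. differential M h p w = ext_deriv M \<beta> p v w)"
  have "form_ext (local_form M \<beta> c) (snd c p) (v c - Y) u = 0" for u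
  proof -
    have T: "tangent_of M p c u \<in> tangent_space M p" by (rule tangent_of_in[OF c])
    then have "differential M h p (tangent_of M p c u) = ext_deriv M \<beta> p v (tangent_of M p c u)" using v by blast
    then have "D u = form_ext (local_form M \<beta> c) (snd c p) (v c) u"
      using v T by (simp add: differential_eq[OF _ c h] ext_deriv_eq[OF smooth_one_form c] tangent_of_self[OF c])
    then show ?thesis
      using linear_diff[OF c.linear_W1[OF cA(2)], of "v c" Y u] Y[of u] by simp
  qed
  then have "v c = Y" using nondegenerate_form[OF cA, of "v c - Y"] by simp
  then show "v = tangent_of M p c Y"
    using tangent_of_coordinates[of v p c] v c by simp
qed

end

locale lifted_flow = exact_manifold M \<beta> + F: compact_hamiltonian_flow "snd C ` fst C" "local_form M \<beta> C" e g X K \<Phi> \<Psi>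
  for M :: "('p, 'e::euclidean_space) manifold" and \<beta> and C :: "('p, 'e) chart" and e g X K \<Phi> \<Psi> +
  assumes C: "C \<in> atlas M"
begin

definition "KM = chart_inv C ` K"

lemma KM_iff: "p \<in> KM \<longleftrightarrow> p \<in> fst C \<and> snd C p \<in> K"
proof
  assume "p \<in> KM"
  then obtain x where "x \<in> K" "p = chart_inv C x" by (auto simp: KM_def)
  then show "p \<in> fst C \<and> snd C p \<in> K"
    using F.K(2) chart_inv_in[of x C] chart_inv_right[of x C] by auto
next
  assume "p \<in> fst C \<and> snd C p \<in> K"
  then show "p \<in> KM" unfolding KM_def using chart_inv_left[OF C] by (metis image_eqI)
qed

text \<open>A compact set in a Hausdorff space is closed. The chart domain and this complement thus
  form an open cover of the manifold; lifted objects are given by coordinates on the first set and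
  trivial on the second, and the gluing arguments below rest on this.\<close>

lemma open_complement_KM: "openin (man_top M) (points M - KM)"
proof -
  have "compactin (top_of_set (snd C ` fst C)) K"
    using F.K by (simp add: compactin_subtopology)
  then have "compactin (man_top M) KM"
    unfolding KM_def using continuous_chart_inv[OF C] image_compactin by blast
  then have "closedin (man_top M) KM" by (rule compactin_imp_closedin[OF hausdorff])
  then show ?thesis by (simp add: openin_diff)
qed

lemma lift_ham_eq:
  assumes "c \<in> atlas M" "t \<in> {0..1}" "p \<in> fst c"
  shows "lift_ham M C g (t, p) = (if p \<in> fst C then g (snd C p) else 0)"
proof -
  have "p \<in> points M" using assms(3) chart_subset[OF assms(1)] by blast
  then show ?thesis using assms(2) by (simp add: lift_ham_def)
qed

lemma Ck_on_lift_ham: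
  assumes c: "c \<in> atlas M" and t: "t \<in> {0..1}"
  shows "Ck_on k (snd c ` fst c) (\<lambda>x. lift_ham M C g (t, chart_inv c x))"
proof (rule Ck_on_local)
  fix x assume "x \<in> snd c ` fst c"
  then obtain p where p: "p \<in> fst c" "x = snd c p" by blast
  show "\<exists>V. open V \<and> x \<in> V \<and> Ck_on k V (\<lambda>x. lift_ham M C g (t, chart_inv c x))"
  proof (cases "p \<in> fst C")
    case True
    let ?S = "snd c ` (fst c \<inter> fst C)"
    have S: "open ?S" by (rule open_chart_image[OF c chart_open[OF C]])
    have "Ck_on k ?S (\<lambda>x. g ((snd C \<circ> chart_inv c) x))"
      by (rule Ck_on_compose[OF S open_UNIV Ck_on_transition[OF c C] F.g(1)]) simp
    then have "Ck_on k ?S (\<lambda>x. lift_ham M C g (t, chart_inv c x))"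
      by (subst Ck_on_cong[OF S, where g = "\<lambda>x. g ((snd C \<circ> chart_inv c) x)"])
        (use c in \<open>auto simp: lift_ham_eq[OF c t]\<close>)
    with S p True show ?thesis by (intro exI[of _ ?S]) auto
  next
    case False
    let ?S = "snd c ` (fst c \<inter> (points M - KM))"
    have S: "open ?S" by (rule open_chart_image[OF c open_complement_KM])
    have "lift_ham M C g (t, chart_inv c x) = 0" if "x \<in> ?S" for x
      using that c F.g(2) by (auto simp: lift_ham_eq[OF c t] KM_iff)
    then have "Ck_on k ?S (\<lambda>x. lift_ham M C g (t, chart_inv c x))"
      using Ck_on_cong[OF S, of "\<lambda>x. lift_ham M C g (t, chart_inv c x)" "\<lambda>_. 0"] by simp
    moreover have "p \<in> points M - KM" using False p chart_subset[OF c] by (auto simp: KM_iff)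
    ultimately show ?thesis using S p by (intro exI[of _ ?S]) auto
  qed
qed

abbreviation H_field :: "real \<Rightarrow> 'p \<Rightarrow> ('p, 'e) tangent" where
  "H_field t \<equiv> ham_field M (ext_deriv M \<beta>) (\<lambda>q. lift_ham M C g (t, q))"

lemma H_field_inside:
  assumes p: "p \<in> fst C" and t: "t \<in> {0..1}"
  shows "H_field t p = tangent_of M p C (X (snd C p))"
proof (rule ham_field_eq)
  have dg: "(g has_derivative frechet_derivative g (at (snd C p))) (at (snd C p))"
    using Ck_on_has_derivative[OF F.g(1)[of "Suc 0"]] by simp
  show "((\<lambda>q. lift_ham M C g (t, q)) \<circ> chart_inv C has_derivative frechet_derivative g (at (snd C p))) (at (snd C p))"
    by (rule has_derivative_transform_within_open[OF dg image_open[OF C]])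
      (use p C chart_inv_in[of _ C] in \<open>auto simp: lift_ham_eq[OF C t]\<close>)
qed (use p C F.ham in \<open>auto simp: charts_at_iff\<close>)

lemma H_field_outside:
  assumes p: "p \<in> points M - KM" and t: "t \<in> {0..1}" and c: "c \<in> charts_at M p"
  shows "H_field t p = tangent_of M p c 0"
proof (rule ham_field_eq[OF c])
  have cA: "c \<in> atlas M" "p \<in> fst c" using c by (auto simp: charts_at_iff)
  interpret c: coordinate_form "snd c ` fst c" "local_form M \<beta> c"
    by (rule coordinate_form_local[OF smooth_one_form cA(1)])
  show "((\<lambda>q. lift_ham M C g (t, q)) \<circ> chart_inv c has_derivative (\<lambda>w. 0)) (at (snd c p))"
    by (rule has_derivative_transform_within_open[OF has_derivative_const open_chart_image[OF cA(1) open_complement_KM]])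
      (use cA p F.g(2) in \<open>auto simp: lift_ham_eq[OF cA(1) t] KM_iff\<close>)
  show "form_ext (local_form M \<beta> c) (snd c p) 0 w = 0" for w
    using linear_0[OF c.linear_W1] cA by simp
qed

text \<open>\<open>Y\<close> is Lipschitz on the whole model space, as \<open>ode_unique\<close>
  demands: it is \<open>X\<close> in the chart \<open>C\<close>, and 0 away from
  \<open>KM\<close>.\<close>

lemma local_lipschitz_chart:
  assumes q: "q \<in> points M"
  obtains c U Y L where "c \<in> atlas M" "openin (man_top M) U" "q \<in> U" "U \<subseteq> fst c" "L \<ge> 0"
    "\<And>x x'. norm (Y x - Y x') \<le> L * norm (x - x' :: 'e)"
    "\<And>t q'. t \<in> {0..1} \<Longrightarrow> q' \<in> U \<Longrightarrow> H_field t q' c = (Y (snd c q') :: 'e)"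
proof (cases "q \<in> fst C")
  case True
  obtain L where L: "L \<ge> 0" "\<forall>x y. norm (X x - X y) \<le> L * norm (x - y)"
    using F.X_lipschitz by blast
  show thesis
  proof (rule that[of C "fst C" L X])
    show "H_field t q' C = X (snd C q')" if "t \<in> {0..1}" "q' \<in> fst C" for t q'
      using that C by (simp add: H_field_inside tangent_of_self charts_at_iff)
  qed (use C True L chart_open in auto)
next
  case False
  obtain c where c: "c \<in> charts_at M q" using points_charts_at[OF q] by blast
  then have cA: "c \<in> atlas M" "q \<in> fst c" by (auto simp: charts_at_iff)
  show thesis
  proof (rule that[of c "fst c \<inter> (points M - KM)" 0 "\<lambda>_. 0"])
    show "H_field t q' c = 0" if "t \<in> {0..1}" "q' \<in> fst c \<inter> (points M - KM)" for t q'
      using that cA by (simp add: H_field_outside[of q' t c] tangent_of_self charts_at_iff)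
    show "q \<in> fst c \<inter> (points M - KM)" using q cA False by (simp add: KM_iff)
    show "openin (man_top M) (fst c \<inter> (points M - KM))"
      by (rule openin_Int[OF chart_open[OF cA(1)] open_complement_KM])
  qed (use cA in auto)
qed

lemma openin_interval_subset:
  assumes "openin (top_of_set {0..1::real}) T" "t0 \<in> T"
  shows "\<exists>r>0. \<forall>t\<in>{0..1}. \<bar>t - t0\<bar> \<le> r \<longrightarrow> t \<in> T"
proof -
  obtain r where r: "r > 0" "\<And>t. t \<in> {0..1} \<Longrightarrow> dist t t0 < r \<Longrightarrow> t \<in> T"
    using assms unfolding openin_euclidean_subtopology_iff by blast
  then show ?thesis by (intro exI[of _ "r / 2"]) (auto simp: dist_real_def)
qed

text \<open>The times at which the curves agree form a closed set by the Hausdorff property and an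
  open one by \<open>ode_unique\<close> in a chart; the interval is connected.\<close>

lemma integral_curve_unique:
  assumes \<gamma>: "integral_curve M H_field {0..1} \<gamma>" and \<delta>: "integral_curve M H_field {0..1} \<delta>"
    and eq0: "\<gamma> 0 = \<delta> 0" and t: "t \<in> {0..1}"
  shows "\<gamma> t = \<delta> t"
proof -
  let ?I = "{0..1::real}"
  define E where "E = {t \<in> ?I. \<gamma> t = \<delta> t}"
  have c\<gamma>: "continuous_map (top_of_set ?I) (man_top M) \<gamma>" and c\<delta>: "continuous_map (top_of_set ?I) (man_top M) \<delta>"
    using \<gamma> \<delta> by (auto simp: integral_curve_def)
  have "closedin (top_of_set ?I) E"
    using closedin_continuous_maps_eq[OF hausdorff c\<gamma> c\<delta>] by (simp add: E_def)
  moreover have "openin (top_of_set ?I) E"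
    unfolding openin_euclidean_subtopology_iff
  proof (intro conjI ballI)
    fix t0 assume "t0 \<in> E"
    then have t0: "t0 \<in> ?I" "\<gamma> t0 = \<delta> t0" by (auto simp: E_def)
    have "\<gamma> ` ?I \<subseteq> points M" using continuous_map_image_subset_topspace[OF c\<gamma>] by simp
    then have "\<gamma> t0 \<in> points M" using t0(1) by (rule subsetD[OF _ imageI])
    then obtain c U Y L where cA: "c \<in> atlas M" and U: "openin (man_top M) U" "\<gamma> t0 \<in> U" "U \<subseteq> fst c" and L: "L \<ge> 0"
      "\<And>x x'. norm (Y x - Y x') \<le> L * norm (x - x' :: 'e)"
      and Y: "\<And>t q'. t \<in> {0..1} \<Longrightarrow> q' \<in> U \<Longrightarrow> H_field t q' c = (Y (snd c q') :: 'e)"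
      by (rule local_lipschitz_chart) blast
    have "openin (top_of_set ?I) {t \<in> topspace (top_of_set ?I). \<gamma> t \<in> U}"
      "openin (top_of_set ?I) {t \<in> topspace (top_of_set ?I). \<delta> t \<in> U}"
      using openin_continuous_map_preimage[OF c\<gamma> U(1)] openin_continuous_map_preimage[OF c\<delta> U(1)] .
    from openin_Int[OF this] obtain r where r: "r > 0"
      "\<And>t. t \<in> ?I \<Longrightarrow> \<bar>t - t0\<bar> \<le> r \<Longrightarrow> \<gamma> t \<in> U \<and> \<delta> t \<in> U"
      using openin_interval_subset[of _ t0] t0 U(2) by (metis (no_types, lifting) Int_iff mem_Collect_eq topspace_euclidean_subtopology)
    \<comment> \<open>Short enough that both curves stay in \<open>U\<close> and that
      \<open>ode_unique\<close> applies on an interval of length at most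
      \<open>2 * s\<close>.\<close>
    define s where "s = min r (1 / (4 * L + 1))"
    have s: "s > 0" "s \<le> r" using r L by (auto simp: s_def)
    have Ls: "L * (2 * s) \<le> 1/2"
    proof -
      have "L * (2 * s) \<le> L * (2 * (1 / (4 * L + 1)))" using L(1) by (intro mult_left_mono) (auto simp: s_def)
      also have "\<dots> \<le> 1/2" using L(1) by (simp add: field_simps)
      finally show ?thesis .
    qed
    define a b where "a = max 0 (t0 - s)" and "b = min 1 (t0 + s)"
    have ab: "{a..b} \<subseteq> ?I" "t0 \<in> {a..b}" using s t0 by (auto simp: a_def b_def)
    have inU: "\<gamma> t \<in> U" "\<delta> t \<in> U" if "t \<in> {a..b}" for t
      using r(2)[of t] that s(2) ab by (auto simp: a_def b_def)
    have curve: "((\<lambda>s. snd c (\<zeta> s)) has_vector_derivative Y (snd c (\<zeta> t))) (at t within {a..b})"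
      if \<zeta>: "integral_curve M H_field ?I \<zeta>" "\<And>t. t \<in> {a..b} \<Longrightarrow> \<zeta> t \<in> U" and t: "t \<in> {a..b}" for \<zeta> t
    proof -
      have tI: "t \<in> ?I" using ab t by blast
      have "c \<in> charts_at M (\<zeta> t)" using cA U(3) \<zeta>(2)[OF t] by (auto simp: charts_at_iff)
      then have "((\<lambda>s. snd c (\<zeta> s)) has_vector_derivative H_field t (\<zeta> t) c) (at t within ?I)"
        using \<zeta>(1) tI unfolding integral_curve_def by blast
      then show ?thesis
        unfolding Y[OF tI \<zeta>(2)[OF t]] by (rule has_vector_derivative_within_subset[OF _ ab(1)])
    qed
    have eq: "\<gamma> t = \<delta> t" if t: "t \<in> {a..b}" for t
    proof -
      have "snd c (\<gamma> t) = snd c (\<delta> t)"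
      proof (rule ode_unique[where X = Y and K = L and a = a and b = b and ?t0.0 = t0
            and y = "\<lambda>t. snd c (\<gamma> t)" and z = "\<lambda>t. snd c (\<delta> t)"])
        show "L * (b - a) \<le> 1/2"
          using order_trans[OF mult_left_mono[of "b - a" "2 * s" L] Ls] L(1) by (auto simp: a_def b_def)
      qed (use curve[OF \<gamma> inU(1)] curve[OF \<delta> inU(2)] L ab t t0 in auto)
      then show ?thesis
        using inj_onD[OF chart_inj[OF cA]] inU[OF t] U(3) by blast
    qed
    have "t \<in> E" if t: "t \<in> ?I" "dist t t0 < s" for t
    proof -
      have "\<bar>t - t0\<bar> < s" using t(2) by (simp add: dist_real_def)
      then have "t \<in> {a..b}" using t(1) by (auto simp: a_def b_def)
      from eq[OF this] t(1) show ?thesis by (simp add: E_def)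
    qed
    then show "\<exists>e>0. \<forall>x'\<in>?I. dist x' t0 < e \<longrightarrow> x' \<in> E" using s(1) by blast
  qed (auto simp: E_def)
  moreover have "connected ?I" by simp
  ultimately have "E = {} \<or> E = ?I" unfolding connected_clopen by blast
  moreover have "0 \<in> E" using eq0 by (simp add: E_def)
  ultimately have "t \<in> E" using t by blast
  then show ?thesis by (simp add: E_def)
qed

lemma lift_curve:
  assumes p: "p \<in> points M"
  shows "integral_curve M H_field {0..1} (\<lambda>t. lift_map M C (\<Phi> t) p)"
proof (cases "p \<in> fst C")
  case True
  let ?x = "snd C p"
  have V: "\<Phi> t ?x \<in> snd C ` fst C" if "t \<in> {0..1}" for t
    using F.\<Phi>_in_V[OF that] True by auto
  have eq: "lift_map M C (\<Phi> t) p = chart_inv C (\<Phi> t ?x)" for t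
    using True p by (simp add: lift_map_def)
  show ?thesis
    unfolding integral_curve_def eq
  proof (intro conjI ballI)
    have "continuous_on {0..1} (\<lambda>t. \<Phi> t ?x)"
      by (rule continuous_on_vector_derivative[OF F.\<Phi>_deriv])
    then have "continuous_map (top_of_set {0..1}) (top_of_set (snd C ` fst C)) (\<lambda>t. \<Phi> t ?x)"
      using V by (auto simp: continuous_map_in_subtopology)
    from continuous_map_compose[OF this continuous_chart_inv[OF C]]
    show "continuous_map (top_of_set {0..1}) (man_top M) (\<lambda>t. chart_inv C (\<Phi> t ?x))"
      by (simp add: o_def)
    fix t :: real and c assume t: "t \<in> {0..1}" and c: "c \<in> charts_at M (chart_inv C (\<Phi> t ?x))"
    let ?q = "chart_inv C (\<Phi> t ?x)"
    have q: "?q \<in> fst C" "snd C ?q = \<Phi> t ?x" using chart_inv_in[OF V[OF t]] chart_inv_right[OF V[OF t]] .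
    have "((snd c \<circ> chart_inv C) has_derivative trans_deriv C c ?q) (at (\<Phi> t ?x))"
      using transition_has_derivative[OF C, of c ?q] c q by (simp add: charts_at_iff)
    from vector_derivative_diff_chain_within[OF F.\<Phi>_deriv[OF t] has_derivative_at_withinI[OF this]]
    show "((\<lambda>s. snd c (chart_inv C (\<Phi> s ?x))) has_vector_derivative H_field t ?q c) (at t within {0..1})"
      unfolding H_field_inside[OF q(1) t] tangent_of_apply[OF c] q(2) by (simp add: o_def)
  qed
next
  case False
  have eq: "lift_map M C (\<Phi> t) p = p" for t using False p by (simp add: lift_map_def)
  have pK: "p \<in> points M - KM" using p False by (simp add: KM_iff)
  show ?thesis
    unfolding integral_curve_def eq using p
    by (auto simp: H_field_outside[OF pK] tangent_of_self)
qed

lemma lift_map_inverse: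
  assumes "\<And>x. x \<in> snd C ` fst C \<Longrightarrow> f x \<in> snd C ` fst C" "\<And>x. f' (f x) = x" "p \<in> points M"
  shows "lift_map M C f' (lift_map M C f p) = p"
proof (cases "p \<in> fst C")
  case True
  then have V: "f (snd C p) \<in> snd C ` fst C" using assms(1) by blast
  have "chart_inv C (f (snd C p)) \<in> fst C" using chart_inv_in[OF V] .
  moreover have "chart_inv C (f (snd C p)) \<in> points M" using calculation chart_subset[OF C] by blast
  ultimately show ?thesis
    using True assms(2,3) chart_inv_right[OF V] C by (simp add: lift_map_def)
qed (use assms(3) in \<open>simp add: lift_map_def\<close>)

lemma lift_map_in_points:
  assumes "\<And>x. x \<in> snd C ` fst C \<Longrightarrow> f x \<in> snd C ` fst C" "p \<in> points M"
  shows "lift_map M C f p \<in> points M"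
proof (cases "p \<in> fst C")
  case True
  then have "f (snd C p) \<in> snd C ` fst C" using assms(1) by blast
  from subsetD[OF chart_subset[OF C] chart_inv_in[OF this]]
  show ?thesis using True assms(2) by (simp add: lift_map_def)
qed (use assms(2) in \<open>simp add: lift_map_def\<close>)

lemma smooth_map_lift_map:
  assumes f: "\<And>k. Ck_on k UNIV f" and V: "\<And>x. x \<in> snd C ` fst C \<Longrightarrow> f x \<in> snd C ` fst C"
    and out: "\<And>x. x \<notin> K \<Longrightarrow> f x = x"
  shows "smooth_map M M (lift_map M C f)"
proof -
  let ?F = "lift_map M C f"
  have F_in: "?F p = chart_inv C (f (snd C p))" "?F p \<in> fst C" "snd C (?F p) = f (snd C p)" if p: "p \<in> fst C" for p
  proof -
    have fV: "f (snd C p) \<in> snd C ` fst C" using V p by blast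
    show "?F p = chart_inv C (f (snd C p))" using p chart_subset[OF C] by (auto simp: lift_map_def)
    then show "?F p \<in> fst C" "snd C (?F p) = f (snd C p)"
      using chart_inv_in[OF fV] chart_inv_right[OF fV] by auto
  qed
  have F_out: "?F p = p" if p: "p \<in> points M - KM" for p
    using p out C by (auto simp: lift_map_def KM_iff)
  have cont: "continuous_map (man_top M) (man_top M) ?F"
  proof (rule pasting_lemma[where I = UNIV and T = "\<lambda>b. if b then fst C else points M - KM" and f = "\<lambda>_. ?F"])
    fix b :: bool
    show "openin (man_top M) (if b then fst C else points M - KM)"
      using chart_open[OF C] open_complement_KM by simp
    show "continuous_map (subtopology (man_top M) (if b then fst C else points M - KM)) (man_top M) ?F"
    proof (cases b)
      case True
      have "continuous_map (subtopology (man_top M) (fst C)) (top_of_set (snd C ` fst C)) (f \<circ> snd C)"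
      proof -
        have "continuous_map euclidean euclidean f" using Ck_on_imp_continuous_on[OF f[of 0]] by simp
        from continuous_map_compose[OF continuous_chart[OF C] this]
        show ?thesis using V by (auto simp: continuous_map_in_subtopology)
      qed
      from continuous_map_compose[OF this continuous_chart_inv[OF C]]
      have "continuous_map (subtopology (man_top M) (fst C)) (man_top M) ?F"
        by (rule continuous_map_eq) (use F_in in auto)
      then show ?thesis using True by simp
    next
      case False
      have "continuous_map (subtopology (man_top M) (points M - KM)) (man_top M) ?F"
        by (rule continuous_map_eq[OF continuous_map_id_subt]) (use F_out in auto)
      then show ?thesis using False by simp
    qed
  next
    fix p assume "p \<in> points M"
    then show "\<exists>b. b \<in> UNIV \<and> p \<in> (if b then fst C else points M - KM) \<and> ?F p = ?F p"
      by (intro exI[of _ "p \<in> fst C"]) (auto simp: KM_iff)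
  qed simp
  have "smooth_on (snd c ` {p \<in> fst c. ?F p \<in> fst c'}) (snd c' \<circ> ?F \<circ> chart_inv c)"
    if c: "c \<in> atlas M" and c': "c' \<in> atlas M" for c c'
  proof -
    have "openin (man_top M) {p \<in> topspace (man_top M). ?F p \<in> fst c'}"
      by (rule openin_continuous_map_preimage[OF cont chart_open[OF c']])
    then have pre: "openin (man_top M) (U \<inter> {p \<in> points M. ?F p \<in> fst c'})" if "openin (man_top M) U" for U
      using that by (simp add: openin_Int)
    have "{p \<in> fst c. ?F p \<in> fst c'} = fst c \<inter> {p \<in> points M. ?F p \<in> fst c'}"
      using chart_subset[OF c] by blast
    then have S: "open (snd c ` {p \<in> fst c. ?F p \<in> fst c'})"
      using open_chart_image[OF c pre[OF openin_topspace]] by (metis Int_Collect inf.absorb_iff2 Collect_subset)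
    have "Ck_on k (snd c ` {p \<in> fst c. ?F p \<in> fst c'}) (snd c' \<circ> ?F \<circ> chart_inv c)" for k
    proof (rule Ck_on_local)
      fix x assume "x \<in> snd c ` {p \<in> fst c. ?F p \<in> fst c'}"
      then obtain p where p: "p \<in> fst c" "?F p \<in> fst c'" "x = snd c p" by blast
      have pM: "p \<in> points M" using p chart_subset[OF c] by blast
      show "\<exists>V. open V \<and> x \<in> V \<and> Ck_on k V (snd c' \<circ> ?F \<circ> chart_inv c)"
      proof (cases "p \<in> fst C")
        case True
        let ?A = "snd c ` (fst c \<inter> (fst C \<inter> {p \<in> points M. ?F p \<in> fst c'}))"
        have A: "open ?A" by (rule open_chart_image[OF c pre[OF chart_open[OF C]]])
        have B: "open (snd C ` (fst C \<inter> fst c'))" by (rule open_chart_image[OF C chart_open[OF c']])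
        have 1: "Ck_on k ?A (snd C \<circ> chart_inv c)"
          by (rule Ck_on_subset[OF Ck_on_transition[OF c C]]) blast
        have 2: "Ck_on k ?A (\<lambda>x. f ((snd C \<circ> chart_inv c) x))"
          by (rule Ck_on_compose[OF A open_UNIV 1 f]) simp
        have 3: "Ck_on k ?A (\<lambda>x. (snd c' \<circ> chart_inv C) (f ((snd C \<circ> chart_inv c) x)))"
        proof (rule Ck_on_compose[OF A B 2 Ck_on_transition[OF C c']])
          show "(\<lambda>x. f ((snd C \<circ> chart_inv c) x)) ` ?A \<subseteq> snd C ` (fst C \<inter> fst c')"
          proof
            fix y assume "y \<in> (\<lambda>x. f ((snd C \<circ> chart_inv c) x)) ` ?A"
            then obtain q where q: "q \<in> fst c" "q \<in> fst C" "?F q \<in> fst c'" "y = f (snd C q)" using c by auto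
            then show "y \<in> snd C ` (fst C \<inter> fst c')" using F_in[of q] by (metis IntI image_eqI)
          qed
        qed
        have "Ck_on k ?A (snd c' \<circ> ?F \<circ> chart_inv c)"
          by (subst Ck_on_cong[OF A, where g = "\<lambda>x. (snd c' \<circ> chart_inv C) (f ((snd C \<circ> chart_inv c) x))"])
            (use 3 F_in c in auto)
        with A p True pM show ?thesis by blast
      next
        case False
        let ?A = "snd c ` (fst c \<inter> ((points M - KM) \<inter> {p \<in> points M. ?F p \<in> fst c'}))"
        have A: "open ?A" by (rule open_chart_image[OF c pre[OF open_complement_KM]])
        have "Ck_on k ?A (snd c' \<circ> chart_inv c)"
          by (rule Ck_on_subset[OF Ck_on_transition[OF c c']]) (use F_out in auto)
        then have "Ck_on k ?A (snd c' \<circ> ?F \<circ> chart_inv c)"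
          by (subst Ck_on_cong[OF A, where g = "snd c' \<circ> chart_inv c"]) (use F_out c in auto)
        moreover have "p \<in> points M - KM" using False pM by (simp add: KM_iff)
        ultimately show ?thesis using A p pM by blast
      qed
    qed
    then show ?thesis unfolding smooth_on_open[OF S] by blast
  qed
  with cont show ?thesis unfolding smooth_map_def by blast
qed

lemma lift_map_Diff:
  assumes t: "t \<in> {0..1}"
  shows "lift_map M C (\<Phi> t) \<in> Diff M"
proof -
  let ?F = "lift_map M C (\<Phi> t)" and ?G = "lift_map M C (\<Psi> t)"
  note VV = F.\<Phi>_in_V[OF t] F.\<Psi>_in_V[OF t]
  have GF: "?G (?F p) = p" and FG: "?F (?G p) = p" if "p \<in> points M" for p
    by (rule lift_map_inverse; use VV F.\<Psi>(2,3)[OF t] that in simp)+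
  have FM: "?F p \<in> points M" and GM: "?G p \<in> points M" if "p \<in> points M" for p
    by (rule lift_map_in_points; use VV that in simp)+
  have bij: "bij_betw ?F (points M) (points M)"
    by (rule bij_betw_byWitness[where f' = ?G]) (use GF FG FM GM in auto)
  have inv: "inv_into (points M) ?F p = ?G p" if "p \<in> points M" for p
    using bij that GM FG by (intro inv_into_f_eq) (auto simp: bij_betw_def)
  have smF: "smooth_map M M ?F"
    by (rule smooth_map_lift_map) (use F.\<Phi>(1,2)[OF t] VV in auto)
  have smG: "smooth_map M M ?G"
    by (rule smooth_map_lift_map) (use F.\<Psi>(1)[OF t] F.\<Psi>_outside[OF t] VV in auto)
  have "smooth_map M M (inv_into (points M) ?F)"
    unfolding smooth_map_def
  proof (intro conjI ballI)
    show "continuous_map (man_top M) (man_top M) (inv_into (points M) ?F)"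
      by (rule continuous_map_eq[of _ _ ?G]) (use smG inv in \<open>auto simp: smooth_map_def\<close>)
    fix c c' assume c: "c \<in> atlas M" and c': "c' \<in> atlas M"
    \<comment> \<open>The inverse and the lift of \<open>\<Psi> t\<close> are compared on the
      carrier only, so smoothness is transferred chart by chart.\<close>
    have e: "inv_into (points M) ?F p = ?G p" if "p \<in> fst c" for p using inv chart_subset[OF c] that by blast
    then have S: "{p \<in> fst c. inv_into (points M) ?F p \<in> fst c'} = {p \<in> fst c. ?G p \<in> fst c'}" by auto
    have "smooth_on (snd c ` {p \<in> fst c. ?G p \<in> fst c'}) (snd c' \<circ> ?G \<circ> chart_inv c)"
      using smG c c' unfolding smooth_map_def by blast
    then show "smooth_on (snd c ` {p \<in> fst c. inv_into (points M) ?F p \<in> fst c'})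
        (snd c' \<circ> inv_into (points M) ?F \<circ> chart_inv c)"
      unfolding S by (rule smooth_on_cong) (use e c in auto)
  qed
  with bij smF show ?thesis by (simp add: Diff_def lift_map_def)
qed

lemma ham_flow_lift: "ham_flow M (ext_deriv M \<beta>) (lift_ham M C g) (\<lambda>t. lift_map M C (\<Phi> t))"
  unfolding ham_flow_def
proof (intro conjI ballI)
  show "lift_map M C (\<Phi> t) \<in> Diff M" if "t \<in> {0..1}" for t by (rule lift_map_Diff[OF that])
  fix p assume p: "p \<in> points M"
  show "lift_map M C (\<Phi> 0) p = p" using p C by (simp add: lift_map_def F.\<Phi>(3))
  show "integral_curve M H_field {0..1} (\<lambda>t. lift_map M C (\<Phi> t) p)" by (rule lift_curve[OF p])
qed

lemma lift_ham_in_Ham: "lift_ham M C g \<in> Ham M (ext_deriv M \<beta>)"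
proof -
  have "smooth_on ({0..1} \<times> snd c ` fst c) (\<lambda>(t, x). lift_ham M C g (t, chart_inv c x))" if c: "c \<in> atlas M" for c
    unfolding smooth_on_def
  proof
    fix z :: "real \<times> 'e"
    assume z: "z \<in> {0..1} \<times> snd c ` fst c"
    \<comment> \<open>The required smooth extension beyond \<open>{0..1}\<close>: as the Hamiltonian
      is constant in time, its values at time 0 serve for all real times.\<close>
    let ?V = "(UNIV :: real set) \<times> snd c ` fst c" and ?h = "\<lambda>z. lift_ham M C g (0, chart_inv c (snd z))"
    have "open ?V" using image_open[OF c] by (simp add: open_Times)
    moreover have "z \<in> ?V" using z by auto
    moreover have "Ck_on k ?V ?h" for k
      by (rule Ck_on_compose_snd[OF image_open[OF c] Ck_on_lift_ham[OF c]]) simp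
    moreover have "?h y = (case y of (t, x) \<Rightarrow> lift_ham M C g (t, chart_inv c x))"
      if "y \<in> ?V \<inter> {0..1} \<times> snd c ` fst c" for y
    proof -
      obtain t x where "y = (t, x)" "t \<in> {0..1}" "x \<in> snd c ` fst c" using \<open>y \<in> _\<close> by blast
      then show ?thesis using lift_ham_eq[OF c _ chart_inv_in] by simp
    qed
    ultimately show "\<exists>V h. open V \<and> z \<in> V \<and> (\<forall>k. Ck_on k V h) \<and>
        (\<forall>y\<in>V \<inter> {0..1} \<times> snd c ` fst c. h y = (case y of (t, x) \<Rightarrow> lift_ham M C g (t, chart_inv c x)))"
      by blast
  qed
  moreover have "lift_ham M C g \<in> extensional ({0..1} \<times> points M)" by (simp add: lift_ham_def)
  ultimately show ?thesis unfolding Ham_def using ham_flow_lift by blast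
qed

text \<open>The definite description is resolved by uniqueness of integral curves on the carrier;
  off the carrier both maps are \<open>undefined\<close>.\<close>

lemma time_one_map_lift: "time_one_map M (ext_deriv M \<beta>) (lift_ham M C g) = lift_map M C (\<Phi> 1)"
  unfolding time_one_map_def
proof (rule the_equality)
  show "\<exists>\<phi>. ham_flow M (ext_deriv M \<beta>) (lift_ham M C g) \<phi> \<and> lift_map M C (\<Phi> 1) = \<phi> 1"
    using ham_flow_lift by (intro exI[of _ "\<lambda>t. lift_map M C (\<Phi> t)"]) simp
  fix \<psi> assume "\<exists>\<phi>. ham_flow M (ext_deriv M \<beta>) (lift_ham M C g) \<phi> \<and> \<psi> = \<phi> 1"
  then obtain \<phi> where \<phi>: "ham_flow M (ext_deriv M \<beta>) (lift_ham M C g) \<phi>" "\<psi> = \<phi> 1" by blast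
  show "\<psi> = lift_map M C (\<Phi> 1)"
  proof (rule extensionalityI[of _ "points M"])
    show "\<psi> \<in> extensional (points M)" using \<phi> by (auto simp: ham_flow_def Diff_def)
    show "lift_map M C (\<Phi> 1) \<in> extensional (points M)" by (simp add: lift_map_def)
    fix p assume p: "p \<in> points M"
    show "\<psi> p = lift_map M C (\<Phi> 1) p"
      unfolding \<phi>(2)
    proof (rule integral_curve_unique)
      show "integral_curve M H_field {0..1} (\<lambda>t. \<phi> t p)" using \<phi>(1) p by (auto simp: ham_flow_def)
      show "integral_curve M H_field {0..1} (\<lambda>t. lift_map M C (\<Phi> t) p)" by (rule lift_curve[OF p])
      show "\<phi> 0 p = lift_map M C (\<Phi> 0) p" using \<phi>(1) ham_flow_lift p by (simp add: ham_flow_def)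
    qed simp
  qed
qed

end

section \<open>Degeneracy of the metric\<close>

context exact_chart
begin

text \<open>The form is multiplied by the same factor \<open>exp c\<close> at a translated point and
  at its translated image, so the factor cancels.\<close>

lemma symplectic_translate:
  assumes \<eta>: "symplectic \<eta>" "Ck_on 1 UNIV \<eta>"
  shows "symplectic (\<lambda>x. \<eta> (x - c *\<^sub>R e) + c *\<^sub>R e)"
  unfolding symplectic_def
proof (intro ballI conjI allI)
  fix x u w assume x: "x \<in> V"
  have x': "x - c *\<^sub>R e \<in> V" using translate_V[OF x, of "- c"] by simp
  then have \<eta>V: "\<eta> (x - c *\<^sub>R e) \<in> V" using \<eta>(1) unfolding symplectic_def by blast
  then show "\<eta> (x - c *\<^sub>R e) + c *\<^sub>R e \<in> V" by (rule translate_V)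
  have d\<eta>: "(\<eta> has_derivative frechet_derivative \<eta> (at (x - c *\<^sub>R e))) (at (x - c *\<^sub>R e))"
    using Ck_on_has_derivative[of 0 UNIV \<eta>] \<eta>(2) by simp
  have "((\<lambda>x. \<eta> (x - c *\<^sub>R e)) has_derivative frechet_derivative \<eta> (at (x - c *\<^sub>R e))) (at x)"
    by (rule has_derivative_compose[of "\<lambda>x. x - c *\<^sub>R e" "\<lambda>v. v" _ _ \<eta>, OF _ d\<eta>]) (auto intro!: derivative_eq_intros)
  from has_derivative_add[OF this has_derivative_const]
  have "frechet_derivative (\<lambda>x. \<eta> (x - c *\<^sub>R e) + c *\<^sub>R e) (at x) = frechet_derivative \<eta> (at (x - c *\<^sub>R e))"
    by (intro frechet_derivative_eqI) simp
  then show "W (\<eta> (x - c *\<^sub>R e) + c *\<^sub>R e) (frechet_derivative (\<lambda>x. \<eta> (x - c *\<^sub>R e) + c *\<^sub>R e) (at x) u)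
      (frechet_derivative (\<lambda>x. \<eta> (x - c *\<^sub>R e) + c *\<^sub>R e) (at x) w) = W x u w"
    using \<eta>(1) x' W_translate[OF \<eta>V, of c] W_translate[OF x', of c] unfolding symplectic_def by simp
qed

text \<open>Provides the identity as an element of the group and the zero Hamiltonian as the base
  point for continuity.\<close>

lemma trivial_flow: "compact_hamiltonian_flow V \<beta> e (\<lambda>_. 0) (\<lambda>_. 0) {} (\<lambda>t x. x) (\<lambda>t x. x)"
proof
  show "W x 0 w = frechet_derivative (\<lambda>_. 0) (at x) w" if "x \<in> V" for x w
    using linear_0[OF linear_W1[OF that]] by simp
qed (auto intro: Ck_on_bounded_linear bounded_linear_ident)

end

context lifted_flow
begin

text \<open>Needed for membership in the function space that carries
  \<open>compact_open_topology\<close>.\<close>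

lemma continuous_lift_ham:
  "continuous_map (prod_topology (top_of_set {0..1}) (man_top M)) euclideanreal (lift_ham M C g)"
proof -
  let ?h = "\<lambda>p. lift_ham M C g (0, p)"
  have h_in: "?h p = g (snd C p)" if "p \<in> fst C" for p using lift_ham_eq[OF C, of 0 p] that by simp
  have h_out: "?h p = 0" if "p \<in> points M - KM" for p
    using that F.g(2) by (auto simp: lift_ham_def KM_iff)
  have "continuous_map (man_top M) euclideanreal ?h"
  proof (rule pasting_lemma[where I = UNIV and T = "\<lambda>b. if b then fst C else points M - KM" and f = "\<lambda>_. ?h"])
    fix b :: bool
    show "openin (man_top M) (if b then fst C else points M - KM)"
      using chart_open[OF C] open_complement_KM by simp
    show "continuous_map (subtopology (man_top M) (if b then fst C else points M - KM)) euclideanreal ?h"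
    proof (cases b)
      case True
      have "continuous_map euclidean euclideanreal g" using Ck_on_imp_continuous_on[OF F.g(1)[of 0]] by simp
      from continuous_map_compose[OF continuous_chart[OF C] this]
      have "continuous_map (subtopology (man_top M) (fst C)) euclideanreal ?h"
        by (rule continuous_map_eq) (use h_in in auto)
      then show ?thesis using True by simp
    next
      case False
      have "continuous_map (subtopology (man_top M) (points M - KM)) euclideanreal (\<lambda>_. 0)" by simp
      then have "continuous_map (subtopology (man_top M) (points M - KM)) euclideanreal ?h"
        by (rule continuous_map_eq) (use h_out in auto)
      then show ?thesis using False by simp
    qed
  next
    fix p assume "p \<in> points M"
    then show "\<exists>b. b \<in> UNIV \<and> p \<in> (if b then fst C else points M - KM) \<and> ?h p = ?h p"
      by (intro exI[of _ "p \<in> fst C"]) (auto simp: KM_iff)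
  qed simp
  from continuous_map_compose[OF continuous_map_snd this, of "top_of_set {0..1::real}"]
  show ?thesis by (rule continuous_map_eq) (auto simp: lift_ham_def)
qed

lemma lift_ham_support: "lift_ham M C g (t, p) \<noteq> 0 \<Longrightarrow> t \<in> {0..1} \<Longrightarrow> p \<in> points M \<Longrightarrow> p \<in> fst C \<and> snd C p \<in> K"
  using F.g(2) by (auto simp: lift_ham_def split: if_splits)

lemma lift_map_in_ham_group: "lift_map M C (\<Phi> 1) \<in> ham_group M (ext_deriv M \<beta>)"
  unfolding ham_group_def using lift_ham_in_Ham time_one_map_lift by (metis image_eqI)

text \<open>\<open>\<Phi> 1\<close> maps the chart image into itself, so the composition is computed
  in coordinates for any \<open>f\<close>.\<close>

lemma compose_lift_map: "compose (points M) (lift_map M C f) (lift_map M C (\<Phi> 1)) = lift_map M C (\<lambda>x. f (\<Phi> 1 x))"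
proof
  fix p
  show "compose (points M) (lift_map M C f) (lift_map M C (\<Phi> 1)) p = lift_map M C (\<lambda>x. f (\<Phi> 1 x)) p"
  proof (cases "p \<in> fst C")
    case True
    then have V: "\<Phi> 1 (snd C p) \<in> snd C ` fst C" using F.\<Phi>_in_V[of 1] by simp
    have "p \<in> points M" "chart_inv C (\<Phi> 1 (snd C p)) \<in> points M"
      using subsetD[OF chart_subset[OF C]] True chart_inv_in[OF V] by auto
    then show ?thesis
      using True chart_inv_in[OF V] chart_inv_right[OF V] by (simp add: lift_map_def compose_def)
  qed (simp add: lift_map_def compose_def)
qed

end

text \<open>With \<open>F\<close>, \<open>F'\<close> and \<open>T\<close> lifting
  \<open>\<Phi> 1\<close>, \<open>\<Phi>' 1\<close> and \<open>\<Theta> 1\<close>, right invariance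
  replaces \<open>F'\<close> and the identity by \<open>F' T = T F\<close> and \<open>T\<close>, and
  left invariance strips \<open>T\<close>. Stating conjugacy as an intertwining relation avoids the
  inverse of \<open>T\<close>.\<close>

lemma (in exact_manifold) distance_conjugate:
  assumes d: "bi_invariant_metric M (ham_group M (ext_deriv M \<beta>)) d" and C: "C \<in> atlas M"
    and chart: "exact_chart (snd C ` fst C) (local_form M \<beta> C) e"
    and F: "compact_hamiltonian_flow (snd C ` fst C) (local_form M \<beta> C) e g X K \<Phi> \<Psi>"
    and G: "compact_hamiltonian_flow (snd C ` fst C) (local_form M \<beta> C) e h Y L \<Theta> \<Xi>"
    and F': "compact_hamiltonian_flow (snd C ` fst C) (local_form M \<beta> C) e g' X' K' \<Phi>' \<Psi>'"
    and conj: "\<And>x. \<Phi>' 1 (\<Theta> 1 x) = \<Theta> 1 (\<Phi> 1 x)"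
  shows "d (lift_map M C (\<Phi>' 1)) (lift_map M C (\<lambda>x. x)) = d (lift_map M C (\<Phi> 1)) (lift_map M C (\<lambda>x. x))"
proof -
  interpret chart: exact_chart "snd C ` fst C" "local_form M \<beta> C" e by (rule chart)
  have lifted: "lifted_flow M \<beta> C e g X K \<Phi> \<Psi>"
    if "compact_hamiltonian_flow (snd C ` fst C) (local_form M \<beta> C) e g X K \<Phi> \<Psi>" for g X K \<Phi> \<Psi>
    by (rule lifted_flow.intro[OF exact_manifold_axioms that lifted_flow_axioms.intro[OF C]])
  interpret F: lifted_flow M \<beta> C e g X K \<Phi> \<Psi> by (rule lifted[OF F])
  interpret G: lifted_flow M \<beta> C e h Y L \<Theta> \<Xi> by (rule lifted[OF G])
  interpret F': lifted_flow M \<beta> C e g' X' K' \<Phi>' \<Psi>' by (rule lifted[OF F'])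
  interpret I: lifted_flow M \<beta> C e "\<lambda>_. 0" "\<lambda>_. 0" "{}" "\<lambda>t x. x" "\<lambda>t x. x" by (rule lifted[OF chart.trivial_flow])
  let ?G = "ham_group M (ext_deriv M \<beta>)" and ?c = "compose (points M)"
  let ?F = "lift_map M C (\<Phi> 1)" and ?F' = "lift_map M C (\<Phi>' 1)" and ?T = "lift_map M C (\<Theta> 1)" and ?I = "lift_map M C (\<lambda>x. x)"
  have inv: "d (?c \<phi> \<eta>) (?c \<psi> \<eta>) = d \<phi> \<psi>" "d (?c \<eta> \<phi>) (?c \<eta> \<psi>) = d \<phi> \<psi>"
    if "\<phi> \<in> ?G" "\<psi> \<in> ?G" "\<eta> \<in> ?G" for \<phi> \<psi> \<eta>
    using d that unfolding bi_invariant_metric_def by blast+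
  note in_G = F.lift_map_in_ham_group G.lift_map_in_ham_group F'.lift_map_in_ham_group I.lift_map_in_ham_group
  have "d ?F' ?I = d (?c ?F' ?T) (?c ?I ?T)" by (rule inv(1)[symmetric]) (rule in_G)+
  also have "?c ?F' ?T = ?c ?T ?F" by (simp add: G.compose_lift_map F.compose_lift_map conj)
  also have "?c ?I ?T = ?c ?T ?I" using G.compose_lift_map[of "\<lambda>x. x"] I.compose_lift_map[of "\<Theta> 1"] by simp
  also have "d (?c ?T ?F) (?c ?T ?I) = d ?F ?I" by (rule inv(2)) (rule in_G)+
  finally show ?thesis .
qed

text \<open>The property passes to finite intersections and to unions, so subbasic sets are
  enough.\<close>

lemma eventually_in_generated_topology:
  fixes Q :: "nat \<Rightarrow> 'a set"
  assumes "generate_topology_on \<S> A" "z \<in> A"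
    and "\<And>s. s \<in> \<S> \<Longrightarrow> z \<in> s \<Longrightarrow> \<exists>m. \<forall>n\<ge>m. Q n \<subseteq> s"
  shows "\<exists>m. \<forall>n\<ge>m. Q n \<subseteq> A"
  using assms(1,2)
proof (induction A rule: generate_topology_on.induct)
  case (Int a b)
  then obtain m m' where "\<forall>n\<ge>m. Q n \<subseteq> a" "\<forall>n\<ge>m'. Q n \<subseteq> b" by blast
  then show ?case by (intro exI[of _ "max m m'"]) simp
next
  case (UN \<K>)
  then obtain k where "k \<in> \<K>" "z \<in> k" by blast
  with UN.IH[OF this] show ?case by (meson Union_upper subset_trans)
qed (simp_all add: assms(3))

text \<open>On a compact set the s-coordinate is bounded, so functions supported high enough vanish
  there and meet the same subbasic conditions as zero. The inclusion is for all such functions at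
  once, because a Hamiltonian is picked only after the height is known.\<close>

lemma eventually_in_neighbourhood_of_zero:
  fixes T :: "(real \<times> 'p) topology" and c r :: real
  defines "X \<equiv> prod_topology (top_of_set {0..1::real}) T"
  assumes T: "continuous_map T euclideanreal fst" and c: "c > 0"
    and A: "openin (compact_open_topology X euclideanreal) A" "z \<in> A"
    and z: "\<And>w. w \<in> topspace X \<Longrightarrow> z w = 0"
  shows "\<exists>m. \<forall>n\<ge>m. {h \<in> extensional (topspace X). continuous_map X euclideanreal h \<and>
    (\<forall>w\<in>topspace X. h w \<noteq> 0 \<longrightarrow> real n * c - r \<le> fst (snd w))} \<subseteq> A"
proof (rule eventually_in_generated_topology[OF _ A(2)])
  show "generate_topology_on {{f \<in> extensional (topspace X). continuous_map X euclideanreal f \<and> f ` K \<subseteq> U} | K U.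
        compactin X K \<and> openin euclideanreal U} A"
    using A(1) unfolding compact_open_topology_def by (rule openin_topology_generated_by)
  fix s assume "s \<in> {{f \<in> extensional (topspace X). continuous_map X euclideanreal f \<and> f ` K \<subseteq> U} | K U.
        compactin X K \<and> openin euclideanreal U}" and zs: "z \<in> s"
  then obtain K U where s: "s = {f \<in> extensional (topspace X). continuous_map X euclideanreal f \<and> f ` K \<subseteq> U}"
    and K: "compactin X K" and U: "openin euclideanreal U" by blast
  have KX: "K \<subseteq> topspace X" using K by (rule compactin_subset_topspace)
  have "continuous_map X euclideanreal (fst \<circ> snd)"
    unfolding X_def by (rule continuous_map_compose[OF continuous_map_snd T])
  then have "compactin euclideanreal ((fst \<circ> snd) ` K)" using image_compactin[OF K] by blast
  then have "bounded ((fst \<circ> snd) ` K)" by (simp add: compact_imp_bounded)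
  then obtain B where B: "\<And>w. w \<in> K \<Longrightarrow> fst (snd w) \<le> B"
    unfolding bounded_iff by (auto simp: abs_le_iff)
  obtain m where m: "B + r < real m * c" using c ex_less_of_nat_mult by blast
  show "\<exists>m. \<forall>n\<ge>m. {h \<in> extensional (topspace X). continuous_map X euclideanreal h \<and>
    (\<forall>w\<in>topspace X. h w \<noteq> 0 \<longrightarrow> real n * c - r \<le> fst (snd w))} \<subseteq> s"
  proof (intro exI[of _ m] allI impI subsetI)
    fix n h assume n: "m \<le> n" and "h \<in> {h \<in> extensional (topspace X). continuous_map X euclideanreal h \<and>
      (\<forall>w\<in>topspace X. h w \<noteq> 0 \<longrightarrow> real n * c - r \<le> fst (snd w))}"
    then have h: "h \<in> extensional (topspace X)" "continuous_map X euclideanreal h"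
      "\<And>w. w \<in> topspace X \<Longrightarrow> h w \<noteq> 0 \<Longrightarrow> real n * c - r \<le> fst (snd w)" by auto
    have "real m * c \<le> real n * c" using n c by simp
    have "h w \<in> U" if w: "w \<in> K" for w
    proof -
      have "h w = 0"
      proof (rule ccontr)
        assume "h w \<noteq> 0"
        then have "real n * c - r \<le> fst (snd w)" using h(3) KX w by blast
        then show False using B[OF w] m \<open>real m * c \<le> real n * c\<close> by linarith
      qed
      moreover have "z w \<in> U" using zs w unfolding s by blast
      moreover have "z w = 0" using z KX w by blast
      ultimately show ?thesis by simp
    qed
    then show "h \<in> s" using h(1,2) unfolding s by blast
  qed
qed

theorem theorem5:
  fixes N :: "('p, 'e::euclidean_space) manifold"
    and \<alpha> :: "('p, 'e) one_form"
  assumes "contact_manifold N \<alpha>"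
    and "DIM('e) \<ge> 3"
    and "\<exists>\<gamma>. closed_characteristic N \<alpha> \<gamma>"
  shows "let M = symplectization N; \<omega> = symplectization_form N \<alpha>
         in \<not> (\<exists>d. bi_invariant_metric M (ham_group M \<omega>) d \<and> C_minus_one M \<omega> (ham_group M \<omega>) d)"
proof -
  define M where "M = symplectization N"
  define \<beta> where "\<beta> = liouville_form N \<alpha>"
  have \<omega>: "symplectization_form N \<alpha> = ext_deriv M \<beta>"
    unfolding M_def \<beta>_def by (rule symplectization_form_eq)
  have \<alpha>: "smooth_one_form N \<alpha>" and N: "smooth_manifold N"
    using assms(1) unfolding contact_manifold_def by auto
  interpret N: atlas_manifold N by (rule smooth_manifold_imp_atlas_manifold[OF N])
  interpret M: atlas_manifold M unfolding M_def by (rule N.atlas_manifold_symplectization)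
  have \<beta>: "smooth_one_form M \<beta>" unfolding M_def \<beta>_def by (rule N.smooth_one_form_liouville[OF \<alpha>])
  have chart: "exact_chart (snd (lift_chart c) ` fst (lift_chart c)) (local_form M \<beta> (lift_chart c)) (1, 0)"
    if "c \<in> atlas N" for c
    unfolding fst_lift_chart lift_chart_image M_def \<beta>_def by (rule exact_chart_liouville[OF assms(1) that])
  have atlas_M: "atlas M = lift_chart ` atlas N" by (simp add: M_def atlas_symplectization)
  interpret M: exact_manifold M \<beta>
  proof (rule exact_manifold.intro[OF M.atlas_manifold_axioms exact_manifold_axioms.intro[OF \<beta>]])
    fix C x u assume "C \<in> atlas M" "x \<in> snd C ` fst C" "\<And>w. form_ext (local_form M \<beta> C) x u w = 0"
    then show "u = 0" using exact_chart.nondegenerate[OF chart] unfolding atlas_M by blast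
  qed
  obtain \<gamma> where "closed_characteristic N \<alpha> \<gamma>" using assms(3) by blast
  then have "continuous_map (top_of_set UNIV) (man_top N) \<gamma>"
    unfolding closed_characteristic_def integral_curve_def by blast
  then have "\<gamma> 0 \<in> points N" using continuous_map_image_subset_topspace by fastforce
  then obtain c0 where c0: "c0 \<in> atlas N" "\<gamma> 0 \<in> fst c0" using N.points_charts_at N.charts_at_iff by blast
  define C where "C = lift_chart c0"
  define V where "V = snd C ` fst C"
  define e :: "real \<times> 'e" where "e = (1, 0)"
  have C: "C \<in> atlas M" using c0 by (simp add: C_def atlas_M)
  interpret V: exact_chart V "local_form M \<beta> C" e unfolding V_def C_def e_def by (rule chart[OF c0(1)])
  let ?flow = "compact_hamiltonian_flow V (local_form M \<beta> C) e"
  have lifted: "lifted_flow M \<beta> C e g X K \<Phi> \<Psi>" if "?flow g X K \<Phi> \<Psi>" for g X K \<Phi> \<Psi>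
    by (rule lifted_flow.intro[OF M.exact_manifold_axioms that[unfolded V_def] lifted_flow_axioms.intro[OF C]])
  define z where "z = (0 :: real, snd c0 (\<gamma> 0))"
  have z: "z \<in> V" using c0 by (auto simp: z_def V_def C_def fst_lift_chart lift_chart_image)
  obtain H Y L \<Theta> \<Xi> r c where \<Theta>: "?flow H Y L \<Theta> \<Xi>" "V.symplectic (\<Theta> 1)" and r: "r > 0" and c: "c > 0"
    and zV: "cball z r \<subseteq> V" and push: "\<Theta> 1 ` cball z r \<subseteq> cball (z + c *\<^sub>R e) r"
    by (rule V.pushing_flow[OF z]) blast
  obtain g0 X0 \<Phi>0 \<Psi>0 y where \<Phi>0: "?flow g0 X0 (cball z r) \<Phi>0 \<Psi>0" and y: "y \<in> V" "\<Phi>0 1 y \<noteq> y"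
    by (rule V.nontrivial_flow[OF r zV]) blast
  let ?id = "lift_map M C (\<lambda>x. x)" and ?\<phi> = "lift_map M C (\<Phi>0 1)"
  define G where "G = ham_group M (ext_deriv M \<beta>)"
  have False if d: "bi_invariant_metric M G d" and Cd: "C_minus_one M (ext_deriv M \<beta>) G d" for d
  proof -
    \<comment> \<open>The induction carries the flow, its support and its distance to the identity.
      Step \<open>n\<close> conjugates with the translate of \<open>\<Theta>\<close> by
      \<open>n * c\<close>.\<close>
    have far: "\<exists>g X K \<Phi> \<Psi>. ?flow g X K \<Phi> \<Psi> \<and> K \<subseteq> cball (z + (real n * c) *\<^sub>R e) r \<and>
      d (lift_map M C (\<Phi> 1)) ?id = d ?\<phi> ?id" for n
    proof (induction n)
      case 0
      show ?case using \<Phi>0 by (intro exI conjI) auto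
    next
      case (Suc n)
      then obtain g X K \<Phi> \<Psi> where F: "?flow g X K \<Phi> \<Psi>" and K: "K \<subseteq> cball (z + (real n * c) *\<^sub>R e) r"
        and dF: "d (lift_map M C (\<Phi> 1)) ?id = d ?\<phi> ?id" by blast
      let ?b = "(real n * c) *\<^sub>R e"
      let ?\<eta> = "\<lambda>t x. \<Theta> t (x - ?b) + ?b" and ?\<theta> = "\<lambda>t x. \<Xi> t (x - ?b) + ?b"
      interpret \<Theta>: compact_hamiltonian_flow V "local_form M \<beta> C" e H Y L \<Theta> \<Xi> by (rule \<Theta>(1))
      note T = \<Theta>.translate[of "real n * c"]
      interpret T: compact_hamiltonian_flow V "local_form M \<beta> C" e "\<lambda>x. exp (real n * c) * H (x - ?b)" "\<lambda>x. Y (x - ?b)"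
        "(\<lambda>x. x + ?b) ` L" ?\<eta> ?\<theta> by (rule T)
      interpret F: compact_hamiltonian_flow V "local_form M \<beta> C" e g X K \<Phi> \<Psi> by (rule F)
      have "V.symplectic (?\<eta> 1)"
        using V.symplectic_translate[OF \<Theta>(2) \<Theta>.\<Phi>(1)] by simp
      then have F': "?flow (\<lambda>x. g (?\<theta> 1 x)) (\<lambda>x. frechet_derivative (?\<eta> 1) (at (?\<theta> 1 x)) (X (?\<theta> 1 x))) (?\<eta> 1 ` K)
          (\<lambda>t x. ?\<eta> 1 (\<Phi> t (?\<theta> 1 x))) (\<lambda>t x. ?\<eta> 1 (\<Psi> t (?\<theta> 1 x)))"
        by (intro F.conjugate T.\<Phi>(1) T.\<Psi>) auto
      have dn: "d (lift_map M C (\<lambda>x. ?\<eta> 1 (\<Phi> 1 (?\<theta> 1 x)))) ?id = d (lift_map M C (\<Phi> 1)) ?id"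
        by (rule M.distance_conjugate[OF d[unfolded G_def] C V.exact_chart_axioms[unfolded V_def] F[unfolded V_def]
              T[unfolded V_def] F'[unfolded V_def]]) (simp add: \<Theta>.\<Psi>(2))
      \<comment> \<open>Translating back puts the support into the original ball,
        \<open>push\<close> takes it into the ball shifted by \<open>c\<close>, and translating
        forward gives the next ball.\<close>
      have K': "?\<eta> 1 ` K \<subseteq> cball (z + (real (Suc n) * c) *\<^sub>R e) r"
      proof
        fix x assume "x \<in> ?\<eta> 1 ` K"
        then obtain k where k: "k \<in> K" "x = \<Theta> 1 (k - ?b) + ?b" by blast
        have "dist z (k - ?b) = dist (z + ?b) k" by (simp add: dist_norm algebra_simps)
        then have "k - ?b \<in> cball z r" using K k(1) by auto
        then have "\<Theta> 1 (k - ?b) \<in> cball (z + c *\<^sub>R e) r" using push by blast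
        moreover have "dist (z + (real (Suc n) * c) *\<^sub>R e) x = dist (z + c *\<^sub>R e) (\<Theta> 1 (k - ?b))"
          by (simp add: k(2) dist_norm algebra_simps)
        ultimately show "x \<in> cball (z + (real (Suc n) * c) *\<^sub>R e) r" by simp
      qed
      show ?case
        by (intro exI conjI, rule F', rule K', rule trans[OF dn dF])
    qed
    let ?X = "prod_topology (top_of_set {0..1::real}) (man_top M)"
    let ?A = "{H \<in> Ham M (ext_deriv M \<beta>). time_one_map M (ext_deriv M \<beta>) H \<in> G}"
    define T where "T = subtopology (compact_open_topology ?X euclideanreal) ?A"
    let ?\<tau> = "time_one_map M (ext_deriv M \<beta>)"
    interpret I: lifted_flow M \<beta> C e "\<lambda>_. 0" "\<lambda>_. 0" "{}" "\<lambda>t x. x" "\<lambda>t x. x" by (rule lifted[OF V.trivial_flow])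
    interpret F0: lifted_flow M \<beta> C e g0 X0 "cball z r" \<Phi>0 \<Psi>0 by (rule lifted[OF \<Phi>0])
    let ?H0 = "lift_ham M C (\<lambda>_. 0)"
    have metric: "Metric_space G d" using d unfolding bi_invariant_metric_def by blast
    have in_G: "?id \<in> G" "?\<phi> \<in> G"
      unfolding G_def using I.lift_map_in_ham_group F0.lift_map_in_ham_group .
    \<comment> \<open>\<open>\<Phi>0 1 y\<close> and \<open>y\<close> are distinct points of the
      chart image, where \<open>chart_inv C\<close> is injective.\<close>
    have "?\<phi> \<noteq> ?id"
    proof
      assume "?\<phi> = ?id"
      obtain p where p: "p \<in> fst C" "y = snd C p" using y(1) by (auto simp: V_def)
      then have pM: "p \<in> points M" using M.chart_subset[OF C] by blast
      have \<Phi>y: "\<Phi>0 1 y \<in> snd C ` fst C" using F0.F.\<Phi>_in_V[of 1 y] y(1) by (simp add: V_def)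
      have "chart_inv C (\<Phi>0 1 y) = chart_inv C y"
        using fun_cong[OF \<open>?\<phi> = ?id\<close>, of p] p pM by (simp add: lift_map_def)
      then have "snd C (chart_inv C (\<Phi>0 1 y)) = snd C (chart_inv C y)" by simp
      then show False using y \<Phi>y M.chart_inv_right unfolding V_def by metis
    qed
    then have pos: "d ?\<phi> ?id > 0" using Metric_space.mdist_pos_less[OF metric _ in_G(2,1)] by blast
    have ext: "lift_ham M C g \<in> extensional (topspace ?X)" for g by (simp add: lift_ham_def)
    have T_in: "lift_ham M C g \<in> topspace T" if F: "?flow g X K \<Phi> \<Psi>" for g X K \<Phi> \<Psi>
    proof -
      interpret F: lifted_flow M \<beta> C e g X K \<Phi> \<Psi> by (rule lifted[OF F])
      \<comment> \<open>The subbasic set belonging to the empty compact set contains all continuous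
        extensional functions, which places the lift in the carrier of the generated
        topology.\<close>
      have "lift_ham M C g \<in> {f \<in> extensional (topspace ?X). continuous_map ?X euclideanreal f \<and> f ` {} \<subseteq> UNIV}"
        using F.continuous_lift_ham ext by simp
      then have "lift_ham M C g \<in> topspace (compact_open_topology ?X euclideanreal)"
        unfolding compact_open_topology_def topology_generated_by_topspace
        using compactin_empty openin_topspace[of euclideanreal] by blast
      then show ?thesis
        using F.lift_ham_in_Ham F.lift_map_in_ham_group by (simp add: T_def F.time_one_map_lift G_def)
    qed
    have cont: "continuous_map (prod_topology T T) euclideanreal (\<lambda>(H, K). d (?\<tau> H) (?\<tau> K))"
      using Cd unfolding C_minus_one_def Let_def T_def .
    \<comment> \<open>A neighbourhood of the pair of zero Hamiltonians where distances stay strictly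
      below that of \<open>?\<phi>\<close> and the identity. Pairing a Hamiltonian supported far up
      with zero will land in it, against \<open>far\<close>.\<close>
    let ?U = "{w \<in> topspace (prod_topology T T). (case w of (H, K) \<Rightarrow> d (?\<tau> H) (?\<tau> K)) \<in> {..< d ?\<phi> ?id}}"
    have "openin (prod_topology T T) ?U"
      by (rule openin_continuous_map_preimage[OF cont]) simp
    moreover have H0T: "?H0 \<in> topspace T" by (rule T_in[OF V.trivial_flow])
    moreover have "d ?id ?id = 0" using Metric_space.mdist_zero[OF metric in_G(1)] .
    then have "(?H0, ?H0) \<in> ?U" using H0T pos by (simp add: I.time_one_map_lift)
    ultimately obtain A B where AB: "openin T A" "openin T B" "?H0 \<in> A" "?H0 \<in> B" "A \<times> B \<subseteq> ?U"
      unfolding openin_prod_topology_alt by meson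
    obtain A' where A': "openin (compact_open_topology ?X euclideanreal) A'" "A = A' \<inter> ?A"
      using AB(1) unfolding T_def openin_subtopology by blast
    have fst: "continuous_map (man_top M) euclideanreal fst"
      unfolding M_def man_top_symplectization by (rule continuous_map_fst)
    have H00: "?H0 w = 0" if "w \<in> topspace ?X" for w
      using that by (cases w) (auto simp: lift_ham_def)
    have "?H0 \<in> A'" using AB(3) A'(2) by blast
    from eventually_in_neighbourhood_of_zero[where r = r, OF fst c A'(1) this H00]
    obtain m where m: "{h \<in> extensional (topspace ?X). continuous_map ?X euclideanreal h \<and>
        (\<forall>w\<in>topspace ?X. h w \<noteq> 0 \<longrightarrow> real m * c - r \<le> fst (snd w))} \<subseteq> A'"
      by blast
    obtain g X K \<Phi> \<Psi> where F: "?flow g X K \<Phi> \<Psi>" and K: "K \<subseteq> cball (z + (real m * c) *\<^sub>R e) r"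
        and dF: "d (lift_map M C (\<Phi> 1)) ?id = d ?\<phi> ?id" using far[of m] by blast
    interpret F: lifted_flow M \<beta> C e g X K \<Phi> \<Psi> by (rule lifted[OF F])
    have "real m * c - r \<le> fst (snd w)" if w: "w \<in> topspace ?X" "lift_ham M C g w \<noteq> 0" for w
    proof -
      obtain t s p where tsp: "w = (t, s, p)" by (cases w) auto
      have "snd C (s, p) \<in> K" using F.lift_ham_support[of t "(s, p)"] w by (simp add: tsp)
      then have "dist (z + (real m * c) *\<^sub>R e) (snd C (s, p)) \<le> r" using K by auto
      \<comment> \<open>In a lifted chart the first coordinate is \<open>s\<close> itself, so the
        ball confines the height of the support.\<close>
      then have "dist (fst (z + (real m * c) *\<^sub>R e)) (fst (snd C (s, p))) \<le> r"
        using dist_fst_le order_trans by blast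
      then have "\<bar>real m * c - s\<bar> \<le> r" by (simp add: z_def e_def C_def snd_lift_chart dist_real_def)
      then show ?thesis by (simp add: tsp)
    qed
    then have "lift_ham M C g \<in> A'" using m ext F.continuous_lift_ham by blast
    then have "lift_ham M C g \<in> A"
      unfolding A'(2) using F.lift_ham_in_Ham F.lift_map_in_ham_group by (simp add: F.time_one_map_lift G_def)
    then have "(lift_ham M C g, ?H0) \<in> ?U" using AB(4,5) by blast
    then show False using dF by (simp add: F.time_one_map_lift I.time_one_map_lift)
  qed
  then show ?thesis unfolding Let_def \<omega> M_def[symmetric] G_def by blast
qed

end
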